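(* Let $\omega(x,y,t)$, $t\ge 0$, be a normalized time-dependent weight function on a compact domain $\Omega\subset\mathbb{R}^2$, with $\omega(x,y)=\omega(x,y,0)$, let $\{\mathbb{P}_n(t)\}_{n\ge 0}$ be the corresponding monic orthogonal polynomial system, and let $D_{n,i}(t)$, $C_{n,i}(t)$, $D_n(t)=D_{n,1}(t)+D_{n,2}(t)$, $C_n(t)=C_{n,1}(t)+C_{n,2}(t)$, $L_{n,i}$, $J_i(t)$, $A(t)$, $\omega_{h,k}(t)$, $S$, $S_{1,0}$, $S_{2,0}$ be the associated objects defined in the context. The following statements are equivalent (each identity being required for all $t\ge 0$): (i) The sequences $\{D_{n,i}(t)\}_{n\ge 0}$ and $\{C_{n,i}(t)\}_{n\ge 1}$, $i=1,2$, satisfy, for all $n\ge 1$, $$\dot D_{n,i}(t)=C_n(t)L_{n-1,i}-L_{n,i}C_{n+1}(t),\qquad \dot C_{n,i}(t)=C_n(t)D_{n-1,i}(t)-D_{n,i}(t)C_n(t).$$ (ii) For $i=1,2$, $\ \dot J_i=[A,J_i]=AJ_i-J_iA$. (iii) For all integers $h,k\ge 0$, $\ \dfrac{d}{dt}\big(J_1^hJ_2^k\big)=A\,J_1^hJ_2^k-J_1^hJ_2^k\,A$. (iv) For all integers $h,k\ge 0$, $\ \dot\omega_{h,k}=-\omega_{h+1,k}-\omega_{h,k+1}+\omega_{h,k}\,(\omega_{1,0}+\omega_{0,1})$. (v) The Stieltjes function satisfies $$\dot S(z_1,z_2,t)=(D_0(t)-z_1-z_2)\,S(z_1,z_2,t)+S_{1,0}(z_1,t)+S_{2,0}(z_2,t).$$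 (vi) The weight function is a solution of the differential equation $\ \dot\omega(x,y,t)=-(x+y-D_0(t))\,\omega(x,y,t)$. (vii) The weight function is given by $$\omega(x,y,t)=\frac{e^{-(x+y)t}\,\omega(x,y)}{\int_\Omega e^{-(x+y)t}\,\omega(x,y)\,dx\,dy}.$$ (viii) $\ \dot{\mathbb{P}}_n(t)=C_n(t)\,\mathbb{P}_{n-1}(t)$ for all $n\ge 1$ and $t\ge 0$.
   Context: Time-dependent weight. For each $t\ge 0$, $\omega(\cdot,\cdot,t)$ is a weight function on a compact domain $\Omega\subset\mathbb{R}^2$ such that $\langle p,q\rangle_t=\int_\Omega p\,q\,\omega(x,y,t)\,dx\,dy$ is positive definite on real bivariate polynomials ($\langle p,p\rangle_t>0$ for $p\not\equiv0$). All moments $\omega_{h,k}(t)=\int_\Omega x^hy^k\omega(x,y,t)\,dx\,dy$, $h,k\ge0$, are finite, and $\omega_{0,0}(t)=1$ for all $t$. A dot denotes $d/dt$ (entrywise for vectors and matrices; for the weight and the polynomials, with $x,y$ fixed); the $t$-dependent quantities are assumed differentiable in $t$. Weight functions are identified when equal almost everywhere on $\Omega$. Vector notation. $\mathbb{X}_n=[x^n,x^{n-1}y,\dots,xy^{n-1},y^n]^\top$. The $(n+1)\times(n+2)$ matrices $L_{n,1}=[\,I_{n+1}\mid 0\,]$ and $L_{n,2}=[\,0\mid I_{n+1}\,]$ satisfy $L_{n,1}\mathbb{X}_{n+1}=x\mathbb{X}_n$ and $L_{n,2}\mathbb{X}_{n+1}=y\mathbb{X}_n$. For polynomial matrices $F,G$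 of compatible sizes, $\langle F,G\rangle_t=\int_\Omega F\,G\,\omega(x,y,t)\,dx\,dy$ entrywise. Monic orthogonal polynomial system. $\{\mathbb{P}_n(t)\}_{n\ge0}$ is the unique sequence of vector polynomials of size $n+1$ of the form $\mathbb{P}_n(t)=\mathbb{X}_n+\sum_{m=0}^{n-1}G^n_m(t)\mathbb{X}_m$, with $G^n_m(t)$ an $(n+1)\times(m+1)$ matrix independent of $x,y$, such that $\langle\mathbb{P}_n(t),\mathbb{P}_m(t)^\top\rangle_t=0$ for $n\ne m$ and $\langle\mathbb{P}_n(t),\mathbb{P}_n(t)^\top\rangle_t=H_n(t)$ is symmetric positive definite. Three term relations. There exist (unique) matrices $D_{n,i}(t)$ of size $(n+1)\times(n+1)$ ($n\ge0$) and $C_{n,i}(t)$ of size $(n+1)\times n$ ($n\ge1$), $i=1,2$, such that $$x\,\mathbb{P}_n=L_{n,1}\mathbb{P}_{n+1}+D_{n,1}\mathbb{P}_n+C_{n,1}\mathbb{P}_{n-1},\qquad y\,\mathbb{P}_n=L_{n,2}\mathbb{P}_{n+1}+D_{n,2}\mathbb{P}_n+C_{n,2}\mathbb{P}_{n-1},$$ with $\mathbb{P}_{-1}=0$. Put $D_n=D_{n,1}+D_{n,2}$ and $C_n=C_{n,1}+C_{n,2}$; in particular $D_0(t)=\omega_{1,0}(t)+\omega_{0,1}(t)$. Infinite block matrices. $J_i(t)$, $i=1,2$, is the infinite block tridiagonal matrix, with block rows and columns indexed by $n\ge0$, whose $(n,n)$ block is $D_{n,i}(t)$, whose $(n,n+1)$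 block is $L_{n,i}$, and whose $(n+1,n)$ block is $C_{n+1,i}(t)$, all other blocks being zero. $A(t)$ is the infinite block matrix whose $(n+1,n)$ block is $C_{n+1}(t)$ for $n\ge0$, all other blocks being zero. Stieltjes function. $S(z_1,z_2,t)=\int_\Omega\frac{\omega(x,y,t)}{(z_1-x)(z_2-y)}\,dx\,dy=\sum_{h,k\ge0}\frac{\omega_{h,k}(t)}{z_1^{h+1}z_2^{k+1}}$, regarded as a formal double power series (convergent for $|z_1|,|z_2|$ large); $\dot S$ is its termwise derivative in $t$. The marginal series are $S_{1,0}(z,t)=\sum_{h\ge0}\frac{\omega_{h,0}(t)}{z^{h+1}}$ and $S_{2,0}(z,t)=\sum_{k\ge0}\frac{\omega_{0,k}(t)}{z^{k+1}}$. *)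

theory Defs
  imports
    "HOL-Analysis.Analysis"
    "HOL-Computational_Algebra.Formal_Laurent_Series"
    "Jordan_Normal_Form.Matrix"
begin

unbundle no vec_syntax

text \<open>
  Time runs over \<open>{0..}\<close>, so every time derivative is taken within \<open>{0..}\<close> and is one-sided
  at \<open>t = 0\<close>. Dimension-indexed vectors and matrices are those of \<open>Jordan_Normal_Form\<close>, with
  0-based entries. The index \<open>i\<close> of the two coordinates ranges over \<open>{1, 2}\<close>.
\<close>

definition all_equivalent :: "bool list \<Rightarrow> bool" where
  "all_equivalent ps \<longleftrightarrow> (\<forall>p\<in>set ps. \<forall>q\<in>set ps. p \<longleftrightarrow> q)"


section \<open>The weight and its moments\<close>

text \<open>A bivariate polynomial is a polynomial in \<open>y\<close> whose coefficients are polynomials in \<open>x\<close>.\<close>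

definition poly2 :: "real poly poly \<Rightarrow> real \<Rightarrow> real \<Rightarrow> real" where
  "poly2 p x y = poly (poly p [:y:]) x"

definition wintegral :: "(real \<times> real) set \<Rightarrow> (real \<Rightarrow> real \<Rightarrow> real \<Rightarrow> real) \<Rightarrow> real
    \<Rightarrow> (real \<Rightarrow> real \<Rightarrow> real) \<Rightarrow> real" where
  "wintegral \<Omega> \<omega> t f = (LINT (x, y):\<Omega>|lebesgue. f x y * \<omega> x y t)"

definition moment :: "(real \<times> real) set \<Rightarrow> (real \<Rightarrow> real \<Rightarrow> real \<Rightarrow> real) \<Rightarrow> nat \<Rightarrow> nat
    \<Rightarrow> real \<Rightarrow> real" where
  "moment \<Omega> \<omega> h k t = wintegral \<Omega> \<omega> t (\<lambda>x y. x ^ h * y ^ k)"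

text \<open>
  Nonnegativity of the weight is not required separately: it follows, almost everywhere on \<open>\<Omega>\<close>,
  from positive definiteness, because polynomials are dense in the continuous functions on \<open>\<Omega>\<close>.
\<close>

definition normalized_weight ::
    "(real \<times> real) set \<Rightarrow> (real \<Rightarrow> real \<Rightarrow> real \<Rightarrow> real) \<Rightarrow> bool" where
  "normalized_weight \<Omega> \<omega> \<longleftrightarrow>
     compact \<Omega> \<and>
     (\<forall>t\<ge>0. \<forall>h k. set_integrable lebesgue \<Omega> (\<lambda>(x, y). x ^ h * y ^ k * \<omega> x y t)) \<and>
     (\<forall>t\<ge>0. \<forall>p. p \<noteq> 0 \<longrightarrow> wintegral \<Omega> \<omega> t (\<lambda>x y. poly2 p x y * poly2 p x y) > 0) \<and>
     (\<forall>t\<ge>0. moment \<Omega> \<omega> 0 0 t = 1)"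


section \<open>Entrywise time derivatives\<close>

definition vec_has_deriv :: "(real \<Rightarrow> real vec) \<Rightarrow> real vec \<Rightarrow> real \<Rightarrow> bool" where
  "vec_has_deriv v v' t \<longleftrightarrow>
     (\<forall>s\<ge>0. v s \<in> carrier_vec (dim_vec v')) \<and>
     (\<forall>r<dim_vec v'. ((\<lambda>s. v s $ r) has_real_derivative v' $ r) (at t within {0..}))"

definition mat_has_deriv :: "(real \<Rightarrow> real mat) \<Rightarrow> real mat \<Rightarrow> real \<Rightarrow> bool" where
  "mat_has_deriv M M' t \<longleftrightarrow>
     (\<forall>s\<ge>0. M s \<in> carrier_mat (dim_row M') (dim_col M')) \<and>
     (\<forall>r<dim_row M'. \<forall>c<dim_col M'.
        ((\<lambda>s. M s $$ (r, c)) has_real_derivative M' $$ (r, c)) (at t within {0..}))"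

definition mat_differentiable :: "(real \<Rightarrow> real mat) \<Rightarrow> real \<Rightarrow> bool" where
  "mat_differentiable M t \<longleftrightarrow> (\<exists>M'. mat_has_deriv M M' t)"


section \<open>Monic orthogonal polynomials and three term relations\<close>

definition Xvec :: "nat \<Rightarrow> real \<Rightarrow> real \<Rightarrow> real vec" where
  "Xvec n x y = vec (n + 1) (\<lambda>j. x ^ (n - j) * y ^ j)"

text \<open>\<open>L n 1 = [I | 0]\<close> and \<open>L n 2 = [0 | I]\<close>, of size \<open>(n + 1) \<times> (n + 2)\<close>.\<close>

definition L :: "nat \<Rightarrow> nat \<Rightarrow> real mat" where
  "L n i = mat (n + 1) (n + 2)
     (\<lambda>(r, c). if c = (if i = 1 then r else r + 1) then 1 else 0)"

text \<open>\<open>Pvec G n t x y = Xvec n x y + (\<Sum>m<n. G n m t *\<^sub>v Xvec m x y)\<close>, written entrywise because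
  vectors of a given dimension do not form a type.\<close>

definition Pvec :: "(nat \<Rightarrow> nat \<Rightarrow> real \<Rightarrow> real mat) \<Rightarrow> nat \<Rightarrow> real \<Rightarrow> real \<Rightarrow> real \<Rightarrow> real vec" where
  "Pvec G n t x y =
     vec (n + 1) (\<lambda>r. Xvec n x y $ r + (\<Sum>m<n. (G n m t *\<^sub>v Xvec m x y) $ r))"

text \<open>The matrix of the entrywise integrals of \<open>P\<^sub>n P\<^sub>m\<^sup>T\<close> against the weight.\<close>

definition Pgram :: "(real \<times> real) set \<Rightarrow> (real \<Rightarrow> real \<Rightarrow> real \<Rightarrow> real) \<Rightarrow>
    (nat \<Rightarrow> nat \<Rightarrow> real \<Rightarrow> real mat) \<Rightarrow> nat \<Rightarrow> nat \<Rightarrow> real \<Rightarrow> real mat" where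
  "Pgram \<Omega> \<omega> G n m t = mat (n + 1) (m + 1)
     (\<lambda>(r, c). wintegral \<Omega> \<omega> t (\<lambda>x y. Pvec G n t x y $ r * Pvec G m t x y $ c))"

definition sym_pos_def :: "nat \<Rightarrow> real mat \<Rightarrow> bool" where
  "sym_pos_def n H \<longleftrightarrow> H \<in> carrier_mat n n \<and> transpose_mat H = H \<and>
     (\<forall>v\<in>carrier_vec n. v \<noteq> 0\<^sub>v n \<longrightarrow> v \<bullet> (H *\<^sub>v v) > 0)"

definition monic_ops :: "(real \<times> real) set \<Rightarrow> (real \<Rightarrow> real \<Rightarrow> real \<Rightarrow> real) \<Rightarrow>
    (nat \<Rightarrow> nat \<Rightarrow> real \<Rightarrow> real mat) \<Rightarrow> bool" where
  "monic_ops \<Omega> \<omega> G \<longleftrightarrow>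
     (\<forall>t\<ge>0. \<forall>n. \<forall>m<n. G n m t \<in> carrier_mat (n + 1) (m + 1)) \<and>
     (\<forall>t\<ge>0. \<forall>n m. n \<noteq> m \<longrightarrow> Pgram \<Omega> \<omega> G n m t = 0\<^sub>m (n + 1) (m + 1)) \<and>
     (\<forall>t\<ge>0. \<forall>n. sym_pos_def (n + 1) (Pgram \<Omega> \<omega> G n n t))"

text \<open>\<open>D n i t\<close> and \<open>C n i t\<close> stand for \<open>D\<^bsub>n,i\<^esub>(t)\<close> and \<open>C\<^bsub>n,i\<^esub>(t)\<close>; the values \<open>C 0 i t\<close> are not used.\<close>

definition three_term :: "(nat \<Rightarrow> nat \<Rightarrow> real \<Rightarrow> real mat) \<Rightarrow> (nat \<Rightarrow> nat \<Rightarrow> real \<Rightarrow> real mat) \<Rightarrow>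
    (nat \<Rightarrow> nat \<Rightarrow> real \<Rightarrow> real mat) \<Rightarrow> bool" where
  "three_term G D C \<longleftrightarrow>
     (\<forall>t\<ge>0. \<forall>n. \<forall>i\<in>{1, 2}. D n i t \<in> carrier_mat (n + 1) (n + 1)) \<and>
     (\<forall>t\<ge>0. \<forall>n\<ge>1. \<forall>i\<in>{1, 2}. C n i t \<in> carrier_mat (n + 1) n) \<and>
     (\<forall>t\<ge>0. \<forall>i\<in>{1, 2}. \<forall>x y. (if i = 1 then x else y) \<cdot>\<^sub>v Pvec G 0 t x y =
        L 0 i *\<^sub>v Pvec G 1 t x y + D 0 i t *\<^sub>v Pvec G 0 t x y) \<and>
     (\<forall>t\<ge>0. \<forall>n\<ge>1. \<forall>i\<in>{1, 2}. \<forall>x y. (if i = 1 then x else y) \<cdot>\<^sub>v Pvec G n t x y =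
        L n i *\<^sub>v Pvec G (n + 1) t x y + D n i t *\<^sub>v Pvec G n t x y
          + C n i t *\<^sub>v Pvec G (n - 1) t x y)"

definition sum12 :: "(nat \<Rightarrow> nat \<Rightarrow> real \<Rightarrow> real mat) \<Rightarrow> nat \<Rightarrow> real \<Rightarrow> real mat" where
  "sum12 M n t = M n 1 t + M n 2 t"


section \<open>Infinite block matrices\<close>

text \<open>The block in position \<open>(m, n)\<close> has size \<open>(m + 1) \<times> (n + 1)\<close>.\<close>

type_synonym bmat = "nat \<Rightarrow> nat \<Rightarrow> real mat"

text \<open>In all products formed below only finitely many terms of the series are nonzero, since the
  factors have finitely many nonzero block diagonals.\<close>

definition bmat_mult :: "bmat \<Rightarrow> bmat \<Rightarrow> bmat" where
  "bmat_mult M N m n = mat (m + 1) (n + 1) (\<lambda>(r, c). \<Sum>k. (M m k * N k n) $$ (r, c))"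

definition bmat_one :: bmat where
  "bmat_one m n = (if m = n then 1\<^sub>m (n + 1) else 0\<^sub>m (m + 1) (n + 1))"

primrec bmat_pow :: "bmat \<Rightarrow> nat \<Rightarrow> bmat" where
  "bmat_pow M 0 = bmat_one"
| "bmat_pow M (Suc h) = bmat_mult M (bmat_pow M h)"

definition bmat_comm :: "bmat \<Rightarrow> bmat \<Rightarrow> bmat" where
  "bmat_comm M N m n = bmat_mult M N m n - bmat_mult N M m n"

definition bmat_has_deriv :: "(real \<Rightarrow> bmat) \<Rightarrow> bmat \<Rightarrow> real \<Rightarrow> bool" where
  "bmat_has_deriv M M' t \<longleftrightarrow> (\<forall>m n. mat_has_deriv (\<lambda>s. M s m n) (M' m n) t)"

definition Jmat :: "(nat \<Rightarrow> nat \<Rightarrow> real \<Rightarrow> real mat) \<Rightarrow> (nat \<Rightarrow> nat \<Rightarrow> real \<Rightarrow> real mat) \<Rightarrow>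
    nat \<Rightarrow> real \<Rightarrow> bmat" where
  "Jmat D C i t m n =
     (if n = m then D m i t
      else if n = m + 1 then L m i
      else if m = n + 1 then C m i t
      else 0\<^sub>m (m + 1) (n + 1))"

definition Amat :: "(nat \<Rightarrow> nat \<Rightarrow> real \<Rightarrow> real mat) \<Rightarrow> real \<Rightarrow> bmat" where
  "Amat C t m n = (if m = n + 1 then sum12 C m t else 0\<^sub>m (m + 1) (n + 1))"


section \<open>Formal Stieltjes series\<close>

text \<open>
  Formal double series in \<open>z1\<^sup>-\<^sup>1\<close>, \<open>z2\<^sup>-\<^sup>1\<close> are Laurent series whose variable is \<open>z2\<^sup>-\<^sup>1\<close> and whose
  coefficients are Laurent series in the variable \<open>z1\<^sup>-\<^sup>1\<close>.
\<close>

type_synonym dseries = "real fls fls"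

definition z1 :: dseries where "z1 = fls_const fls_X_inv"
definition z2 :: dseries where "z2 = fls_X_inv"

definition stieltjes :: "(real \<times> real) set \<Rightarrow> (real \<Rightarrow> real \<Rightarrow> real \<Rightarrow> real) \<Rightarrow> real \<Rightarrow> dseries" where
  "stieltjes \<Omega> \<omega> t = inverse z1 * inverse z2 *
     fps_to_fls (Abs_fps (\<lambda>k. fps_to_fls (Abs_fps (\<lambda>h. moment \<Omega> \<omega> h k t))))"

definition stieltjes10 :: "(real \<times> real) set \<Rightarrow> (real \<Rightarrow> real \<Rightarrow> real \<Rightarrow> real) \<Rightarrow> real \<Rightarrow> dseries" where
  "stieltjes10 \<Omega> \<omega> t = inverse z1 * fls_const (fps_to_fls (Abs_fps (\<lambda>h. moment \<Omega> \<omega> h 0 t)))"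

definition stieltjes20 :: "(real \<times> real) set \<Rightarrow> (real \<Rightarrow> real \<Rightarrow> real \<Rightarrow> real) \<Rightarrow> real \<Rightarrow> dseries" where
  "stieltjes20 \<Omega> \<omega> t = inverse z2 * fps_to_fls (Abs_fps (\<lambda>k. fls_const (moment \<Omega> \<omega> 0 k t)))"

definition dseries_has_deriv :: "(real \<Rightarrow> dseries) \<Rightarrow> dseries \<Rightarrow> real \<Rightarrow> bool" where
  "dseries_has_deriv F F' t \<longleftrightarrow>
     (\<forall>a b. ((\<lambda>s. fls_nth (fls_nth (F s) b) a) has_real_derivative fls_nth (fls_nth F' b) a)
              (at t within {0..}))"

end

theory Submission
  imports Defs
begin

text \<open>
  All eight statements describe one flow: the initial weight is damped by \<open>exp (- (x + y) t)\<close> and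
  renormalized. Each of them is shown to be equivalent to the differential equations for the moments.

  On the side of the weight, multiplying by the exponential of an antiderivative of the drift
  \<open>\<omega>\<^sub>1\<^sub>0 + \<omega>\<^sub>0\<^sub>1\<close> turns the moment equations into the linear hierarchy
  \<open>u' h k = - (u (h + 1) k + u h (k + 1))\<close>, which the moments of the damped initial weight solve as well.
  Solutions of geometric growth in \<open>h + k\<close>, locally uniformly in \<open>t\<close>, are unique
  (\<open>moment_hierarchy_zero\<close>), and positive definiteness yields such a bound without any control of the
  total variation of the weight (\<open>mom_bound\<close>). Since \<open>\<Omega>\<close> is compact, an integrable function is
  determined by its moments (\<open>AE_zero_if_moments_zero\<close>), and the explicit formula follows. The formula
  can be differentiated under the integral sign, which leads back to the moments. Between the formula
  and the differential equation of the weight stand the exceptional null sets, which depend on the time: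
  in one direction they are merged by restriction to rational times, in the other by Fubini, combined
  with the fact that an everywhere differentiable function whose derivative vanishes almost everywhere is
  constant. The Stieltjes series merely collects the moment equations as coefficients.

  On the side of the polynomials, write \<open>P\<close> for the infinite column of all \<open>P\<^sub>n\<close>. The three term relations
  are \<open>x P = J\<^sub>1 P\<close> and \<open>y P = J\<^sub>2 P\<close>, the last statement of the theorem is \<open>P' = A P\<close>, and \<open>A\<close> is the
  strictly lower block triangular part of \<open>J\<^sub>1 + J\<^sub>2\<close>. If \<open>P' = A P\<close>, then differentiating
  \<open>x\<^sup>h y\<^sup>k P = J\<^sub>1\<^sup>h J\<^sub>2\<^sup>k P\<close> and comparing coefficients gives the commutator equations for all products, in
  particular the Lax equations for \<open>J\<^sub>1\<close> and \<open>J\<^sub>2\<close>; the \<open>(0, 0)\<close> entries of the products are the moments,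
  and their commutator equations are the moment equations. Differentiating the orthogonality
  relations with the help of the moment equations gives \<open>P' = A P\<close> back. The Lax equations also imply
  \<open>P' = A P\<close>, since they make the defect \<open>P' - A P\<close> satisfy the recurrence of \<open>P\<close> with initial value \<open>0\<close>.
  Finally, the component equations are the blocks of the Lax equations, apart from two kinds of blocks
  that they do not contain: the one of \<open>D\<^sub>0\<close> and those two below the diagonal. Both are consequences
  of the commutation of \<open>J\<^sub>1\<close> and \<open>J\<^sub>2\<close>.
\<close>

section \<open>Integrable functions on a compact set and their moments\<close>

lemma set_integrable_continuous_mult:
  fixes w g :: "'a::euclidean_space \<Rightarrow> real"
  assumes S: "compact S" and w: "set_integrable lebesgue S w" and g: "continuous_on S g"
  shows "set_integrable lebesgue S (\<lambda>z. g z * w z)"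
proof -
  obtain B where B: "\<And>z. z \<in> S \<Longrightarrow> norm (g z) \<le> B"
    using compact_imp_bounded[OF compact_continuous_image[OF g S]] by (auto simp: bounded_iff)
  have Sb: "S \<in> sets borel" using S by (simp add: borel_compact)
  have gm: "(\<lambda>z. indicator S z *\<^sub>R g z) \<in> borel_measurable lebesgue"
    using borel_measurable_continuous_on_indicator[OF Sb g] by (simp add: measurable_completion)
  have "integrable lebesgue (\<lambda>z. (indicator S z *\<^sub>R g z) * (indicator S z *\<^sub>R w z))"
  proof (rule Bochner_Integration.integrable_bound)
    show "integrable lebesgue (\<lambda>z. B * (indicator S z *\<^sub>R w z))"
      using w by (simp add: set_integrable_def)
    show "(\<lambda>z. (indicator S z *\<^sub>R g z) * (indicator S z *\<^sub>R w z)) \<in> borel_measurable lebesgue"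
      using gm w by (intro borel_measurable_times) (auto simp: set_integrable_def)
    show "AE z in lebesgue. norm ((indicator S z *\<^sub>R g z) * (indicator S z *\<^sub>R w z))
        \<le> norm (B * (indicator S z *\<^sub>R w z))"
    proof (rule AE_I2)
      fix z
      show "norm ((indicator S z *\<^sub>R g z) * (indicator S z *\<^sub>R w z))
        \<le> norm (B * (indicator S z *\<^sub>R w z))"
        using B[of z] by (cases "z \<in> S") (auto simp: abs_mult intro!: mult_right_mono)
    qed
  qed
  moreover have "(\<lambda>z. (indicator S z *\<^sub>R g z) * (indicator S z *\<^sub>R w z))
      = (\<lambda>z. indicator S z *\<^sub>R (g z * w z))"
    by (auto simp: indicator_def fun_eq_iff)
  ultimately show ?thesis by (simp add: set_integrable_def)
qed

lemma set_integral_continuous_mult_bound: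
  fixes w g :: "'a::euclidean_space \<Rightarrow> real"
  assumes S: "compact S" and w: "set_integrable lebesgue S w" and g: "continuous_on S g"
    and B: "\<And>z. z \<in> S \<Longrightarrow> \<bar>g z\<bar> \<le> B"
  shows "\<bar>LINT z:S|lebesgue. g z * w z\<bar> \<le> B * (LINT z:S|lebesgue. \<bar>w z\<bar>)"
proof -
  have gw: "set_integrable lebesgue S (\<lambda>z. g z * w z)"
    by (rule set_integrable_continuous_mult[OF S w g])
  have aw: "set_integrable lebesgue S (\<lambda>z. \<bar>w z\<bar>)" by (rule set_integrable_abs[OF w])
  have "\<bar>LINT z:S|lebesgue. g z * w z\<bar> \<le> (LINT z:S|lebesgue. \<bar>g z * w z\<bar>)"
    using set_integral_norm_bound[OF gw] by simp
  also have "\<dots> \<le> (LINT z:S|lebesgue. B * \<bar>w z\<bar>)"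
    using aw set_integrable_abs[OF gw] B
    by (intro set_integral_mono) (auto simp: abs_mult intro!: mult_right_mono)
  finally show ?thesis by simp
qed

text \<open>By dominated convergence the hypothesis extends from continuous functions to indicators of closed sets,
  and from these, which are stable under intersection and generate the Borel sets, to all Borel sets.\<close>

lemma AE_zero_if_continuous_annihilated:
  fixes w :: "'a::euclidean_space \<Rightarrow> real"
  assumes S: "compact S" and w: "set_integrable lebesgue S w"
    and zero: "\<And>g. continuous_on UNIV g \<Longrightarrow> (LINT z:S|lebesgue. g z * w z) = 0"
  shows "AE z in lebesgue. z \<in> S \<longrightarrow> w z = 0"
proof -
  define f where "f = (\<lambda>z. indicator S z *\<^sub>R w z)"
  have f: "integrable lebesgue f" using w by (simp add: f_def set_integrable_def)
  \<comment> \<open>the indicator of a closed set is the limit of the continuous functions \<open>max 0 (1 - n dist)\<close>\<close>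
  have closed: "(LINT z:A|lebesgue. f z) = 0" if A: "closed A" for A
  proof (cases "A = {}")
    case False
    define g where "g n z = max 0 (1 - real n * infdist z A)" for n z
    have lim: "(\<lambda>n. g n z) \<longlonglongrightarrow> indicator A z" for z
    proof (cases "z \<in> A")
      case True then show ?thesis by (simp add: g_def)
    next
      case False
      then have "infdist z A > 0" using A \<open>A \<noteq> {}\<close>
        by (metis in_closed_iff_infdist_zero infdist_nonneg less_eq_real_def)
      then have "eventually (\<lambda>n. real n > 1 / infdist z A) sequentially"
        using filterlim_real_sequentially filterlim_at_top_dense by blast
      then have "eventually (\<lambda>n. g n z = indicator A z) sequentially"
        by eventually_elim (use False \<open>infdist z A > 0\<close> in \<open>simp add: g_def field_simps\<close>)
      then show ?thesis by (simp add: tendsto_eventually)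
    qed
    have gc: "continuous_on UNIV (g n)" for n
      unfolding g_def by (intro continuous_intros)
    have gm: "g n \<in> borel_measurable lebesgue" for n
      using borel_measurable_continuous_onI[OF gc] by (simp add: measurable_completion)
    have "(\<lambda>n. integral\<^sup>L lebesgue (\<lambda>z. g n z * f z)) \<longlonglongrightarrow> integral\<^sup>L lebesgue (\<lambda>z. indicator A z *\<^sub>R f z)"
    proof (rule integral_dominated_convergence[where w="\<lambda>z. \<bar>f z\<bar>"])
      show "(\<lambda>z. indicator A z *\<^sub>R f z) \<in> borel_measurable lebesgue"
        using f A by (intro borel_measurable_scaleR borel_measurable_indicator) (auto simp: borel_closed)
      show "(\<lambda>z. g n z * f z) \<in> borel_measurable lebesgue" for n
        using f gm by (intro borel_measurable_times) auto
      show "integrable lebesgue (\<lambda>z. \<bar>f z\<bar>)" using f by simp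
      show "AE z in lebesgue. (\<lambda>n. g n z * f z) \<longlonglongrightarrow> indicator A z *\<^sub>R f z"
        using lim by (intro AE_I2) (auto intro!: tendsto_mult)
      show "AE z in lebesgue. norm (g n z * f z) \<le> \<bar>f z\<bar>" for n
      proof (intro AE_I2)
        fix z have "\<bar>g n z\<bar> \<le> 1" using infdist_nonneg[of z A] by (auto simp: g_def)
        then show "norm (g n z * f z) \<le> \<bar>f z\<bar>"
          by (simp add: abs_mult mult_left_le_one_le)
      qed
    qed
    moreover have "integral\<^sup>L lebesgue (\<lambda>z. g n z * f z) = 0" for n
      using zero[OF gc, of n] by (simp add: f_def set_lebesgue_integral_def mult_ac)
    ultimately show ?thesis by (simp add: set_lebesgue_integral_def LIMSEQ_const_iff)
  qed (simp add: set_lebesgue_integral_def)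
  have borel: "(LINT z:A|lebesgue. f z) = 0" if "A \<in> sets borel" for A
  proof -
    have "Int_stable (Collect closed :: 'a set set)" by (auto simp: Int_stable_def)
    moreover have "Collect closed \<subseteq> Pow (UNIV :: 'a set)" by simp
    moreover have "A \<in> sigma_sets UNIV (Collect closed)" using that by (simp add: borel_eq_closed)
    ultimately show ?thesis
    proof (induction rule: sigma_sets_induct_disjoint)
      case (basic A) then show ?case by (simp add: closed)
    next
      case (compl A)
      then have "A \<in> sets borel" by (simp add: borel_eq_closed)
      then have Am: "A \<in> sets lebesgue" by (simp add: sets_completionI_sets)
      have "(LINT z:UNIV|lebesgue. f z) = (LINT z:A|lebesgue. f z) + (LINT z:(UNIV - A)|lebesgue. f z)"
        using set_integral_Un[of A "UNIV - A" lebesgue f] integrable_mult_indicator[OF Am f]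
          integrable_mult_indicator[OF sets.compl_sets[OF Am] f]
        by (simp add: set_integrable_def Un_Diff_cancel)
      moreover have "(LINT z:UNIV|lebesgue. f z) = 0" using closed[of UNIV] by simp
      ultimately show ?case using compl by simp
    next
      case (union F)
      have "F i \<in> sets borel" for i using union(2) by (auto simp: borel_eq_closed)
      then have Fm: "F i \<in> sets lebesgue" for i by (simp add: sets_completionI_sets)
      have "(LINT z:(\<Union>i. F i)|lebesgue. f z) = (\<Sum>i. (LINT z:F i|lebesgue. f z))"
      proof (rule lebesgue_integral_countable_add)
        show "\<And>i. F i \<in> sets lebesgue" by (rule Fm)
        show "\<And>i j. i \<noteq> j \<Longrightarrow> F i \<inter> F j = {}" using union(1) by (auto simp: disjoint_family_on_def)
        show "set_integrable lebesgue (\<Union>i. F i) f"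
          unfolding set_integrable_def using Fm f by (intro integrable_mult_indicator) auto
      qed
      then show ?case using union(3) by simp
    qed (simp add: set_lebesgue_integral_def)
  qed
  obtain f' where f': "f' \<in> borel_measurable lborel" "AE z in lborel. f z = f' z"
    using completion_ex_borel_measurable_real[of f lborel] f by auto
  have ae: "AE z in lebesgue. f z = f' z" using f'(2) by (rule AE_completion)
  have f'm: "f' \<in> borel_measurable lebesgue" using f'(1) by (rule measurable_completion)
  have "integrable lebesgue f'"
    using integrable_cong_AE[of f lebesgue f'] f f'm ae by auto
  then have f'i: "integrable lborel f'" using f'(1) by (simp add: integrable_completion)
  have "AE z in lborel. f' z = 0"
  proof (rule sigma_finite_measure.density_zero[OF sigma_finite_lborel f'i])
    fix A :: "'a set" assume A: "A \<in> sets lborel"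
    have Am: "A \<in> sets lebesgue" using A by auto
    have "(LINT z:A|lborel. f' z) = (LINT z:A|lebesgue. f' z)"
      unfolding set_lebesgue_integral_def using A f'(1)
      by (intro integral_completion[symmetric]) auto
    also have "\<dots> = (LINT z:A|lebesgue. f z)"
      unfolding set_lebesgue_integral_def
      using ae Am f'm f
      by (intro integral_cong_AE) (auto intro!: borel_measurable_scaleR borel_measurable_indicator)
    also have "\<dots> = 0" using borel[of A] A by simp
    finally show "(LINT z:A|lborel. f' z) = 0" .
  qed
  then have "AE z in lebesgue. f' z = 0" by (rule AE_completion)
  with ae show ?thesis
    by eventually_elim (auto simp: f_def)
qed

lemma continuous_on_real_polynomial_function:
  "real_polynomial_function p \<Longrightarrow> continuous_on S p"
  by (simp add: continuous_on_polymonial_function real_polynomial_function_eq)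

text \<open>Multiplying by a polynomial preserves the vanishing of all moments; it suffices to see this
  for the generators of the polynomial ring, because the property is closed under products.\<close>

lemma moments_zero_polynomial_mult:
  fixes w g p :: "real \<times> real \<Rightarrow> real"
  assumes S: "compact S" and w: "set_integrable lebesgue S w"
    and p: "real_polynomial_function p" and g: "continuous_on UNIV g"
    and zero: "\<And>h k. (LINT z:S|lebesgue. fst z ^ h * snd z ^ k * g z * w z) = 0"
  shows "(LINT z:S|lebesgue. fst z ^ h * snd z ^ k * (g z * p z) * w z) = 0"
  using p g zero
proof (induction p arbitrary: g h k rule: real_polynomial_function.induct)
  case (linear p)
  have lin: "p z = fst z * p (1, 0) + snd z * p (0, 1)" for z
  proof -
    have "p z = p (fst z *\<^sub>R (1, 0) + snd z *\<^sub>R (0, 1))" by (cases z) simp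
    also have "\<dots> = fst z * p (1, 0) + snd z * p (0, 1)"
      using linear(1) by (simp only: bounded_linear_def linear_add linear_scale real_scaleR_def)
    finally show ?thesis .
  qed
  have i: "set_integrable lebesgue S (\<lambda>z. (fst z ^ h * snd z ^ k * g z) * w z)" for h k
    using continuous_on_subset[OF linear(2) subset_UNIV[of S]]
    by (intro set_integrable_continuous_mult[OF S w] continuous_intros)
  have "(LINT z:S|lebesgue. fst z ^ h * snd z ^ k * (g z * p z) * w z)
      = (LINT z:S|lebesgue. p (1, 0) * (fst z ^ Suc h * snd z ^ k * g z * w z)
          + p (0, 1) * (fst z ^ h * snd z ^ Suc k * g z * w z))"
    by (subst lin) (simp add: algebra_simps)
  also have "\<dots> = 0"
    using i[of "Suc h" k] i[of h "Suc k"]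
    by (subst set_integral_add) (simp_all only: set_integrable_mult_right set_integral_mult_right linear(3)  mult_zero_right add_0)
  finally show ?case .
next
  case (const c)
  have "(LINT z:S|lebesgue. fst z ^ h * snd z ^ k * (g z * c) * w z)
      = (LINT z:S|lebesgue. c * (fst z ^ h * snd z ^ k * g z * w z))"
    by (simp add: mult_ac)
  then show ?case by (simp add: const(2))
next
  case (add p q)
  have i: "set_integrable lebesgue S (\<lambda>z. (fst z ^ h * snd z ^ k * (g z * r z)) * w z)"
    if "real_polynomial_function r" for r
    using continuous_on_subset[OF add(5) subset_UNIV[of S]] continuous_on_real_polynomial_function[OF that]
    by (intro set_integrable_continuous_mult[OF S w] continuous_intros)
  have "(LINT z:S|lebesgue. fst z ^ h * snd z ^ k * (g z * (p z + q z)) * w z)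
      = (LINT z:S|lebesgue. fst z ^ h * snd z ^ k * (g z * p z) * w z
          + fst z ^ h * snd z ^ k * (g z * q z) * w z)"
    by (simp add: algebra_simps)
  also have "\<dots> = 0"
    using i[OF add(1)] i[OF add(2)] add(3)[OF add(5,6)] add(4)[OF add(5,6)]
    by (subst set_integral_add) simp_all
  finally show ?case .
next
  case (mult p q)
  have "continuous_on UNIV (\<lambda>z. g z * p z)"
    using mult(5) continuous_on_real_polynomial_function[OF mult(1)] by (intro continuous_intros)
  from mult(4)[OF this, of h k] mult(3)[OF mult(5,6)] show ?case
    by (simp add: mult.assoc)
qed

text \<open>By the Stone-Weierstrass theorem, vanishing moments on a compact set imply that integration against
  \<open>w\<close> annihilates all continuous functions.\<close>

lemma AE_zero_if_moments_zero:
  fixes w :: "real \<times> real \<Rightarrow> real"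
  assumes S: "compact S" and w: "set_integrable lebesgue S w"
    and zero: "\<And>h k. (LINT z:S|lebesgue. fst z ^ h * snd z ^ k * w z) = 0"
  shows "AE z in lebesgue. z \<in> S \<longrightarrow> w z = 0"
proof (rule AE_zero_if_continuous_annihilated[OF S w])
  fix g :: "real \<times> real \<Rightarrow> real" assume g: "continuous_on UNIV g"
  let ?I = "LINT z:S|lebesgue. g z * w z" and ?N = "LINT z:S|lebesgue. \<bar>w z\<bar>"
  have N: "?N \<ge> 0" unfolding set_lebesgue_integral_def by (rule integral_nonneg_AE) simp
  have gS: "continuous_on S g" using g continuous_on_subset by blast
  have "\<bar>?I\<bar> \<le> e * ?N" if e: "e > 0" for e
  proof -
    obtain p where p: "real_polynomial_function p" "\<And>z. z \<in> S \<Longrightarrow> \<bar>g z - p z\<bar> < e"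
      using Stone_Weierstrass_real_polynomial_function[OF S gS e] by blast
    have pc: "continuous_on S p" by (rule continuous_on_real_polynomial_function[OF p(1)])
    have p0: "(LINT z:S|lebesgue. p z * w z) = 0"
      using moments_zero_polynomial_mult[OF S w p(1), of "\<lambda>_. 1" 0 0] zero by simp
    have "?I = (LINT z:S|lebesgue. g z * w z) - (LINT z:S|lebesgue. p z * w z)" by (simp add: p0)
    also have "\<dots> = (LINT z:S|lebesgue. (g z - p z) * w z)"
      by (subst set_integral_diff(2)[symmetric])
        (auto simp: algebra_simps intro: set_integrable_continuous_mult[OF S w] gS pc)
    also have "\<bar>\<dots>\<bar> \<le> e * ?N"
      using p(2) by (intro set_integral_continuous_mult_bound[OF S w] continuous_intros gS pc)
        (simp add: less_imp_le)
    finally show ?thesis .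
  qed
  note small = this
  show "?I = 0"
  proof (cases "?N = 0")
    case True
    then show ?thesis using small[of 1] by simp
  next
    case False
    then show ?thesis using small[of "\<bar>?I\<bar> / (2 * ?N)"] N by (cases "?I = 0") auto
  qed
qed

section \<open>Derivatives and growth estimates in one real variable\<close>

lemma at_within_Ici_interior: "(0::real) < t \<Longrightarrow> at t within {0..} = at t"
  by (rule at_within_interior) simp

lemma abs_exp_minus_one_minus_le: "\<bar>exp z - 1 - z\<bar> \<le> z\<^sup>2 * exp \<bar>z\<bar>" for z :: real
proof -
  obtain t where t: "\<bar>t\<bar> \<le> \<bar>z\<bar>" "exp z = (\<Sum>m<2. z ^ m / fact m) + exp t / fact 2 * z ^ 2"
    using Maclaurin_exp_le[of z 2] by blast
  have "\<bar>exp z - 1 - z\<bar> = exp t / 2 * z\<^sup>2"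
    using t(2) by (simp add: numeral_2_eq_2)
  also have "\<dots> \<le> exp \<bar>z\<bar> * z\<^sup>2"
    using t(1) exp_le_cancel_iff[of t "\<bar>z\<bar>"] exp_gt_zero[of "\<bar>z\<bar>"] by (intro mult_right_mono) (linarith, simp)
  finally show ?thesis by (simp add: mult.commute)
qed

text \<open>A quadratic error estimate, unlike a limit, can be integrated over a parameter without further ado;
  this is how derivatives are moved under the integral sign.\<close>

lemma DERIV_if_quadratic_error:
  fixes f :: "real \<Rightarrow> real"
  assumes "\<And>s. \<bar>s - t\<bar> < 1 \<Longrightarrow> \<bar>f s - f t - D * (s - t)\<bar> \<le> K * (s - t)\<^sup>2"
  shows "(f has_real_derivative D) (at t)"
  unfolding has_field_derivative_iff
proof -
  have "((\<lambda>s. (f s - f t) / (s - t) - D) \<longlongrightarrow> 0) (at t)"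
  proof (rule Lim_null_comparison[where g="\<lambda>s. K * \<bar>s - t\<bar>"])
    have "eventually (\<lambda>s. \<bar>s - t\<bar> < 1 \<and> s \<noteq> t) (at t)"
      by (auto simp: eventually_at dist_real_def intro: exI[of _ 1])
    then show "eventually (\<lambda>s. norm ((f s - f t) / (s - t) - D) \<le> K * \<bar>s - t\<bar>) (at t)"
    proof eventually_elim
      case (elim s)
      have "(f s - f t) / (s - t) - D = (f s - f t - D * (s - t)) / (s - t)"
        using elim by (simp add: field_simps)
      also have "\<bar>\<dots>\<bar> \<le> K * (s - t)\<^sup>2 / \<bar>s - t\<bar>"
        using assms[of s] elim by (simp add: divide_right_mono)
      also have "\<dots> = K * \<bar>s - t\<bar>"
      proof -
        have "(s - t)\<^sup>2 = \<bar>s - t\<bar> * \<bar>s - t\<bar>" by (simp add: power2_eq_square)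
        then show ?thesis using elim by (simp del: abs_mult_self_eq)
      qed
      finally show ?case by simp
    qed
    show "((\<lambda>s. K * \<bar>s - t\<bar>) \<longlongrightarrow> 0) (at t)"
      by (auto intro!: tendsto_eq_intros)
  qed
  then show "((\<lambda>s. (f s - f t) / (s - t)) \<longlongrightarrow> D) (at t)"
    by (simp add: LIM_zero_iff)
qed

lemma antiderivative_on_nonnegative:
  fixes a :: "real \<Rightarrow> real"
  assumes "continuous_on {0..} a"
  obtains F where "F 0 = 0" "\<And>t. t \<ge> 0 \<Longrightarrow> (F has_real_derivative a t) (at t within {0..})"
proof (rule that[of "\<lambda>u. integral {0..u} a"])
  show "integral {0..0} a = 0" by simp
next
  fix t :: real assume t: "t \<ge> 0"
  have "continuous_on {0..t+1} a" using assms by (rule continuous_on_subset) auto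
  then have "((\<lambda>u. integral {0..u} a) has_real_derivative a t) (at t within {0..t+1})"
    using t by (intro integral_has_real_derivative) auto
  moreover have "at t within {0..t+1} = at t within {0..}"
    using t by (intro at_within_nhd[of _ "{..<t+1}"]) auto
  ultimately show "((\<lambda>u. integral {0..u} a) has_real_derivative a t) (at t within {0..})" by simp
qed

text \<open>For moments the first hypothesis is a case of the Cauchy-Schwarz inequality. After \<open>n\<close> iterations the
  constant of the second one enters only through its root of order \<open>2 ^ n\<close>, whose upper limit is at most \<open>1\<close>.\<close>

lemma moment_bound_by_doubling:
  fixes m :: "nat \<Rightarrow> nat \<Rightarrow> real"
  assumes sq: "\<And>h k. (m h k)\<^sup>2 \<le> m (2 * h) (2 * k)"
    and bound: "\<And>h k. \<bar>m h k\<bar> \<le> N * R ^ (h + k)" and R: "R > 0"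
  shows "\<bar>m h k\<bar> \<le> R ^ (h + k)"
proof -
  have pow: "\<bar>m h k\<bar> ^ (2 ^ n) \<le> \<bar>m (2 ^ n * h) (2 ^ n * k)\<bar>" for n
  proof (induction n)
    case (Suc n)
    have "\<bar>m h k\<bar> ^ (2 ^ Suc n) = (\<bar>m h k\<bar> ^ (2 ^ n))\<^sup>2" by (simp add: power_mult[symmetric] mult.commute)
    also have "\<dots> \<le> (m (2 ^ n * h) (2 ^ n * k))\<^sup>2" using Suc by (metis power2_abs power_mono zero_le_power abs_ge_zero)
    also have "\<dots> \<le> \<bar>m (2 ^ Suc n * h) (2 ^ Suc n * k)\<bar>"
      using sq[of "2 ^ n * h" "2 ^ n * k"] by (simp add: mult.assoc)
    finally show ?case .
  qed simp
  define q where "q = \<bar>m h k\<bar> / R ^ (h + k)"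
  have qn: "q ^ (2 ^ n) \<le> N" for n
  proof -
    have "\<bar>m h k\<bar> ^ (2 ^ n) \<le> N * (R ^ (h + k)) ^ (2 ^ n)"
    proof -
      have "2 ^ n * h + 2 ^ n * k = (h + k) * 2 ^ n" by (simp add: algebra_simps)
      then show ?thesis
        using pow[of n] bound[of "2 ^ n * h" "2 ^ n * k"] by (simp add: power_mult[symmetric])
    qed
    then show ?thesis using R by (simp add: q_def power_divide field_simps)
  qed
  have "q \<le> 1"
  proof (rule ccontr)
    assume "\<not> q \<le> 1"
    then obtain n where n: "N < q ^ n" using real_arch_pow[of q N] by auto
    have "q ^ n \<le> q ^ (2 ^ n)" using \<open>\<not> q \<le> 1\<close> by (intro power_increasing) auto
    then show False using n qn[of n] by simp
  qed
  then show ?thesis using R by (simp add: q_def)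
qed

text \<open>Each integration of the hierarchy from \<open>0\<close> to \<open>t\<close> improves the bound by one order in \<open>t\<close>; the
  geometric growth in \<open>h + k\<close> costs a factor \<open>2 * R\<close>, so the bounds are the terms of an exponential
  series and tend to \<open>0\<close>.\<close>

lemma moment_hierarchy_zero:
  fixes d :: "nat \<Rightarrow> nat \<Rightarrow> real \<Rightarrow> real"
  assumes deriv: "\<And>h k t. t \<ge> 0 \<Longrightarrow>
      (d h k has_real_derivative - (d (Suc h) k t + d h (Suc k) t)) (at t within {0..})"
    and init: "\<And>h k. d h k 0 = 0"
    and bound: "\<And>h k t. 0 \<le> t \<Longrightarrow> t \<le> T \<Longrightarrow> \<bar>d h k t\<bar> \<le> K * R ^ (h + k)"
    and t: "0 \<le> t" "t \<le> T"
  shows "d h k t = 0"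
proof -
  have ind: "\<bar>d h k t\<bar> \<le> K * R ^ (h + k) * (2 * R * t) ^ n / fact n" if "0 \<le> t" "t \<le> T" for h k t n
    using that
  proof (induction n arbitrary: h k t)
    case 0 then show ?case using bound by simp
  next
    case (Suc n)
    define c where "c s = K * R ^ (h + k) * (2 * R * s) ^ Suc n / fact (Suc n)" for s
    have c': "(c has_real_derivative 2 * (K * R ^ (h + k + 1) * (2 * R * s) ^ n / fact n)) (at s)" for s
    proof -
      have "(c has_real_derivative K * R ^ (h + k) * (real (Suc n) * (2 * R * s) ^ n * (2 * R)) / fact (Suc n)) (at s)"
        unfolding c_def by (rule derivative_eq_intros refl | simp)+
      also have "K * R ^ (h + k) * (real (Suc n) * (2 * R * s) ^ n * (2 * R)) / fact (Suc n)
          = 2 * (K * R ^ (h + k + 1) * (2 * R * s) ^ n / fact n)"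
        by (simp add: field_simps del: of_nat_Suc)
      finally show ?thesis .
    qed
    have d': "(d h k has_real_derivative - (d (Suc h) k s + d h (Suc k) s)) (at s)" if "0 < s" for s
      using deriv[of s h k] that by (simp add: at_within_Ici_interior)
    have dc: "continuous_on {0..t} (d h k)"
    proof (rule DERIV_continuous_on)
      fix s assume "s \<in> {0..t}"
      then show "(d h k has_real_derivative - (d (Suc h) k s + d h (Suc k) s)) (at s within {0..t})"
        using deriv[of s h k] by (auto intro: DERIV_subset)
    qed
    have cc: "continuous_on {0..t} c" using c' by (intro DERIV_continuous_on) (auto intro: DERIV_subset)
    have small: "\<bar>d (Suc h) k s + d h (Suc k) s\<bar> \<le> 2 * (K * R ^ (h + k + 1) * (2 * R * s) ^ n / fact n)"
      if "0 < s" "s < t" for s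
      using Suc.IH[of s "Suc h" k] Suc.IH[of s h "Suc k"] that Suc.prems by simp
    have "c 0 + d h k 0 \<le> c t + d h k t"
    proof (rule DERIV_nonneg_imp_increasing_open[OF Suc.prems(1)])
      fix s assume s: "0 < s" "s < t"
      show "\<exists>y. ((\<lambda>s. c s + d h k s) has_real_derivative y) (at s) \<and> 0 \<le> y"
      proof -
        let ?b = "2 * (K * R ^ (h + k + 1) * (2 * R * s) ^ n / fact n)"
        let ?e = "d (Suc h) k s + d h (Suc k) s"
        have "((\<lambda>s. c s + d h k s) has_real_derivative ?b + - ?e) (at s)"
          by (rule DERIV_add[OF c' d'[OF s(1)]])
        moreover have "0 \<le> ?b + - ?e" using small[OF s] by linarith
        ultimately show ?thesis by blast
      qed
    qed (intro continuous_intros cc dc)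
    moreover have "c 0 - d h k 0 \<le> c t - d h k t"
    proof (rule DERIV_nonneg_imp_increasing_open[OF Suc.prems(1)])
      fix s assume s: "0 < s" "s < t"
      show "\<exists>y. ((\<lambda>s. c s - d h k s) has_real_derivative y) (at s) \<and> 0 \<le> y"
      proof -
        let ?b = "2 * (K * R ^ (h + k + 1) * (2 * R * s) ^ n / fact n)"
        let ?e = "d (Suc h) k s + d h (Suc k) s"
        have "((\<lambda>s. c s - d h k s) has_real_derivative ?b - - ?e) (at s)"
          by (rule DERIV_diff[OF c' d'[OF s(1)]])
        moreover have "0 \<le> ?b - - ?e" using small[OF s] by linarith
        ultimately show ?thesis by blast
      qed
    qed (intro continuous_intros cc dc)
    moreover have "c 0 = 0" by (simp add: c_def)
    ultimately have "\<bar>d h k t\<bar> \<le> c t" using init[of h k] by simp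
    then show ?case by (simp only: c_def)
  qed
  have "(\<lambda>n. (2 * R * t) ^ n / fact n) \<longlonglongrightarrow> 0"
    using summable_LIMSEQ_zero[OF summable_exp[of "2 * R * t"]] by (simp add: divide_inverse mult.commute)
  then have "(\<lambda>n. K * R ^ (h + k) * ((2 * R * t) ^ n / fact n)) \<longlonglongrightarrow> 0"
    by (rule tendsto_mult_right_zero)
  then have "\<bar>d h k t\<bar> \<le> 0"
  proof (rule tendsto_lowerbound)
    show "eventually (\<lambda>n. \<bar>d h k t\<bar> \<le> K * R ^ (h + k) * ((2 * R * t) ^ n / fact n)) sequentially"
      using ind[OF t, of h k] by simp
  qed simp
  then show ?thesis by simp
qed

text \<open>A function which is differentiable everywhere, not only almost everywhere, is the integral of its
  derivative in the Henstock-Kurzweil sense; a derivative that vanishes almost everywhere therefore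
  forces the function to be constant.\<close>

lemma constant_if_derivative_zero_AE:
  fixes g g' :: "real \<Rightarrow> real"
  assumes g: "\<And>t. t \<ge> 0 \<Longrightarrow> (g has_real_derivative g' t) (at t within {0..})"
    and zero: "AE t in lborel. t \<ge> 0 \<longrightarrow> g' t = 0" and T: "T \<ge> 0"
  shows "g T = g 0"
proof -
  have i1: "(g' has_integral g T - g 0) {0..T}"
    using T
    by (intro fundamental_theorem_of_calculus)
      (auto simp: has_real_derivative_iff_has_vector_derivative[symmetric] intro: DERIV_subset[OF g])
  have "negligible {t \<in> {0..T}. g' t \<noteq> 0}"
  proof -
    have "AE t in lebesgue. t \<ge> 0 \<longrightarrow> g' t = 0" using zero by (rule AE_completion)
    then obtain N where N: "{t \<in> space lebesgue. \<not> (t \<ge> 0 \<longrightarrow> g' t = 0)} \<subseteq> N"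
        "emeasure lebesgue N = 0" "N \<in> sets lebesgue"
      by (rule AE_E)
    then have "negligible N" by (simp add: negligible_iff_null_sets null_sets_def)
    then show ?thesis
      by (rule negligible_subset) (use N(1) in auto)
  qed
  then have i2: "(g' has_integral 0) {0..T}"
    by (rule has_integral_spike[OF _ _ has_integral_0]) simp
  show ?thesis using has_integral_unique[OF i1 i2] by simp
qed

text \<open>The second order Taylor remainder of the exponential function is bounded uniformly on the compact set.\<close>

lemma DERIV_exponential_integral:
  fixes w g u :: "'a::euclidean_space \<Rightarrow> real"
  assumes S: "compact S" and w: "set_integrable lebesgue S w"
    and g: "continuous_on S g" and u: "continuous_on S u"
  shows "((\<lambda>t. LINT z:S|lebesgue. g z * exp (- u z * t) * w z) has_real_derivative
    - (LINT z:S|lebesgue. u z * g z * exp (- u z * t) * w z)) (at t)"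
proof -
  obtain B0 where B0: "\<And>z. z \<in> S \<Longrightarrow> \<bar>u z\<bar> \<le> B0"
    using compact_imp_bounded[OF compact_continuous_image[OF u S]] by (auto simp: bounded_iff)
  obtain G0 where G0: "\<And>z. z \<in> S \<Longrightarrow> \<bar>g z\<bar> \<le> G0"
    using compact_imp_bounded[OF compact_continuous_image[OF g S]] by (auto simp: bounded_iff)
  define B where "B = max 0 B0"
  define A where "A = max 0 G0"
  have B: "\<bar>u z\<bar> \<le> B" "0 \<le> B" and G: "\<bar>g z\<bar> \<le> A" "0 \<le> A" if "z \<in> S" for z
    using B0[OF that] G0[OF that] by (auto simp: A_def B_def)
  define N where "N = (LINT z:S|lebesgue. \<bar>w z\<bar>)"
  have int: "set_integrable lebesgue S (\<lambda>z. f z * w z)" if "continuous_on S f" for f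
    by (rule set_integrable_continuous_mult[OF S w that])
  have N: "N \<ge> 0" unfolding N_def set_lebesgue_integral_def by (rule integral_nonneg_AE) simp
  show ?thesis
  proof (rule DERIV_if_quadratic_error[where K="A * exp (B * \<bar>t\<bar>) * (B\<^sup>2 * exp B) * N"])
    fix s assume s: "\<bar>s - t\<bar> < 1"
    let ?E = "\<lambda>z. g z * exp (- u z * t) * (exp (- u z * (s - t)) - 1 - (- u z * (s - t)))"
    have split: "?E z * w z = g z * exp (- u z * s) * w z - g z * exp (- u z * t) * w z
        + (s - t) * (u z * g z * exp (- u z * t) * w z)" for z
    proof -
      have "exp (- u z * t) * exp (- u z * (s - t)) = exp (- u z * s)"
        by (simp add: exp_add[symmetric] algebra_simps)
      moreover have "G * a * (b - 1 - (- v * d)) * W = G * (a * b) * W - G * a * W + d * (v * G * a * W)"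
        for G a b v d W :: real by (simp add: algebra_simps)
      ultimately show ?thesis by metis
    qed
    have "(LINT z:S|lebesgue. g z * exp (- u z * s) * w z) - (LINT z:S|lebesgue. g z * exp (- u z * t) * w z)
        - - (LINT z:S|lebesgue. u z * g z * exp (- u z * t) * w z) * (s - t)
        = (LINT z:S|lebesgue. ?E z * w z)"
      unfolding split
      by (subst set_integral_add set_integral_diff, (intro set_integral_add set_integral_diff set_integrable_mult_right int continuous_intros g u)+)+
         (simp add: mult.commute)
    also have "\<bar>\<dots>\<bar> \<le> (A * exp (B * \<bar>t\<bar>) * (B\<^sup>2 * exp B) * (s - t)\<^sup>2) * N"
      unfolding N_def
    proof (rule set_integral_continuous_mult_bound[OF S w])
      show "continuous_on S ?E" by (intro continuous_intros g u)
      fix z assume z: "z \<in> S"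
      have "- u z * t \<le> B * \<bar>t\<bar>"
        using B[OF z] mult_right_mono[of "\<bar>u z\<bar>" B "\<bar>t\<bar>"] by (simp add: abs_mult[symmetric])
      then have e1: "exp (- u z * t) \<le> exp (B * \<bar>t\<bar>)" by simp
      have zt: "\<bar>- u z * (s - t)\<bar> \<le> B * \<bar>s - t\<bar>"
        using B[OF z] by (simp add: abs_mult mult_right_mono)
      have "\<bar>exp (- u z * (s - t)) - 1 - (- u z * (s - t))\<bar>
          \<le> (- u z * (s - t))\<^sup>2 * exp \<bar>- u z * (s - t)\<bar>"
        by (rule abs_exp_minus_one_minus_le)
      also have "\<dots> \<le> (B * \<bar>s - t\<bar>)\<^sup>2 * exp B"
      proof (intro mult_mono)
        show "(- u z * (s - t))\<^sup>2 \<le> (B * \<bar>s - t\<bar>)\<^sup>2"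
          using zt by (metis abs_ge_zero power2_abs power_mono)
        have "B * \<bar>s - t\<bar> \<le> B" using s B[OF z] by (simp add: mult_left_le)
        then show "exp \<bar>- u z * (s - t)\<bar> \<le> exp B" using zt by simp
      qed auto
      finally have e2: "\<bar>exp (- u z * (s - t)) - 1 - (- u z * (s - t))\<bar> \<le> B\<^sup>2 * exp B * (s - t)\<^sup>2"
        by (simp add: power_mult_distrib mult_ac)
      have "\<bar>?E z\<bar> = \<bar>g z\<bar> * exp (- u z * t) * \<bar>exp (- u z * (s - t)) - 1 - (- u z * (s - t))\<bar>"
        by (simp add: abs_mult)
      also have "\<dots> \<le> A * exp (B * \<bar>t\<bar>) * (B\<^sup>2 * exp B * (s - t)\<^sup>2)"
        using e1 e2 G[OF z] by (intro mult_mono) auto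
      finally show "\<bar>?E z\<bar> \<le> A * exp (B * \<bar>t\<bar>) * (B\<^sup>2 * exp B) * (s - t)\<^sup>2"
        by (simp add: mult.assoc)
    qed
    finally show "\<bar>(LINT z:S|lebesgue. g z * exp (- u z * s) * w z) - (LINT z:S|lebesgue. g z * exp (- u z * t) * w z)
        - - (LINT z:S|lebesgue. u z * g z * exp (- u z * t) * w z) * (s - t)\<bar>
        \<le> A * exp (B * \<bar>t\<bar>) * (B\<^sup>2 * exp B) * N * (s - t)\<^sup>2"
      by (simp add: mult_ac)
  qed
qed

section \<open>Moments of a normalized weight\<close>

lemma poly2_simps [simp]:
  "poly2 0 x y = 0"
  "poly2 (p + q) x y = poly2 p x y + poly2 q x y"
  "poly2 (monom (monom c h) k) x y = c * x ^ h * y ^ k"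
  by (simp_all add: poly2_def poly_monom)

lemma poly2_sum: "poly2 (\<Sum>i\<in>I. p i) x y = (\<Sum>i\<in>I. poly2 (p i) x y)"
  by (induction I rule: infinite_finite_induct) simp_all

abbreviation continuous2 :: "(real \<Rightarrow> real \<Rightarrow> real) \<Rightarrow> bool" where
  "continuous2 f \<equiv> continuous_on UNIV (\<lambda>z. f (fst z) (snd z))"

locale weight_family =
  fixes \<Omega> :: "(real \<times> real) set" and \<omega> :: "real \<Rightarrow> real \<Rightarrow> real \<Rightarrow> real"
  assumes weight: "normalized_weight \<Omega> \<omega>"
begin

abbreviation \<mu> where "\<mu> \<equiv> wintegral \<Omega> \<omega>"
abbreviation mom where "mom \<equiv> moment \<Omega> \<omega>"

lemma compact: "compact \<Omega>"
  using weight by (simp add: normalized_weight_def)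

lemma mom_00 [simp]: "t \<ge> 0 \<Longrightarrow> mom 0 0 t = 1"
  using weight by (simp add: normalized_weight_def)

lemma wintegral_eq: "\<mu> t f = (LINT z:\<Omega>|lebesgue. f (fst z) (snd z) * \<omega> (fst z) (snd z) t)"
  by (simp add: wintegral_def case_prod_beta')

lemma mom_eq: "mom h k t = (LINT z:\<Omega>|lebesgue. fst z ^ h * snd z ^ k * \<omega> (fst z) (snd z) t)"
  by (simp add: moment_def wintegral_eq)

lemma weight_integrable:
  assumes "t \<ge> 0" shows "set_integrable lebesgue \<Omega> (\<lambda>z. \<omega> (fst z) (snd z) t)"
proof -
  have "set_integrable lebesgue \<Omega> (\<lambda>(x, y). x ^ 0 * y ^ 0 * \<omega> x y t)"
    using weight assms unfolding normalized_weight_def by blast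
  then show ?thesis by (simp add: case_prod_beta')
qed

lemma integrable2:
  assumes "t \<ge> 0" "continuous2 f"
  shows "set_integrable lebesgue \<Omega> (\<lambda>z. f (fst z) (snd z) * \<omega> (fst z) (snd z) t)"
  using assms continuous_on_subset[OF _ subset_UNIV]
  by (intro set_integrable_continuous_mult[OF compact weight_integrable])

lemma wintegral_add:
  assumes "t \<ge> 0" "continuous2 f" "continuous2 g"
  shows "\<mu> t (\<lambda>x y. f x y + g x y) = \<mu> t f + \<mu> t g"
  unfolding wintegral_eq using integrable2[OF assms(1,2)] integrable2[OF assms(1,3)]
  by (simp add: distrib_right set_integral_add)

lemma wintegral_mult: "\<mu> t (\<lambda>x y. c * f x y) = c * \<mu> t f"
  unfolding wintegral_eq by (simp add: mult.assoc)

lemma wintegral_diff: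
  assumes "t \<ge> 0" "continuous2 f" "continuous2 g"
  shows "\<mu> t (\<lambda>x y. f x y - g x y) = \<mu> t f - \<mu> t g"
  unfolding wintegral_eq using integrable2[OF assms(1,2)] integrable2[OF assms(1,3)]
  by (simp add: left_diff_distrib set_integral_diff)

lemma wintegral_sum:
  assumes "t \<ge> 0" "finite I" "\<And>i. i \<in> I \<Longrightarrow> continuous2 (f i)"
  shows "\<mu> t (\<lambda>x y. \<Sum>i\<in>I. f i x y) = (\<Sum>i\<in>I. \<mu> t (f i))"
  using assms(2,3)
proof (induction I rule: finite_induct)
  case empty then show ?case by (simp add: wintegral_eq)
next
  case (insert i I)
  have "\<mu> t (\<lambda>x y. \<Sum>j\<in>insert i I. f j x y) = \<mu> t (\<lambda>x y. f i x y + (\<Sum>j\<in>I. f j x y))"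
    using insert(1,2) by simp
  also have "\<dots> = \<mu> t (f i) + \<mu> t (\<lambda>x y. \<Sum>j\<in>I. f j x y)"
    using insert(4) by (intro wintegral_add[OF assms(1)] continuous_on_sum) auto
  finally show ?case using insert by simp
qed

lemma wintegral_square_nonneg:
  assumes "t \<ge> 0" shows "\<mu> t (\<lambda>x y. poly2 p x y * poly2 p x y) \<ge> 0"
proof (cases "p = 0")
  case True then show ?thesis by (simp add: wintegral_eq)
next
  case False then show ?thesis using weight assms by (simp add: normalized_weight_def less_imp_le)
qed

text \<open>Positive definiteness concerns formal polynomials; this form serves functions that are known as sums of
  monomials.\<close>

lemma zero_if_square_integral_zero:
  assumes t: "t \<ge> 0" and q: "\<And>x y. q x y = (\<Sum>i\<in>I. c i * x ^ a i * y ^ b i)"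
    and zero: "\<mu> t (\<lambda>x y. q x y * q x y) = 0"
  shows "q x y = 0"
proof -
  let ?p = "\<Sum>i\<in>I. monom (monom (c i) (a i)) (b i)"
  have p: "poly2 ?p x y = q x y" for x y by (simp add: poly2_sum q)
  have "?p = 0"
  proof (rule ccontr)
    assume "?p \<noteq> 0"
    then have "\<mu> t (\<lambda>x y. poly2 ?p x y * poly2 ?p x y) > 0"
      using weight t by (auto simp: normalized_weight_def)
    then show False using zero by (simp add: p)
  qed
  then show ?thesis using p[of x y] by simp
qed

text \<open>The square of \<open>x\<^sup>h y\<^sup>k - c\<close> has nonnegative integral; the best choice of \<open>c\<close> is the moment itself.\<close>

lemma mom_square_le:
  assumes t: "t \<ge> 0" shows "(mom h k t)\<^sup>2 \<le> mom (2 * h) (2 * k) t"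
proof -
  define c where "c = mom h k t"
  let ?p = "monom (monom 1 h) k + monom (monom (- c) 0) 0"
  have "0 \<le> \<mu> t (\<lambda>x y. poly2 ?p x y * poly2 ?p x y)"
    by (rule wintegral_square_nonneg[OF t])
  also have "(\<lambda>x y. poly2 ?p x y * poly2 ?p x y)
      = (\<lambda>x y. x ^ (2 * h) * y ^ (2 * k) + ((- 2 * c) * (x ^ h * y ^ k) + c\<^sup>2 * (x ^ 0 * y ^ 0)))"
  proof (intro ext)
    fix x y :: real
    define u where "u = x ^ h * y ^ k"
    have u: "x ^ (2 * h) * y ^ (2 * k) = u * u"
    proof -
      have "a ^ (2 * n) = a ^ n * a ^ n" for a :: real and n by (metis mult_2 power_add)
      then have "x ^ (2 * h) * y ^ (2 * k) = (x ^ h * x ^ h) * (y ^ k * y ^ k)" by (simp only:)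
      then show ?thesis by (simp add: u_def mult_ac)
    qed
    have "poly2 ?p x y = u - c" by (simp add: u_def)
    then show "poly2 ?p x y * poly2 ?p x y
        = x ^ (2 * h) * y ^ (2 * k) + ((- 2 * c) * (x ^ h * y ^ k) + c\<^sup>2 * (x ^ 0 * y ^ 0))"
      unfolding u by (simp add: u_def[symmetric] power2_eq_square algebra_simps)
  qed
  also have "\<mu> t \<dots> = \<mu> t (\<lambda>x y. x ^ (2 * h) * y ^ (2 * k))
      + (\<mu> t (\<lambda>x y. (- 2 * c) * (x ^ h * y ^ k)) + \<mu> t (\<lambda>x y. c\<^sup>2 * (x ^ 0 * y ^ 0)))"
  proof -
    have 1: "continuous2 (\<lambda>x y. x ^ (2 * h) * y ^ (2 * k))"
      and 2: "continuous2 (\<lambda>x y. (- 2 * c) * (x ^ h * y ^ k))"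
      and 3: "continuous2 (\<lambda>x y. c\<^sup>2 * (x ^ 0 * y ^ 0))"
      by (intro continuous_intros)+
    show ?thesis
      by (simp only: wintegral_add[OF t 1 continuous_on_add[OF 2 3]] wintegral_add[OF t 2 3])
  qed
  also have "\<dots> = mom (2 * h) (2 * k) t + ((- 2 * c) * c + c\<^sup>2)"
    using mom_00[OF t] by (simp only: wintegral_mult moment_def[symmetric] c_def mult_1_right)
  finally show ?thesis by (simp add: c_def power2_eq_square)
qed

lemma coordinates_bounded:
  obtains R where "R > 0" "\<And>z. z \<in> \<Omega> \<Longrightarrow> \<bar>fst z\<bar> \<le> R" "\<And>z. z \<in> \<Omega> \<Longrightarrow> \<bar>snd z\<bar> \<le> R"
proof -
  obtain R where R: "R > 0" "\<And>z. z \<in> \<Omega> \<Longrightarrow> norm z \<le> R"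
    using compact_imp_bounded[OF compact] by (auto simp: bounded_pos)
  show ?thesis
  proof (rule that[OF R(1)])
    fix z assume "z \<in> \<Omega>"
    then show "\<bar>fst z\<bar> \<le> R" "\<bar>snd z\<bar> \<le> R"
      using R(2)[of z] norm_fst_le[of "fst z" "snd z"] norm_snd_le[of "snd z" "fst z"] by auto
  qed
qed

lemma abs_monomial_le:
  assumes "\<bar>x\<bar> \<le> R" "\<bar>y\<bar> \<le> R" shows "\<bar>x ^ h * y ^ k\<bar> \<le> (R::real) ^ (h + k)"
  using assms by (auto simp: abs_mult power_abs power_add intro!: mult_mono power_mono)

text \<open>Uniqueness for the moment equations needs a bound that is uniform in the time. The total variation of
  the weight gives a bound at each time, and doubling the exponents removes it.\<close>

lemma mom_bound:
  assumes R: "R > 0" "\<And>z. z \<in> \<Omega> \<Longrightarrow> \<bar>fst z\<bar> \<le> R" "\<And>z. z \<in> \<Omega> \<Longrightarrow> \<bar>snd z\<bar> \<le> R" and t: "t \<ge> 0"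
  shows "\<bar>mom h k t\<bar> \<le> R ^ (h + k)"
proof (rule moment_bound_by_doubling[where m="\<lambda>h k. mom h k t" and N="LINT z:\<Omega>|lebesgue. \<bar>\<omega> (fst z) (snd z) t\<bar>"])
  fix h k
  have "\<bar>mom h k t\<bar> \<le> R ^ (h + k) * (LINT z:\<Omega>|lebesgue. \<bar>\<omega> (fst z) (snd z) t\<bar>)"
    unfolding mom_eq
    by (rule set_integral_continuous_mult_bound[OF compact weight_integrable[OF t]])
      (auto intro!: continuous_intros abs_monomial_le R)
  then show "\<bar>mom h k t\<bar> \<le> (LINT z:\<Omega>|lebesgue. \<bar>\<omega> (fst z) (snd z) t\<bar>) * R ^ (h + k)"
    by (simp add: mult.commute)
qed (use mom_square_le[OF t] R in auto)

text \<open>The moments of the damped initial weight before normalization; \<open>damped 0 0\<close> is the normalizing integral.\<close>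

definition damped :: "nat \<Rightarrow> nat \<Rightarrow> real \<Rightarrow> real" where
  "damped h k t = (LINT z:\<Omega>|lebesgue. fst z ^ h * snd z ^ k * exp (- (fst z + snd z) * t) * \<omega> (fst z) (snd z) 0)"

lemma damped_deriv:
  "(damped h k has_real_derivative - (damped (Suc h) k t + damped h (Suc k) t)) (at t)"
proof -
  have int: "set_integrable lebesgue \<Omega> (\<lambda>z. fst z ^ h * snd z ^ k * exp (- (fst z + snd z) * t) * \<omega> (fst z) (snd z) 0)" for h k
    by (intro set_integrable_continuous_mult[OF compact] weight_integrable continuous_intros) simp
  have "(damped h k has_real_derivative - (LINT z:\<Omega>|lebesgue. (fst z + snd z) * (fst z ^ h * snd z ^ k)
      * exp (- (fst z + snd z) * t) * \<omega> (fst z) (snd z) 0)) (at t)"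
    unfolding damped_def[abs_def]
    by (rule DERIV_exponential_integral[OF compact weight_integrable]) (auto intro!: continuous_intros)
  also have "(LINT z:\<Omega>|lebesgue. (fst z + snd z) * (fst z ^ h * snd z ^ k)
      * exp (- (fst z + snd z) * t) * \<omega> (fst z) (snd z) 0)
    = (LINT z:\<Omega>|lebesgue. fst z ^ Suc h * snd z ^ k * exp (- (fst z + snd z) * t) * \<omega> (fst z) (snd z) 0
       + fst z ^ h * snd z ^ Suc k * exp (- (fst z + snd z) * t) * \<omega> (fst z) (snd z) 0)"
    by (simp add: algebra_simps)
  also have "\<dots> = damped (Suc h) k t + damped h (Suc k) t"
    unfolding damped_def by (rule set_integral_add(2)[OF int int])
  finally show ?thesis .
qed

lemma damped_bound:
  assumes R: "R > 0" "\<And>z. z \<in> \<Omega> \<Longrightarrow> \<bar>fst z\<bar> \<le> R" "\<And>z. z \<in> \<Omega> \<Longrightarrow> \<bar>snd z\<bar> \<le> R" and t: "0 \<le> t" "t \<le> T"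
  shows "\<bar>damped h k t\<bar> \<le> exp (2 * R * T) * (LINT z:\<Omega>|lebesgue. \<bar>\<omega> (fst z) (snd z) 0\<bar>) * R ^ (h + k)"
proof -
  have "\<bar>damped h k t\<bar> \<le> R ^ (h + k) * exp (2 * R * T) * (LINT z:\<Omega>|lebesgue. \<bar>\<omega> (fst z) (snd z) 0\<bar>)"
    unfolding damped_def
  proof (rule set_integral_continuous_mult_bound[OF compact weight_integrable])
    fix z assume z: "z \<in> \<Omega>"
    have "- (fst z + snd z) * t \<le> (2 * R) * T"
      using R(2,3)[OF z] t R(1) by (intro mult_mono) auto
    then have "exp (- (fst z + snd z) * t) \<le> exp (2 * R * T)" by simp
    moreover have "\<bar>fst z ^ h * snd z ^ k\<bar> \<le> R ^ (h + k)" by (rule abs_monomial_le[OF R(2,3)[OF z]])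
    ultimately have "\<bar>fst z ^ h * snd z ^ k\<bar> * exp (- (fst z + snd z) * t) \<le> R ^ (h + k) * exp (2 * R * T)"
      using R(1) by (intro mult_mono) auto
    then show "\<bar>fst z ^ h * snd z ^ k * exp (- (fst z + snd z) * t)\<bar> \<le> R ^ (h + k) * exp (2 * R * T)"
      by (simp add: abs_mult)
  qed (auto intro!: continuous_intros)
  then show ?thesis by (simp add: mult_ac)
qed

end

section \<open>Evolution of the moments and of the weight\<close>

lemma has_real_derivative_cong_nonnegative:
  assumes "(f has_real_derivative D) (at t within {0..})" "t \<ge> 0" "\<And>s. s \<ge> 0 \<Longrightarrow> f s = g s"
  shows "(g has_real_derivative D) (at t within {0..})"
  by (rule has_field_derivative_transform_within[OF assms(1), of 1]) (use assms in auto)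

lemma DERIV_exp_within:
  fixes g :: "real \<Rightarrow> real"
  assumes "(g has_real_derivative m) (at x within S)"
  shows "((\<lambda>x. exp (g x)) has_real_derivative exp (g x) * m) (at x within S)"
  using assms by (auto intro!: derivative_eq_intros)

lemma floor_grid_tendsto: "(\<lambda>n. real_of_int \<lfloor>real (Suc n) * t\<rfloor> / real (Suc n)) \<longlonglongrightarrow> t"
proof (rule real_tendsto_sandwich)
  have "t - 1 / real (Suc n) \<le> real_of_int \<lfloor>real (Suc n) * t\<rfloor> / real (Suc n)" for n
  proof -
    have "real (Suc n) * t - 1 \<le> real_of_int \<lfloor>real (Suc n) * t\<rfloor>" by linarith
    then have "(real (Suc n) * t - 1) / real (Suc n) \<le> real_of_int \<lfloor>real (Suc n) * t\<rfloor> / real (Suc n)"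
      by (rule divide_right_mono) simp
    then show ?thesis by (simp add: diff_divide_distrib del: of_nat_Suc)
  qed
  then show "\<forall>\<^sub>F n in sequentially. t - 1 / real (Suc n) \<le> real_of_int \<lfloor>real (Suc n) * t\<rfloor> / real (Suc n)"
    by simp
  have "real_of_int \<lfloor>real (Suc n) * t\<rfloor> / real (Suc n) \<le> t" for n
  proof -
    have "real_of_int \<lfloor>real (Suc n) * t\<rfloor> \<le> real (Suc n) * t" by linarith
    then have "real_of_int \<lfloor>real (Suc n) * t\<rfloor> / real (Suc n) \<le> real (Suc n) * t / real (Suc n)"
      by (rule divide_right_mono) simp
    then show ?thesis by (simp del: of_nat_Suc)
  qed
  then show "\<forall>\<^sub>F n in sequentially. real_of_int \<lfloor>real (Suc n) * t\<rfloor> / real (Suc n) \<le> t" by simp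
  show "(\<lambda>n. t - 1 / real (Suc n)) \<longlonglongrightarrow> t"
    using tendsto_diff[OF tendsto_const LIMSEQ_inverse_real_of_nat, of t] by (simp add: inverse_eq_divide)
qed simp

lemma sigma_finite_lebesgue: "sigma_finite_measure (lebesgue :: 'a::euclidean_space measure)"
proof
  obtain A :: "'a set set" where A: "countable A" "A \<subseteq> sets lborel" "\<Union>A = space lborel"
      "\<And>a. a \<in> A \<Longrightarrow> emeasure lborel a \<noteq> \<infinity>"
    using sigma_finite_measure.sigma_finite_countable[OF sigma_finite_lborel] by metis
  then show "\<exists>A::'a set set. countable A \<and> A \<subseteq> sets lebesgue \<and> \<Union>A = space lebesgue \<and> (\<forall>a\<in>A. emeasure lebesgue a \<noteq> \<infinity>)"
    by (intro exI[of _ A]) (auto simp: main_part_sets)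
qed

text \<open>Continuity in the second variable makes the function a limit of its restrictions to the grids of
  mesh \<open>1 / n\<close>, and these are jointly measurable because a grid is countable.\<close>

lemma measurable_pair_if_continuous_right:
  fixes f :: "'a \<Rightarrow> real \<Rightarrow> real"
  assumes meas: "\<And>t. (\<lambda>z. f z t) \<in> borel_measurable M" and cont: "\<And>z. continuous_on UNIV (f z)"
  shows "(\<lambda>p. f (fst p) (snd p)) \<in> borel_measurable (M \<Otimes>\<^sub>M lborel)"
proof (rule borel_measurable_LIMSEQ_real)
  fix p :: "'a \<times> real"
  have "isCont (f (fst p)) (snd p)" using cont by (simp add: continuous_on_eq_continuous_at)
  then show "(\<lambda>n. f (fst p) (real_of_int \<lfloor>real (Suc n) * snd p\<rfloor> / real (Suc n))) \<longlonglongrightarrow> f (fst p) (snd p)"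
    using floor_grid_tendsto by (rule isCont_tendsto_compose)
next
  fix n
  show "(\<lambda>p. f (fst p) (real_of_int \<lfloor>real (Suc n) * snd p\<rfloor> / real (Suc n))) \<in> borel_measurable (M \<Otimes>\<^sub>M lborel)"
  proof (rule measurable_compose_countable[where f="\<lambda>i p. f (fst p) (real_of_int i / real (Suc n))"])
    show "(\<lambda>p. f (fst p) (real_of_int i / real (Suc n))) \<in> borel_measurable (M \<Otimes>\<^sub>M lborel)" for i
      by (rule measurable_compose[OF measurable_fst meas])
    show "(\<lambda>p. \<lfloor>real (Suc n) * snd p\<rfloor>) \<in> measurable (M \<Otimes>\<^sub>M lborel) (count_space UNIV)"
      by measurable
  qed
qed

locale smooth_weight_family = weight_family +
  assumes diff_weight: "\<And>t x y. t \<ge> 0 \<Longrightarrow> (x, y) \<in> \<Omega> \<Longrightarrow> (\<lambda>s. \<omega> x y s) differentiable (at t within {0..})"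
    and diff_moment: "\<And>t h k. t \<ge> 0 \<Longrightarrow> (\<lambda>s. moment \<Omega> \<omega> h k s) differentiable (at t within {0..})"
begin

text \<open>It equals \<open>D\<^sub>0\<close>; in terms of moments it makes sense before the polynomials are introduced.\<close>

definition drift :: "real \<Rightarrow> real" where "drift t = mom 1 0 t + mom 0 1 t"

definition moment_equation :: bool where
  "moment_equation \<longleftrightarrow> (\<forall>t\<ge>0. \<forall>h k. (mom h k has_real_derivative
     - mom (h + 1) k t - mom h (k + 1) t + mom h k t * drift t) (at t within {0..}))"

definition weight_equation :: bool where
  "weight_equation \<longleftrightarrow> (\<forall>t\<ge>0. AE (x, y) in lebesgue. (x, y) \<in> \<Omega> \<longrightarrow>
     ((\<lambda>s. \<omega> x y s) has_real_derivative - (x + y - drift t) * \<omega> x y t) (at t within {0..}))"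

definition weight_formula :: bool where
  "weight_formula \<longleftrightarrow> (\<forall>t\<ge>0. AE (x, y) in lebesgue. (x, y) \<in> \<Omega> \<longrightarrow>
     \<omega> x y t = exp (- (x + y) * t) * \<omega> x y 0 / (LINT (x, y):\<Omega>|lebesgue. exp (- (x + y) * t) * \<omega> x y 0))"

lemma damped_00: "damped 0 0 t = (LINT (x, y):\<Omega>|lebesgue. exp (- (x + y) * t) * \<omega> x y 0)"
  by (simp add: damped_def case_prod_beta')

lemma weight_formula_alt: "weight_formula \<longleftrightarrow> (\<forall>t\<ge>0. AE z in lebesgue. z \<in> \<Omega> \<longrightarrow>
    \<omega> (fst z) (snd z) t = exp (- (fst z + snd z) * t) * \<omega> (fst z) (snd z) 0 / damped 0 0 t)"
  by (simp add: weight_formula_def damped_00 case_prod_beta')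

lemma weight_equation_alt: "weight_equation \<longleftrightarrow> (\<forall>t\<ge>0. AE z in lebesgue. z \<in> \<Omega> \<longrightarrow>
    (\<omega> (fst z) (snd z) has_real_derivative
      - (fst z + snd z - drift t) * \<omega> (fst z) (snd z) t) (at t within {0..}))"
  by (simp add: weight_equation_def case_prod_beta')

lemma sets_Omega: "\<Omega> \<in> sets lebesgue"
  using compact by (simp add: borel_compact sets_completionI_sets)

lemma continuous_drift: "continuous_on {0..} drift"
  unfolding drift_def[abs_def] continuous_on_eq_continuous_within
  using differentiable_imp_continuous_within[OF diff_moment] by (auto intro!: continuous_add)

text \<open>Normalization identifies the factor \<open>c\<close>, which is how the normalizing integral enters the explicit formula.\<close>

lemma damped_multiple:
  assumes t: "t \<ge> 0"
    and ae: "AE z in lebesgue. z \<in> \<Omega> \<longrightarrow>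
      \<omega> (fst z) (snd z) t = c * (exp (- (fst z + snd z) * t) * \<omega> (fst z) (snd z) 0)"
  shows "mom h k t = c * damped h k t" and "c * damped 0 0 t = 1"
proof -
  have *: "mom h k t = c * damped h k t" for h k
  proof -
    have i1: "set_integrable lebesgue \<Omega> (\<lambda>z. fst z ^ h * snd z ^ k * \<omega> (fst z) (snd z) t)"
      using t by (intro set_integrable_continuous_mult[OF compact] weight_integrable continuous_intros)
    have i2: "set_integrable lebesgue \<Omega> (\<lambda>z. c * (fst z ^ h * snd z ^ k * exp (- (fst z + snd z) * t) * \<omega> (fst z) (snd z) 0))"
      by (intro set_integrable_mult_right set_integrable_continuous_mult[OF compact] weight_integrable continuous_intros) simp
    have "mom h k t = (LINT z:\<Omega>|lebesgue. c * (fst z ^ h * snd z ^ k * exp (- (fst z + snd z) * t) * \<omega> (fst z) (snd z) 0))"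
      unfolding mom_eq set_lebesgue_integral_def
    proof (rule integral_cong_AE)
      show "AE z in lebesgue. indicator \<Omega> z *\<^sub>R (fst z ^ h * snd z ^ k * \<omega> (fst z) (snd z) t)
          = indicator \<Omega> z *\<^sub>R (c * (fst z ^ h * snd z ^ k * exp (- (fst z + snd z) * t) * \<omega> (fst z) (snd z) 0))"
        using ae by eventually_elim (auto simp: indicator_def)
    qed (use i1 i2 in \<open>auto simp: set_integrable_def dest: borel_measurable_integrable\<close>)
    then show ?thesis by (simp add: damped_def)
  qed
  show "mom h k t = c * damped h k t" by (rule *)
  show "c * damped 0 0 t = 1" using *[of 0 0] t by simp
qed

lemma weight_formula_imp_moments:
  assumes weight_formula "t \<ge> 0"
  shows "mom h k t = damped h k t / damped 0 0 t" and "damped 0 0 t \<noteq> 0"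
proof -
  have "AE z in lebesgue. z \<in> \<Omega> \<longrightarrow>
      \<omega> (fst z) (snd z) t = (1 / damped 0 0 t) * (exp (- (fst z + snd z) * t) * \<omega> (fst z) (snd z) 0)"
    using assms unfolding weight_formula_alt by simp
  from damped_multiple[OF assms(2) this] show "mom h k t = damped h k t / damped 0 0 t" "damped 0 0 t \<noteq> 0"
    by auto
qed

lemma weight_formula_if_multiple:
  assumes "\<And>t. t \<ge> 0 \<Longrightarrow> AE z in lebesgue. z \<in> \<Omega> \<longrightarrow>
      \<omega> (fst z) (snd z) t = c t * (exp (- (fst z + snd z) * t) * \<omega> (fst z) (snd z) 0)"
  shows weight_formula
  unfolding weight_formula_alt
proof (intro allI impI)
  fix t :: real assume t: "t \<ge> 0"
  have "c t * damped 0 0 t = 1" by (rule damped_multiple(2)[OF t assms[OF t]])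
  moreover from this have "damped 0 0 t \<noteq> 0" by auto
  ultimately have "c t = 1 / damped 0 0 t" by (simp add: eq_divide_eq)
  then show "AE z in lebesgue. z \<in> \<Omega> \<longrightarrow>
    \<omega> (fst z) (snd z) t = exp (- (fst z + snd z) * t) * \<omega> (fst z) (snd z) 0 / damped 0 0 t"
    using assms[OF t] by simp
qed

lemma weight_formula_imp_moment_equation:
  assumes weight_formula shows moment_equation
  unfolding moment_equation_def
proof (intro allI impI)
  fix t :: real and h k assume t: "t \<ge> 0"
  note m = weight_formula_imp_moments[OF assms]
  have "((\<lambda>t. damped h k t / damped 0 0 t) has_real_derivative
      (- (damped (Suc h) k t + damped h (Suc k) t) * damped 0 0 t
        - damped h k t * - (damped (Suc 0) 0 t + damped 0 (Suc 0) t)) / (damped 0 0 t * damped 0 0 t)) (at t within {0..})"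
    by (intro DERIV_divide has_field_derivative_at_within[OF damped_deriv] m t)
  also have "(- (damped (Suc h) k t + damped h (Suc k) t) * damped 0 0 t
        - damped h k t * - (damped (Suc 0) 0 t + damped 0 (Suc 0) t)) / (damped 0 0 t * damped 0 0 t)
      = - mom (h + 1) k t - mom h (k + 1) t + mom h k t * drift t"
    unfolding drift_def m(1)[OF t] using m(2)[OF t] by (simp add: field_simps)
  finally show "(mom h k has_real_derivative - mom (h + 1) k t - mom h (k + 1) t + mom h k t * drift t) (at t within {0..})"
    by (rule has_real_derivative_cong_nonnegative) (use m(1) t in auto)
qed

text \<open>With an antiderivative \<open>F\<close> of the drift, \<open>exp (- F)\<close> times the moments and the damped moments solve the
  same linear hierarchy with the same initial values, so they agree. Hence at each time the weight and a
  multiple of the damped initial weight have equal moments.\<close>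

lemma moment_equation_imp_weight_formula:
  assumes moment_equation shows weight_formula
proof -
  obtain F where F: "F 0 = 0" "\<And>t. t \<ge> 0 \<Longrightarrow> (F has_real_derivative drift t) (at t within {0..})"
    using antiderivative_on_nonnegative[OF continuous_drift] by blast
  obtain R where R: "R > 0" "\<And>z. z \<in> \<Omega> \<Longrightarrow> \<bar>fst z\<bar> \<le> R" "\<And>z. z \<in> \<Omega> \<Longrightarrow> \<bar>snd z\<bar> \<le> R"
    by (rule coordinates_bounded) blast
  define d where "d h k t = exp (- F t) * mom h k t - damped h k t" for h k t
  have damped_0: "damped h k 0 = mom h k 0" for h k by (simp add: damped_def mom_eq)
  have "d h k T = 0" if T: "T \<ge> 0" for h k T
  proof -
    have "continuous_on {0..T} (\<lambda>t. exp (- F t))"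
    proof -
      have "continuous_on {0..T} F"
        by (rule DERIV_continuous_on[where D=drift]) (auto intro: DERIV_subset[OF F(2)])
      then show ?thesis by (intro continuous_intros)
    qed
    then have "bounded ((\<lambda>t. exp (- F t)) ` {0..T})"
      by (intro compact_imp_bounded compact_continuous_image compact_Icc)
    then obtain E where E: "\<And>t. t \<in> {0..T} \<Longrightarrow> norm (exp (- F t)) \<le> E"
      unfolding bounded_iff by blast
    let ?N = "exp (2 * R * T) * (LINT z:\<Omega>|lebesgue. \<bar>\<omega> (fst z) (snd z) 0\<bar>)"
    show ?thesis
    proof (rule moment_hierarchy_zero[where d=d and T=T and K="E + ?N" and R=R])
      fix h k and t :: real assume t: "t \<ge> 0"
      have m: "(mom h k has_real_derivative - mom (h + 1) k t - mom h (k + 1) t + mom h k t * drift t) (at t within {0..})"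
        using assms t by (simp add: moment_equation_def)
      have "(d h k has_real_derivative
          (exp (- F t) * - drift t) * mom h k t
          + (- mom (h + 1) k t - mom h (k + 1) t + mom h k t * drift t) * exp (- F t)
          - - (damped (Suc h) k t + damped h (Suc k) t)) (at t within {0..})"
        unfolding d_def[abs_def]
        by (intro DERIV_diff DERIV_mult DERIV_exp_within DERIV_minus F(2) t m has_field_derivative_at_within[OF damped_deriv])
      then show "(d h k has_real_derivative - (d (Suc h) k t + d h (Suc k) t)) (at t within {0..})"
        by (simp add: d_def algebra_simps)
    next
      fix h k and t :: real assume t: "0 \<le> t" "t \<le> T"
      have "\<bar>exp (- F t) * mom h k t\<bar> \<le> E * R ^ (h + k)"
        using E[of t] t mom_bound[OF R t(1), of h k] order_trans[OF norm_ge_zero E[of t]]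
        by (auto simp: abs_mult intro!: mult_mono)
      moreover have "\<bar>damped h k t\<bar> \<le> ?N * R ^ (h + k)" by (rule damped_bound[OF R t])
      ultimately show "\<bar>d h k t\<bar> \<le> (E + ?N) * R ^ (h + k)"
        by (simp add: d_def distrib_right)
    qed (use T in \<open>auto simp: d_def F(1) damped_0\<close>)
  qed
  then have eq: "exp (- F t) * mom h k t = damped h k t" if "t \<ge> 0" for h k t
    using that by (simp add: d_def)
  show ?thesis
  proof (rule weight_formula_if_multiple[where c="\<lambda>t. exp (F t)"])
    fix t :: real assume t: "t \<ge> 0"
    have i1: "set_integrable lebesgue \<Omega> (\<lambda>z. fst z ^ h * snd z ^ k * \<omega> (fst z) (snd z) t)" for h k
      using t by (intro set_integrable_continuous_mult[OF compact] weight_integrable continuous_intros)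
    have i2: "set_integrable lebesgue \<Omega> (\<lambda>z. exp (F t) * (fst z ^ h * snd z ^ k * exp (- (fst z + snd z) * t) * \<omega> (fst z) (snd z) 0))" for h k
      by (intro set_integrable_mult_right set_integrable_continuous_mult[OF compact] weight_integrable continuous_intros) simp
    have "AE z in lebesgue. z \<in> \<Omega> \<longrightarrow>
      \<omega> (fst z) (snd z) t - exp (F t) * (exp (- (fst z + snd z) * t) * \<omega> (fst z) (snd z) 0) = 0"
    proof (rule AE_zero_if_moments_zero[OF compact])
      show "set_integrable lebesgue \<Omega> (\<lambda>z. \<omega> (fst z) (snd z) t
          - exp (F t) * (exp (- (fst z + snd z) * t) * \<omega> (fst z) (snd z) 0))"
        using set_integral_diff(1)[OF i1[of 0 0] i2[of 0 0]] by simp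
      fix h k
      have "(LINT z:\<Omega>|lebesgue. fst z ^ h * snd z ^ k * (\<omega> (fst z) (snd z) t
          - exp (F t) * (exp (- (fst z + snd z) * t) * \<omega> (fst z) (snd z) 0)))
        = (LINT z:\<Omega>|lebesgue. fst z ^ h * snd z ^ k * \<omega> (fst z) (snd z) t
          - exp (F t) * (fst z ^ h * snd z ^ k * exp (- (fst z + snd z) * t) * \<omega> (fst z) (snd z) 0))"
        by (simp add: right_diff_distrib mult_ac)
      also have "\<dots> = mom h k t - exp (F t) * damped h k t"
        by (simp only: set_integral_diff(2)[OF i1 i2] set_integral_mult_right mom_eq damped_def)
      also have "\<dots> = 0"
        unfolding eq[OF t, symmetric] by (simp add: mult.assoc[symmetric] exp_add[symmetric])
      finally show "(LINT z:\<Omega>|lebesgue. fst z ^ h * snd z ^ k * (\<omega> (fst z) (snd z) t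
          - exp (F t) * (exp (- (fst z + snd z) * t) * \<omega> (fst z) (snd z) 0))) = 0" .
    qed
    then show "AE z in lebesgue. z \<in> \<Omega> \<longrightarrow>
      \<omega> (fst z) (snd z) t = exp (F t) * (exp (- (fst z + snd z) * t) * \<omega> (fst z) (snd z) 0)"
      by simp
  qed
qed

text \<open>The exceptional null set of the formula depends on \<open>t\<close>; restricting to rational times leaves one
  null set, and continuity in \<open>t\<close> recovers the other times.\<close>

lemma weight_formula_imp_weight_equation:
  assumes wf: weight_formula shows weight_equation
proof -
  note m = weight_formula_imp_moments[OF wf]
  have Zd: "(damped 0 0 has_real_derivative - (damped (Suc 0) 0 t + damped 0 (Suc 0) t)) (at t within T)" for t T
    by (rule has_field_derivative_at_within[OF damped_deriv])
  define f where "f z t = exp (- (fst z + snd z) * t) * \<omega> (fst z) (snd z) 0 / damped 0 0 t" for z t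
  have "AE z in lebesgue. \<forall>n. \<forall>i::nat. z \<in> \<Omega> \<longrightarrow> \<omega> (fst z) (snd z) (real i / real (Suc n)) = f z (real i / real (Suc n))"
    unfolding AE_all_countable
  proof (intro allI)
    fix n i :: nat
    have "real i / real (Suc n) \<ge> 0" by simp
    then show "AE z in lebesgue. z \<in> \<Omega> \<longrightarrow> \<omega> (fst z) (snd z) (real i / real (Suc n)) = f z (real i / real (Suc n))"
      using wf unfolding weight_formula_alt f_def by blast
  qed
  then have *: "AE z in lebesgue. \<forall>t\<ge>0. z \<in> \<Omega> \<longrightarrow> \<omega> (fst z) (snd z) t = f z t"
  proof eventually_elim
    case (elim z)
    show ?case
    proof (intro allI impI)
      fix t :: real assume t: "t \<ge> 0" and z: "z \<in> \<Omega>"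
      define r where "r n = real_of_int \<lfloor>real (Suc n) * t\<rfloor> / real (Suc n)" for n
      have r: "r \<longlonglongrightarrow> t" unfolding r_def by (rule floor_grid_tendsto)
      have r0: "r n \<in> {0..}" for n using t by (simp add: r_def del: of_nat_Suc)
      have "r n = real (nat \<lfloor>real (Suc n) * t\<rfloor>) / real (Suc n)" for n
        using t by (simp add: r_def del: of_nat_Suc)
      then have eq: "\<omega> (fst z) (snd z) (r n) = f z (r n)" for n using elim z by metis
      have c1: "continuous (at t within {0..}) (\<omega> (fst z) (snd z))"
        using diff_weight[OF t, of "fst z" "snd z"] z by (auto intro: differentiable_imp_continuous_within)
      have c2: "continuous (at t within {0..}) (f z)"
        unfolding f_def using m(2)[OF t]
        by (intro continuous_intros DERIV_continuous[OF Zd])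
      have "(\<lambda>n. \<omega> (fst z) (snd z) (r n)) \<longlonglongrightarrow> \<omega> (fst z) (snd z) t"
        by (rule continuous_within_tendsto_compose'[OF c1 r0 r])
      moreover have "(\<lambda>n. f z (r n)) \<longlonglongrightarrow> f z t"
        by (rule continuous_within_tendsto_compose'[OF c2 r0 r])
      ultimately show "\<omega> (fst z) (snd z) t = f z t" unfolding eq by (rule LIMSEQ_unique)
    qed
  qed
  show ?thesis
    unfolding weight_equation_alt
  proof (intro allI impI)
    fix t :: real assume t: "t \<ge> 0"
    show "AE z in lebesgue. z \<in> \<Omega> \<longrightarrow> (\<omega> (fst z) (snd z) has_real_derivative
      - (fst z + snd z - drift t) * \<omega> (fst z) (snd z) t) (at t within {0..})"
      using *
    proof (eventually_elim, intro impI)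
      fix z assume eq: "\<forall>t\<ge>0. z \<in> \<Omega> \<longrightarrow> \<omega> (fst z) (snd z) t = f z t" and z: "z \<in> \<Omega>"
      have num: "((\<lambda>t. exp (- (fst z + snd z) * t) * \<omega> (fst z) (snd z) 0) has_real_derivative
          exp (- (fst z + snd z) * t) * (- (fst z + snd z)) * \<omega> (fst z) (snd z) 0) (at t within {0..})"
        by (auto intro!: derivative_eq_intros)
      have "(f z has_real_derivative
          ((exp (- (fst z + snd z) * t) * (- (fst z + snd z)) * \<omega> (fst z) (snd z) 0) * damped 0 0 t
           - (exp (- (fst z + snd z) * t) * \<omega> (fst z) (snd z) 0) * - (damped (Suc 0) 0 t + damped 0 (Suc 0) t))
            / (damped 0 0 t * damped 0 0 t)) (at t within {0..})"
        unfolding f_def[abs_def]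
        by (rule DERIV_divide[OF num Zd m(2)[OF t]])
      also have "((exp (- (fst z + snd z) * t) * (- (fst z + snd z)) * \<omega> (fst z) (snd z) 0) * damped 0 0 t
           - (exp (- (fst z + snd z) * t) * \<omega> (fst z) (snd z) 0) * - (damped (Suc 0) 0 t + damped 0 (Suc 0) t))
            / (damped 0 0 t * damped 0 0 t) = - (fst z + snd z - drift t) * f z t"
        unfolding drift_def m(1)[OF t] f_def using m(2)[OF t] by (simp add: field_simps)
      also have "f z t = \<omega> (fst z) (snd z) t" using eq t z by simp
      finally show "(\<omega> (fst z) (snd z) has_real_derivative
          - (fst z + snd z - drift t) * \<omega> (fst z) (snd z) t) (at t within {0..})"
        by (rule has_real_derivative_cong_nonnegative) (use eq z t in auto)
    qed
  qed
qed

text \<open>The exceptional null set of the differential equation depends on \<open>t\<close>. By Fubini, for almost every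
  point of \<open>\<Omega>\<close> the equation holds at almost every time, which is enough because the weight is
  differentiable at every time.\<close>

lemma weight_equation_imp_weight_formula:
  assumes we: weight_equation shows weight_formula
proof -
  obtain F where F: "F 0 = 0" "\<And>t. t \<ge> 0 \<Longrightarrow> (F has_real_derivative drift t) (at t within {0..})"
    using antiderivative_on_nonnegative[OF continuous_drift] by blast
  \<comment> \<open>continued to negative times as a constant and by zero outside \<open>\<Omega>\<close>, to be measurable on a product space\<close>
  define f where "f z t = indicator \<Omega> z * \<omega> (fst z) (snd z) (max 0 t)" for z t
  have f_in: "f z t = \<omega> (fst z) (snd z) t" if "z \<in> \<Omega>" "t \<ge> 0" for z t
    using that by (simp add: f_def)
  have fm: "(\<lambda>z. f z t) \<in> borel_measurable lebesgue" for t
    using weight_integrable[of "max 0 t"] unfolding f_def set_integrable_def by auto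
  have fc: "continuous_on UNIV (f z)" for z
  proof (cases "z \<in> \<Omega>")
    case True
    have "continuous_on {0..} (\<omega> (fst z) (snd z))"
      unfolding continuous_on_eq_continuous_within
      using diff_weight[of _ "fst z" "snd z"] True by (auto intro: differentiable_imp_continuous_within)
    then have "continuous_on UNIV (\<lambda>t. \<omega> (fst z) (snd z) (max 0 t))"
      by (rule continuous_on_compose2) (auto intro!: continuous_intros)
    then show ?thesis using True by (simp add: f_def[abs_def])
  next
    case False then show ?thesis by (simp add: f_def[abs_def])
  qed
  have driftm: "(\<lambda>t. drift (max 0 t)) \<in> borel_measurable borel"
    by (rule borel_measurable_continuous_onI, rule continuous_on_compose2[OF continuous_drift])
      (auto intro!: continuous_intros)
  \<comment> \<open>the derivative as a limit along a sequence, which makes it jointly measurable\<close>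
  define f' where "f' z t = lim (\<lambda>n. (f z (t + 1 / real (Suc n)) - f z t) * real (Suc n))" for z t
  have f'_eq: "f' z t = D"
    if z: "z \<in> \<Omega>" and t: "t \<ge> 0" and D: "(\<omega> (fst z) (snd z) has_real_derivative D) (at t within {0..})" for z t D
  proof -
    have "((\<lambda>s. (\<omega> (fst z) (snd z) s - \<omega> (fst z) (snd z) t) / (s - t)) \<longlongrightarrow> D) (at t within {0..})"
      using D by (simp add: has_field_derivative_iff)
    moreover have "filterlim (\<lambda>n. t + 1 / real (Suc n)) (at t within {0..}) sequentially"
    proof -
      have "(\<lambda>n. t + 1 / real (Suc n)) \<longlonglongrightarrow> t"
        using tendsto_add[OF tendsto_const LIMSEQ_inverse_real_of_nat, of t] by (simp add: inverse_eq_divide)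
      then show ?thesis using t by (simp add: filterlim_at del: of_nat_Suc)
    qed
    ultimately have "(\<lambda>n. (\<omega> (fst z) (snd z) (t + 1 / real (Suc n)) - \<omega> (fst z) (snd z) t)
        / (t + 1 / real (Suc n) - t)) \<longlonglongrightarrow> D"
      by (rule filterlim_compose)
    then have "(\<lambda>n. (f z (t + 1 / real (Suc n)) - f z t) * real (Suc n)) \<longlonglongrightarrow> D"
      using z t by (simp add: f_in del: of_nat_Suc)
    then show ?thesis unfolding f'_def by (rule limI)
  qed
  have fp: "(\<lambda>p. f (fst p) (snd p + c)) \<in> borel_measurable (lebesgue \<Otimes>\<^sub>M lborel)" for c
  proof (rule measurable_pair_if_continuous_right[where f="\<lambda>z t. f z (t + c)"])
    show "continuous_on UNIV (\<lambda>t. f z (t + c))" for z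
      by (rule continuous_on_compose2[OF fc]) (auto intro!: continuous_intros)
  qed (rule fm)
  have fp0: "(\<lambda>p. f (fst p) (snd p)) \<in> borel_measurable (lebesgue \<Otimes>\<^sub>M lborel)"
    using fp[of 0] by simp
  have f'm: "(\<lambda>p. f' (fst p) (snd p)) \<in> borel_measurable (lebesgue \<Otimes>\<^sub>M lborel)"
    unfolding f'_def using fp fp0 by (intro borel_measurable_lim_metric borel_measurable_times borel_measurable_diff) auto
  define P where "P z t \<longleftrightarrow> (z \<in> \<Omega> \<and> t \<ge> 0 \<longrightarrow> f' z t = - (fst z + snd z - drift (max 0 t)) * f z t)" for z t
  have Pm: "{p \<in> space (lebesgue \<Otimes>\<^sub>M lborel). P (fst p) (snd p)} \<in> sets (lebesgue \<Otimes>\<^sub>M lborel)"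
  proof -
    have [measurable]: "\<Omega> \<in> sets lebesgue" by (rule sets_Omega)
    have cm: "(\<lambda>z::real \<times> real. fst z + snd z) \<in> borel_measurable lebesgue"
      using borel_measurable_continuous_onI[of "\<lambda>z::real \<times> real. fst z + snd z"]
      by (simp add: measurable_completion continuous_on_fst continuous_on_snd continuous_on_add continuous_on_id)
    have [measurable]: "(\<lambda>p. fst (fst p) + snd (fst p)) \<in> borel_measurable ((lebesgue :: (real \<times> real) measure) \<Otimes>\<^sub>M (lborel :: real measure))"
      by (rule measurable_compose[OF measurable_fst cm])
    have [measurable]: "(\<lambda>p. drift (max 0 (snd p))) \<in> borel_measurable ((lebesgue :: (real \<times> real) measure) \<Otimes>\<^sub>M (lborel :: real measure))"
      by (rule measurable_compose[OF _ driftm]) simp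
    note [measurable] = fp0 f'm
    show ?thesis unfolding P_def by measurable
  qed
  have "AE t in lborel. AE z in lebesgue. P z t"
  proof (rule AE_I2)
    fix t :: real
    show "AE z in lebesgue. P z t"
    proof (cases "t \<ge> 0")
      case True
      then have "AE z in lebesgue. z \<in> \<Omega> \<longrightarrow> (\<omega> (fst z) (snd z) has_real_derivative
          - (fst z + snd z - drift t) * \<omega> (fst z) (snd z) t) (at t within {0..})"
        using we unfolding weight_equation_alt by blast
      then show ?thesis
      proof eventually_elim
        case (elim z)
        then show ?case using True f'_eq[of z t] by (simp add: P_def f_in max_def)
      qed
    qed (simp add: P_def)
  qed
  moreover have "pair_sigma_finite (lebesgue :: (real \<times> real) measure) (lborel :: real measure)"
    by (intro pair_sigma_finite.intro sigma_finite_lebesgue sigma_finite_lborel)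
  ultimately have P: "AE z in lebesgue. AE t in lborel. P z t"
    using pair_sigma_finite.AE_commute[of lebesgue lborel P] Pm by blast
  have main: "AE z in lebesgue. z \<in> \<Omega> \<longrightarrow> (\<forall>T\<ge>0. \<omega> (fst z) (snd z) T
      = exp (F T) * (exp (- (fst z + snd z) * T) * \<omega> (fst z) (snd z) 0))"
    using P
  proof (eventually_elim, intro impI allI)
    fix z and T :: real assume Pz: "AE t in lborel. P z t" and z: "z \<in> \<Omega>" and T: "T \<ge> 0"
    define a where "a = fst z + snd z"
    define g where "g t = exp (a * t - F t) * \<omega> (fst z) (snd z) t" for t
    have "g T = g 0"
    proof (rule constant_if_derivative_zero_AE[OF _ _ T])
      fix t :: real assume t: "t \<ge> 0"
      obtain D where D: "(\<omega> (fst z) (snd z) has_real_derivative D) (at t within {0..})"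
        using diff_weight[OF t, of "fst z" "snd z"] z by (auto simp: real_differentiable_def)
      have "((\<lambda>t. a * t - F t) has_real_derivative a - drift t) (at t within {0..})"
        by (auto intro!: derivative_eq_intros F(2) t)
      from DERIV_mult[OF DERIV_exp_within[OF this] D]
      show "(g has_real_derivative exp (a * t - F t) * (a - drift t) * \<omega> (fst z) (snd z) t
          + f' z t * exp (a * t - F t)) (at t within {0..})"
        unfolding g_def[abs_def] using f'_eq[OF z t D] by simp
    next
      show "AE t in lborel. t \<ge> 0 \<longrightarrow> exp (a * t - F t) * (a - drift t) * \<omega> (fst z) (snd z) t
          + f' z t * exp (a * t - F t) = 0"
        using Pz
      proof (eventually_elim, intro impI)
        fix t assume "P z t" "t \<ge> 0"
        then have eq: "f' z t = - (a - drift t) * \<omega> (fst z) (snd z) t"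
          using z by (simp add: P_def f_in a_def max_def)
        show "exp (a * t - F t) * (a - drift t) * \<omega> (fst z) (snd z) t
          + f' z t * exp (a * t - F t) = 0" unfolding eq by (simp add: algebra_simps)
      qed
    qed
    then have "exp (a * T - F T) * \<omega> (fst z) (snd z) T = \<omega> (fst z) (snd z) 0"
      by (simp add: g_def F(1))
    then have "exp (F T) * (exp (- a * T) * \<omega> (fst z) (snd z) 0)
        = (exp (F T) * exp (- a * T) * exp (a * T - F T)) * \<omega> (fst z) (snd z) T"
      by (simp add: mult.assoc)
    also have "exp (F T) * exp (- a * T) * exp (a * T - F T) = 1"
      by (simp add: exp_add[symmetric])
    finally show "\<omega> (fst z) (snd z) T = exp (F T) * (exp (- (fst z + snd z) * T) * \<omega> (fst z) (snd z) 0)"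
      by (simp add: a_def)
  qed
  show ?thesis
  proof (rule weight_formula_if_multiple)
    fix t :: real assume t: "t \<ge> 0"
    show "AE z in lebesgue. z \<in> \<Omega> \<longrightarrow> \<omega> (fst z) (snd z) t
        = exp (F t) * (exp (- (fst z + snd z) * t) * \<omega> (fst z) (snd z) 0)"
      using main
    proof eventually_elim
      case (elim z) then show ?case using t by blast
    qed
  qed
qed

end

section \<open>Stieltjes series\<close>

abbreviation coeff2 :: "dseries \<Rightarrow> int \<Rightarrow> int \<Rightarrow> real" where
  "coeff2 F a b \<equiv> fls_nth (fls_nth F b) a"

lemma inverse_z1: "inverse z1 = fls_const fls_X"
  by (simp add: z1_def fls_inverse_const fls_inverse_X_inv)

lemma inverse_z2: "inverse z2 = fls_X"
  by (simp add: z2_def fls_inverse_X_inv)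

lemma coeff2_inverse_z1_mult: "coeff2 (inverse z1 * F) a b = coeff2 F (a - 1) b"
  by (simp add: inverse_z1 fls_X_times_conv_shift)

lemma coeff2_inverse_z2_mult: "coeff2 (inverse z2 * F) a b = coeff2 F a (b - 1)"
  by (simp add: inverse_z2 fls_X_times_conv_shift)

lemma coeff2_z1_mult: "coeff2 (z1 * F) a b = coeff2 F (a + 1) b"
  by (simp add: z1_def fls_X_inv_times_conv_shift)

lemma coeff2_z2_mult: "coeff2 (z2 * F) a b = coeff2 F a (b + 1)"
  by (simp add: z2_def fls_X_inv_times_conv_shift)

lemma coeff2_const_mult: "coeff2 (fls_const (fls_const c) * F) a b = c * coeff2 F a b"
  by simp

lemma coeff2_stieltjes:
  "coeff2 (stieltjes \<Omega> \<omega> t) a b = (if a \<ge> 1 \<and> b \<ge> 1 then moment \<Omega> \<omega> (nat (a - 1)) (nat (b - 1)) t else 0)"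
  unfolding stieltjes_def mult.assoc coeff2_inverse_z1_mult coeff2_inverse_z2_mult by simp

lemma coeff2_stieltjes10:
  "coeff2 (stieltjes10 \<Omega> \<omega> t) a b = (if a \<ge> 1 \<and> b = 0 then moment \<Omega> \<omega> (nat (a - 1)) 0 t else 0)"
  unfolding stieltjes10_def coeff2_inverse_z1_mult by simp

lemma coeff2_stieltjes20:
  "coeff2 (stieltjes20 \<Omega> \<omega> t) a b = (if a = 0 \<and> b \<ge> 1 then moment \<Omega> \<omega> 0 (nat (b - 1)) t else 0)"
  unfolding stieltjes20_def coeff2_inverse_z2_mult by simp

text \<open>Outside the exponents of \<open>S\<close> the right-hand side vanishes: the marginal series cancel exactly the
  terms without \<open>1 / z1\<close> or without \<open>1 / z2\<close> that multiplication by \<open>z1\<close> and \<open>z2\<close> produces.\<close>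

lemma coeff2_stieltjes_rhs:
  "coeff2 ((fls_const (fls_const c) - z1 - z2) * stieltjes \<Omega> \<omega> t + stieltjes10 \<Omega> \<omega> t + stieltjes20 \<Omega> \<omega> t) a b
    = (if a \<ge> 1 \<and> b \<ge> 1 then
         - moment \<Omega> \<omega> (nat (a - 1) + 1) (nat (b - 1)) t - moment \<Omega> \<omega> (nat (a - 1)) (nat (b - 1) + 1) t
         + moment \<Omega> \<omega> (nat (a - 1)) (nat (b - 1)) t * c
       else 0)"
proof -
  have eq: "coeff2 ((fls_const (fls_const c) - z1 - z2) * F + G + H) a b
      = c * coeff2 F a b - coeff2 F (a + 1) b - coeff2 F a (b + 1) + coeff2 G a b + coeff2 H a b" for F G H
    by (simp only: left_diff_distrib fls_minus_nth fls_plus_nth coeff2_const_mult coeff2_z1_mult coeff2_z2_mult)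
  show ?thesis
    unfolding eq coeff2_stieltjes coeff2_stieltjes10 coeff2_stieltjes20
    by (simp add: nat_diff_distrib)
qed

lemma stieltjes_equation_iff:
  "dseries_has_deriv (stieltjes \<Omega> \<omega>)
      ((fls_const (fls_const c) - z1 - z2) * stieltjes \<Omega> \<omega> t + stieltjes10 \<Omega> \<omega> t + stieltjes20 \<Omega> \<omega> t) t
   \<longleftrightarrow> (\<forall>h k. (moment \<Omega> \<omega> h k has_real_derivative
        - moment \<Omega> \<omega> (h + 1) k t - moment \<Omega> \<omega> h (k + 1) t + moment \<Omega> \<omega> h k t * c) (at t within {0..}))"
  (is "?L \<longleftrightarrow> ?R")
proof
  assume L: ?L
  show ?R
  proof (intro allI)
    fix h k
    show "(moment \<Omega> \<omega> h k has_real_derivative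
        - moment \<Omega> \<omega> (h + 1) k t - moment \<Omega> \<omega> h (k + 1) t + moment \<Omega> \<omega> h k t * c) (at t within {0..})"
      using L[unfolded dseries_has_deriv_def coeff2_stieltjes_rhs, rule_format, of "int k + 1" "int h + 1"]
      by (simp add: coeff2_stieltjes)
  qed
next
  assume ?R
  then show ?L
    unfolding dseries_has_deriv_def coeff2_stieltjes_rhs by (auto simp: coeff2_stieltjes)
qed

section \<open>Banded infinite block matrices\<close>

text \<open>Indices of scalar entries: \<open>(n, r)\<close> is the row \<open>r\<close> of the block row \<open>n\<close>.\<close>

text \<open>The entry indices up to the block \<open>N\<close>; a triangle because the block \<open>n\<close> has \<open>n + 1\<close> rows.\<close>

definition tri :: "nat \<Rightarrow> (nat \<times> nat) set" where
  "tri N = (SIGMA n:{..N}. {..n})"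

definition entry :: "bmat \<Rightarrow> nat \<times> nat \<Rightarrow> nat \<times> nat \<Rightarrow> real" where
  "entry M i j = M (fst i) (fst j) $$ (snd i, snd j)"

text \<open>Only the block diagonals above the main one are bounded in number: this makes all rows finite and is
  preserved by products and powers.\<close>

definition banded :: "nat \<Rightarrow> bmat \<Rightarrow> bool" where
  "banded w M \<longleftrightarrow> (\<forall>m n. M m n \<in> carrier_mat (m + 1) (n + 1)) \<and>
     (\<forall>m n. m + w < n \<longrightarrow> M m n = 0\<^sub>m (m + 1) (n + 1))"

abbreviation index :: "nat \<times> nat \<Rightarrow> bool" where "index i \<equiv> snd i \<le> fst i"

lemma finite_tri [simp]: "finite (tri N)"
  by (simp add: tri_def)

lemma mem_tri: "j \<in> tri N \<longleftrightarrow> fst j \<le> N \<and> index j"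
  by (cases j) (simp add: tri_def)

lemma tri_0: "tri 0 = {(0, 0)}"
  by (auto simp: tri_def)

lemma sum_tri: "(\<Sum>j\<in>tri N. f j) = (\<Sum>n\<le>N. \<Sum>c\<le>n. f (n, c))"
  unfolding tri_def by (simp add: sum.Sigma)

lemma banded_carrier: "banded w M \<Longrightarrow> M m n \<in> carrier_mat (m + 1) (n + 1)"
  by (simp add: banded_def)

lemma entry_above_band: "banded w M \<Longrightarrow> index i \<Longrightarrow> index j \<Longrightarrow> fst i + w < fst j \<Longrightarrow> entry M i j = 0"
  by (simp add: banded_def entry_def)

lemma mult_entry:
  assumes "M \<in> carrier_mat a (k + 1)" "N \<in> carrier_mat (k + 1) b" "r < a" "c < b"
  shows "(M * N) $$ (r, c) = (\<Sum>l\<le>k. M $$ (r, l) * N $$ (l, c))"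
  using assms by (auto simp: scalar_prod_def atLeast0LessThan lessThan_Suc_atMost intro!: sum.cong)

lemma mult_vec_entry:
  assumes "M \<in> carrier_mat a (k + 1)" "v \<in> carrier_vec (k + 1)" "r < a"
  shows "(M *\<^sub>v v) $ r = (\<Sum>l\<le>k. M $$ (r, l) * v $ l)"
  using assms by (auto simp: scalar_prod_def atLeast0LessThan lessThan_Suc_atMost intro!: sum.cong)

lemma bmat_mult_carrier: "bmat_mult M N m n \<in> carrier_mat (m + 1) (n + 1)"
  by (simp add: bmat_mult_def)

lemma bmat_mult_block:
  assumes M: "banded w M" and N: "banded v N" and K: "finite K"
    and zero: "\<And>k. k \<notin> K \<Longrightarrow> M m k = 0\<^sub>m (m + 1) (k + 1) \<or> N k n = 0\<^sub>m (k + 1) (n + 1)"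
    and rc: "r \<le> m" "c \<le> n"
  shows "bmat_mult M N m n $$ (r, c) = (\<Sum>k\<in>K. (M m k * N k n) $$ (r, c))"
proof -
  have "(M m k * N k n) $$ (r, c) = 0" if "k \<notin> K" for k
  proof -
    have "M m k * N k n = 0\<^sub>m (m + 1) (n + 1)"
      using zero[OF that] banded_carrier[OF M, of m k] banded_carrier[OF N, of k n] by auto
    then show ?thesis using rc by simp
  qed
  then show ?thesis
    unfolding bmat_mult_def using rc K by (simp add: suminf_finite)
qed

lemma entry_mult:
  assumes M: "banded w M" and N: "banded v N" and ij: "index i" "index j" and K: "fst i + w \<le> K"
  shows "entry (bmat_mult M N) i j = (\<Sum>l\<in>tri K. entry M i l * entry N l j)"
proof -
  have "entry (bmat_mult M N) i j = (\<Sum>k\<in>{..K}. (M (fst i) k * N k (fst j)) $$ (snd i, snd j))"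
    unfolding entry_def
    by (rule bmat_mult_block[OF M N]) (use M K ij in \<open>auto simp: banded_def\<close>)
  also have "\<dots> = (\<Sum>k\<le>K. \<Sum>l\<le>k. M (fst i) k $$ (snd i, l) * N k (fst j) $$ (l, snd j))"
    using ij by (intro sum.cong mult_entry[OF banded_carrier[OF M] banded_carrier[OF N]]) auto
  finally show ?thesis by (simp add: sum_tri entry_def)
qed

lemma banded_mult:
  assumes M: "banded w M" and N: "banded v N"
  shows "banded (w + v) (bmat_mult M N)"
  unfolding banded_def
proof (intro conjI allI impI)
  fix m n assume mn: "m + (w + v) < n"
  show "bmat_mult M N m n = 0\<^sub>m (m + 1) (n + 1)"
  proof (rule eq_matI)
    fix r c assume rc: "r < dim_row (0\<^sub>m (m + 1) (n + 1) :: real mat)" "c < dim_col (0\<^sub>m (m + 1) (n + 1) :: real mat)"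
    have "bmat_mult M N m n $$ (r, c) = (\<Sum>k\<in>{}. (M m k * N k n) $$ (r, c))"
    proof (rule bmat_mult_block[OF M N])
      fix k show "M m k = 0\<^sub>m (m + 1) (k + 1) \<or> N k n = 0\<^sub>m (k + 1) (n + 1)"
        using M N mn by (cases "m + w < k") (auto simp: banded_def)
    qed (use rc in auto)
    then show "bmat_mult M N m n $$ (r, c) = 0\<^sub>m (m + 1) (n + 1) $$ (r, c)" using rc by simp
  qed (simp_all add: bmat_mult_def)
qed (rule bmat_mult_carrier)

lemma banded_one: "banded 0 bmat_one"
  by (auto simp: banded_def bmat_one_def)

lemma entry_one: "index i \<Longrightarrow> index j \<Longrightarrow> entry bmat_one i j = (if i = j then 1 else 0)"
  by (auto simp: entry_def bmat_one_def prod_eq_iff)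

lemma banded_pow: "banded w M \<Longrightarrow> banded (h * w) (bmat_pow M h)"
  by (induction h) (simp_all add: banded_one banded_mult)

lemma banded_eqI:
  assumes "banded w M" "banded v N" "\<And>i j. index i \<Longrightarrow> index j \<Longrightarrow> entry M i j = entry N i j"
  shows "M = N"
proof -
  have M: "dim_row (M m n) = m + 1" "dim_col (M m n) = n + 1"
    and N: "dim_row (N m n) = m + 1" "dim_col (N m n) = n + 1" for m n
    using banded_carrier[OF assms(1), of m n] banded_carrier[OF assms(2), of m n] by auto
  show ?thesis
  proof (intro ext eq_matI)
    fix m n r c
    assume "r < dim_row (N m n)" "c < dim_col (N m n)"
    then show "M m n $$ (r, c) = N m n $$ (r, c)"
      using assms(3)[of "(m, r)" "(n, c)"] N by (simp add: entry_def)
  qed (simp_all only: M N)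
qed

lemma bmat_mult_one_right: assumes "banded w M" shows "bmat_mult M bmat_one = M"
proof (rule banded_eqI[OF banded_mult[OF assms banded_one] assms])
  fix i j :: "nat \<times> nat" assume ij: "index i" "index j"
  have "entry (bmat_mult M bmat_one) i j = (\<Sum>l\<in>tri (fst i + w + fst j). entry M i l * entry bmat_one l j)"
    by (rule entry_mult[OF assms banded_one ij]) simp
  also have "\<dots> = (\<Sum>l\<in>tri (fst i + w + fst j). if l = j then entry M i j else 0)"
    using ij by (intro sum.cong) (auto simp: entry_one mem_tri)
  also have "\<dots> = entry M i j" using ij by (simp add: mem_tri)
  finally show "entry (bmat_mult M bmat_one) i j = entry M i j" .
qed

lemma bmat_mult_one_left: assumes "banded w M" shows "bmat_mult bmat_one M = M"
proof (rule banded_eqI[OF banded_mult[OF banded_one assms] assms])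
  fix i j :: "nat \<times> nat" assume ij: "index i" "index j"
  have "entry (bmat_mult bmat_one M) i j = (\<Sum>l\<in>tri (fst i + 0). entry bmat_one i l * entry M l j)"
    by (rule entry_mult[OF banded_one assms ij]) simp
  also have "\<dots> = (\<Sum>l\<in>tri (fst i). if l = i then entry M i j else 0)"
    using ij by (intro sum.cong) (auto simp: entry_one mem_tri)
  also have "\<dots> = entry M i j" using ij by (simp add: mem_tri)
  finally show "entry (bmat_mult bmat_one M) i j = entry M i j" .
qed

lemma bmat_comm_carrier: "bmat_comm M N m n \<in> carrier_mat (m + 1) (n + 1)"
  unfolding bmat_comm_def by (rule minus_carrier_mat[OF bmat_mult_carrier])

lemma entry_comm:
  "index i \<Longrightarrow> index j \<Longrightarrow> entry (bmat_comm M N) i j = entry (bmat_mult M N) i j - entry (bmat_mult N M) i j"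
  by (simp add: bmat_comm_def entry_def bmat_mult_def)

lemma bmat_has_deriv_iff:
  assumes M: "\<And>s m n. s \<ge> 0 \<Longrightarrow> M s m n \<in> carrier_mat (m + 1) (n + 1)"
    and M': "\<And>m n. M' m n \<in> carrier_mat (m + 1) (n + 1)"
  shows "bmat_has_deriv M M' t \<longleftrightarrow> (\<forall>i j. index i \<longrightarrow> index j \<longrightarrow>
    ((\<lambda>s. entry (M s) i j) has_real_derivative entry M' i j) (at t within {0..}))"
proof -
  have d: "dim_row (M' m n) = m + 1" "dim_col (M' m n) = n + 1" for m n using M'[of m n] by auto
  show ?thesis
    unfolding bmat_has_deriv_def mat_has_deriv_def d entry_def using M
    by (auto simp: less_Suc_eq_le)
qed

text \<open>The equation \<open>f = M g\<close> between infinite columns; the bandwidth makes the product a finite sum.\<close>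

definition represents :: "nat \<Rightarrow> bmat \<Rightarrow> (nat \<times> nat \<Rightarrow> real) \<Rightarrow> (nat \<times> nat \<Rightarrow> real) \<Rightarrow> bool" where
  "represents w M f g \<longleftrightarrow> banded w M \<and> (\<forall>i. index i \<longrightarrow> f i = (\<Sum>j\<in>tri (fst i + w). entry M i j * g j))"

lemma representsD:
  assumes "represents w M f g" "index i" "fst i + w \<le> K"
  shows "f i = (\<Sum>j\<in>tri K. entry M i j * g j)"
proof -
  have "(\<Sum>j\<in>tri K. entry M i j * g j) = (\<Sum>j\<in>tri (fst i + w). entry M i j * g j)"
    using assms entry_above_band[of w M i]
    by (intro sum.mono_neutral_right) (auto simp: represents_def mem_tri not_le)
  moreover have "f i = (\<Sum>j\<in>tri (fst i + w). entry M i j * g j)"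
    using assms(1,2) unfolding represents_def by blast
  ultimately show ?thesis by simp
qed

lemma represents_banded: "represents w M f g \<Longrightarrow> banded w M"
  by (simp add: represents_def)

lemma represents_scale: "represents w M f g \<Longrightarrow> represents w M (\<lambda>i. c * f i) (\<lambda>i. c * g i)"
  by (simp add: represents_def sum_distrib_left mult_ac)

text \<open>Substituting one expansion into another multiplies the matrices; with it, identities between infinite
  matrices can be read off from identities between polynomials.\<close>

lemma represents_mult:
  assumes M: "represents w M f g" and N: "represents v N g h"
  shows "represents (w + v) (bmat_mult M N) f h"
  unfolding represents_def
proof (intro conjI allI impI)
  note bM = represents_banded[OF M] and bN = represents_banded[OF N]
  show "banded (w + v) (bmat_mult M N)" by (rule banded_mult[OF bM bN])
  fix i :: "nat \<times> nat" assume i: "index i"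
  have "f i = (\<Sum>j\<in>tri (fst i + w). entry M i j * g j)" by (rule representsD[OF M i]) simp
  also have "\<dots> = (\<Sum>j\<in>tri (fst i + w). entry M i j * (\<Sum>l\<in>tri (fst i + (w + v)). entry N j l * h l))"
    by (intro sum.cong refl arg_cong2[where f="(*)"] representsD[OF N]) (auto simp: mem_tri)
  also have "\<dots> = (\<Sum>l\<in>tri (fst i + (w + v)). (\<Sum>j\<in>tri (fst i + w). entry M i j * entry N j l) * h l)"
    by (simp add: sum_distrib_left sum_distrib_right mult.assoc) (rule sum.swap)
  also have "\<dots> = (\<Sum>l\<in>tri (fst i + (w + v)). entry (bmat_mult M N) i l * h l)"
    using i by (intro sum.cong refl arg_cong2[where f="(*)"] entry_mult[OF bM bN, symmetric]) (auto simp: mem_tri)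
  finally show "f i = (\<Sum>l\<in>tri (fst i + (w + v)). entry (bmat_mult M N) i l * h l)" .
qed

lemma represents_one: "represents 0 bmat_one f f"
  unfolding represents_def
proof (intro conjI allI impI banded_one)
  fix i :: "nat \<times> nat" assume i: "index i"
  have "(\<Sum>j\<in>tri (fst i + 0). entry bmat_one i j * f j) = (\<Sum>j\<in>tri (fst i). if j = i then f i else 0)"
    using i by (intro sum.cong) (auto simp: entry_one mem_tri)
  then show "f i = (\<Sum>j\<in>tri (fst i + 0). entry bmat_one i j * f j)" using i by (simp add: mem_tri)
qed

lemma represents_pow:
  assumes "represents w M (\<lambda>i. c * f i) f"
  shows "represents (h * w) (bmat_pow M h) (\<lambda>i. c ^ h * f i) f"
proof (induction h)
  case 0 show ?case by (simp add: represents_one)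
next
  case (Suc h)
  have "represents (w + h * w) (bmat_mult M (bmat_pow M h)) (\<lambda>i. c ^ h * (c * f i)) f"
    by (rule represents_mult[OF represents_scale[OF assms] Suc])
  then show ?case by (simp add: mult_ac)
qed

lemma DERIV_unique_nonnegative:
  fixes f :: "real \<Rightarrow> real"
  assumes "(f has_real_derivative D) (at t within {0..})" "(f has_real_derivative E) (at t within {0..})" "t \<ge> 0"
  shows "D = E"
proof -
  have "at_right t \<le> at t within {0..}" using assms(3) by (intro at_le) auto
  then have "at t within {0::real..} \<noteq> bot"
    using trivial_limit_at_right_real[of t] bot.extremum_uniqueI by metis
  then show ?thesis
    using assms(1,2) tendsto_unique unfolding has_field_derivative_iff by blast
qed

lemma entry_differentiable_mult:
  fixes M N :: "real \<Rightarrow> bmat"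
  assumes M: "\<And>s. s \<ge> 0 \<Longrightarrow> banded w (M s)" and N: "\<And>s. s \<ge> 0 \<Longrightarrow> banded v (N s)"
    and dM: "\<And>i j. index i \<Longrightarrow> index j \<Longrightarrow> (\<lambda>s. entry (M s) i j) differentiable (at t within {0..})"
    and dN: "\<And>i j. index i \<Longrightarrow> index j \<Longrightarrow> (\<lambda>s. entry (N s) i j) differentiable (at t within {0..})"
    and t: "t \<ge> 0" and ij: "index i" "index j"
  shows "(\<lambda>s. entry (bmat_mult (M s) (N s)) i j) differentiable (at t within {0..})"
proof -
  have "(\<lambda>s. \<Sum>l\<in>tri (fst i + w). entry (M s) i l * entry (N s) l j) differentiable (at t within {0..})"
    using dM dN ij by (intro differentiable_sum ballI differentiable_mult) (auto simp: mem_tri)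
  then show ?thesis
  proof (rule differentiable_transform_within[where d=1])
    fix s :: real assume "s \<in> {0..}"
    then show "(\<Sum>l\<in>tri (fst i + w). entry (M s) i l * entry (N s) l j) = entry (bmat_mult (M s) (N s)) i j"
      by (intro entry_mult[symmetric, OF M N ij]) auto
  qed (use t in auto)
qed

section \<open>The orthogonal system and its recurrence matrices\<close>

definition monomial :: "nat \<times> nat \<Rightarrow> real \<Rightarrow> real \<Rightarrow> real" where
  "monomial j x y = x ^ (fst j - snd j) * y ^ snd j"

locale matrix_flow = smooth_weight_family +
  fixes G D C :: "nat \<Rightarrow> nat \<Rightarrow> real \<Rightarrow> real mat"
  assumes mops: "monic_ops \<Omega> \<omega> G"
    and ttr: "three_term G D C"
    and diff_G: "\<And>t n m. t \<ge> 0 \<Longrightarrow> m < n \<Longrightarrow> mat_differentiable (G n m) t"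
    and diff_D: "\<And>t n i. t \<ge> 0 \<Longrightarrow> i \<in> {1, 2} \<Longrightarrow> mat_differentiable (D n i) t"
    and diff_C: "\<And>t n i. t \<ge> 0 \<Longrightarrow> n \<ge> 1 \<Longrightarrow> i \<in> {1, 2} \<Longrightarrow> mat_differentiable (C n i) t"
begin

definition p :: "real \<Rightarrow> real \<Rightarrow> real \<Rightarrow> nat \<times> nat \<Rightarrow> real" where
  "p t x y j = Pvec G (fst j) t x y $ snd j"

text \<open>The coefficient of the monomial \<open>j\<close> in the polynomial \<open>i\<close>, including the leading ones.\<close>

definition coef :: "nat \<times> nat \<Rightarrow> nat \<times> nat \<Rightarrow> real \<Rightarrow> real" where
  "coef i j t = (if fst j < fst i then G (fst i) (fst j) t $$ (snd i, snd j) else if j = i then 1 else 0)"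

lemma G_carrier: "t \<ge> 0 \<Longrightarrow> m < n \<Longrightarrow> G n m t \<in> carrier_mat (n + 1) (m + 1)"
  using mops by (simp add: monic_ops_def)

lemma p_expansion:
  assumes t: "t \<ge> 0" and i: "index i"
  shows "p t x y i = (\<Sum>j\<in>tri (fst i). coef i j t * monomial j x y)"
proof -
  obtain n r where [simp]: "i = (n, r)" by (cases i)
  have r: "r \<le> n" using i by simp
  have X: "Xvec m x y $ c = monomial (m, c) x y" if "c \<le> m" for m c
    using that by (simp add: Xvec_def monomial_def)
  have "p t x y i = monomial i x y + (\<Sum>m<n. (G n m t *\<^sub>v Xvec m x y) $ r)"
    using r by (simp add: p_def Pvec_def X)
  also have "(\<Sum>m<n. (G n m t *\<^sub>v Xvec m x y) $ r) = (\<Sum>m<n. \<Sum>c\<le>m. coef i (m, c) t * monomial (m, c) x y)"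
  proof (intro sum.cong refl)
    fix m assume m: "m \<in> {..<n}"
    have "(G n m t *\<^sub>v Xvec m x y) $ r = (\<Sum>c\<le>m. G n m t $$ (r, c) * Xvec m x y $ c)"
      using r m by (intro mult_vec_entry[OF G_carrier[OF t]]) (auto simp: Xvec_def)
    then show "(G n m t *\<^sub>v Xvec m x y) $ r = (\<Sum>c\<le>m. coef i (m, c) t * monomial (m, c) x y)"
      using m by (simp add: X coef_def)
  qed
  also have "monomial i x y = (\<Sum>c\<le>n. coef i (n, c) t * monomial (n, c) x y)"
  proof -
    have "(\<Sum>c\<le>n. coef i (n, c) t * monomial (n, c) x y) = (\<Sum>c\<le>n. if c = r then monomial i x y else 0)"
      by (intro sum.cong) (auto simp: coef_def)
    then show ?thesis using r by simp
  qed
  finally show ?thesis by (simp add: sum_tri lessThan_Suc_atMost[symmetric] add.commute)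
qed

lemma continuous2_p: "t \<ge> 0 \<Longrightarrow> index i \<Longrightarrow> continuous2 (\<lambda>x y. p t x y i)"
  by (simp only: p_expansion monomial_def) (intro continuous_intros)

lemma continuous2_monomial: "continuous2 (monomial j)"
  unfolding monomial_def by (intro continuous_intros)

lemma p_00: "p t x y (0, 0) = 1"
  by (simp add: p_def Pvec_def Xvec_def)

lemma gram:
  assumes "index i" "index j"
  shows "\<mu> t (\<lambda>x y. p t x y i * p t x y j) = Pgram \<Omega> \<omega> G (fst i) (fst j) t $$ (snd i, snd j)"
  using assms by (simp add: Pgram_def p_def)

lemma p_orthogonal:
  assumes "t \<ge> 0" "index i" "index j" "fst i \<noteq> fst j"
  shows "\<mu> t (\<lambda>x y. p t x y i * p t x y j) = 0"
  unfolding gram[OF assms(2,3)] using mops assms by (simp add: monic_ops_def)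

lemma wintegral_p: "t \<ge> 0 \<Longrightarrow> index i \<Longrightarrow> \<mu> t (\<lambda>x y. p t x y i) = (if fst i = 0 then 1 else 0)"
  using p_orthogonal[of t i "(0, 0)"] mom_00[of t]
  by (cases i) (auto simp: p_00 moment_def)

lemma wintegral_combination:
  assumes "t \<ge> 0" "finite I" "\<And>j. j \<in> I \<Longrightarrow> continuous2 (\<lambda>x y. f j x y)"
  shows "\<mu> t (\<lambda>x y. \<Sum>j\<in>I. a j * f j x y) = (\<Sum>j\<in>I. a j * \<mu> t (f j))"
proof -
  have "\<mu> t (\<lambda>x y. \<Sum>j\<in>I. a j * f j x y) = (\<Sum>j\<in>I. \<mu> t (\<lambda>x y. a j * f j x y))"
    using assms by (intro wintegral_sum) (auto intro!: continuous_intros)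
  then show ?thesis by (simp add: wintegral_mult)
qed

text \<open>Integrating the relation against the polynomials of degree \<open>m\<close> leaves the Gram matrix of degree \<open>m\<close>
  applied to the coefficients of that degree, and the Gram matrix is positive definite.\<close>

lemma p_independent:
  assumes t: "t \<ge> 0" and zero: "\<And>x y. (\<Sum>j\<in>tri K. a j * p t x y j) = 0" and i: "i \<in> tri K"
  shows "a i = 0"
proof -
  let ?m = "fst i"
  have m: "?m \<le> K" "index i" using i by (auto simp: mem_tri)
  define H where "H = Pgram \<Omega> \<omega> G ?m ?m t"
  define v where "v = vec (?m + 1) (\<lambda>c. a (?m, c))"
  have H: "H \<in> carrier_mat (?m + 1) (?m + 1)"
    and pos: "v \<noteq> 0\<^sub>v (?m + 1) \<Longrightarrow> v \<bullet> (H *\<^sub>v v) > 0"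
    using mops t by (auto simp: H_def v_def monic_ops_def sym_pos_def_def)
  have "H *\<^sub>v v = 0\<^sub>v (?m + 1)"
  proof (rule eq_vecI)
    fix s assume "s < dim_vec (0\<^sub>v (?m + 1) :: real vec)"
    then have s: "s \<le> ?m" by simp
    have "0 = \<mu> t (\<lambda>x y. \<Sum>j\<in>tri K. a j * (p t x y (?m, s) * p t x y j))"
    proof -
      have "(\<Sum>j\<in>tri K. a j * (p t x y (?m, s) * p t x y j)) = 0" for x y
      proof -
        have "(\<Sum>j\<in>tri K. a j * (p t x y (?m, s) * p t x y j)) = p t x y (?m, s) * (\<Sum>j\<in>tri K. a j * p t x y j)"
          by (simp add: sum_distrib_left mult_ac)
        then show ?thesis by (simp add: zero)
      qed
      then show ?thesis by (simp add: wintegral_eq)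
    qed
    also have "\<dots> = (\<Sum>j\<in>tri K. a j * \<mu> t (\<lambda>x y. p t x y (?m, s) * p t x y j))"
      using s by (intro wintegral_combination t finite_tri continuous_on_mult continuous2_p) (auto simp: mem_tri)
    also have "\<dots> = (\<Sum>n\<le>K. \<Sum>c\<le>n. a (n, c) * \<mu> t (\<lambda>x y. p t x y (?m, s) * p t x y (n, c)))"
      by (rule sum_tri)
    also have "\<dots> = (\<Sum>n\<in>{?m}. \<Sum>c\<le>n. a (n, c) * \<mu> t (\<lambda>x y. p t x y (?m, s) * p t x y (n, c)))"
      using m s t by (intro sum.mono_neutral_right) (auto simp: p_orthogonal intro!: sum.neutral)
    also have "\<dots> = (\<Sum>c\<le>?m. a (?m, c) * H $$ (s, c))"
      using s by (simp add: gram H_def)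
    also have "\<dots> = (\<Sum>c\<le>?m. H $$ (s, c) * v $ c)"
      by (intro sum.cong) (auto simp: v_def)
    also have "\<dots> = (H *\<^sub>v v) $ s"
      using s by (intro mult_vec_entry[OF H, symmetric]) (auto simp: v_def)
    finally show "(H *\<^sub>v v) $ s = 0\<^sub>v (?m + 1) $ s" using s by simp
  qed (use H in auto)
  then have "v = 0\<^sub>v (?m + 1)" using pos H by (force simp: v_def)
  then have "v $ snd i = 0" using m by simp
  then show ?thesis using m by (simp add: v_def)
qed

lemma represents_unique:
  assumes t: "t \<ge> 0" and M: "\<And>x y. represents w M (f x y) (p t x y)"
    and N: "\<And>x y. represents v N (f x y) (p t x y)" and ij: "index i" "index j"
  shows "entry M i j = entry N i j"
proof -
  define K where "K = max (fst j) (fst i + max w v)"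
  have "entry M i j - entry N i j = 0"
  proof (rule p_independent[OF t])
    show "(\<Sum>j\<in>tri K. (entry M i j - entry N i j) * p t x y j) = 0" for x y
    proof -
      have "(\<Sum>j\<in>tri K. entry M i j * p t x y j) = f x y i"
        by (rule representsD[OF M ij(1), symmetric]) (simp add: K_def)
      moreover have "(\<Sum>j\<in>tri K. entry N i j * p t x y j) = f x y i"
        by (rule representsD[OF N ij(1), symmetric]) (simp add: K_def)
      ultimately show ?thesis by (simp only: left_diff_distrib sum_subtractf diff_self)
    qed
    show "j \<in> tri K" using ij by (simp add: mem_tri K_def)
  qed
  then show ?thesis by simp
qed

abbreviation J where "J i t \<equiv> Jmat D C i t"
abbreviation A where "A t \<equiv> Amat C t"
definition coord :: "nat \<Rightarrow> real \<Rightarrow> real \<Rightarrow> real" where "coord i x y = (if i = 1 then x else y)"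

lemma D_carrier: "t \<ge> 0 \<Longrightarrow> i \<in> {1, 2} \<Longrightarrow> D n i t \<in> carrier_mat (n + 1) (n + 1)"
  using ttr[unfolded three_term_def, THEN conjunct1] by (elim allE impE) auto

lemma C_carrier: "t \<ge> 0 \<Longrightarrow> i \<in> {1, 2} \<Longrightarrow> n \<ge> 1 \<Longrightarrow> C n i t \<in> carrier_mat (n + 1) n"
  using ttr[unfolded three_term_def, THEN conjunct2, THEN conjunct1] by (elim allE impE) auto

lemma L_carrier: "L n i \<in> carrier_mat (n + 1) (n + 2)"
  by (simp add: L_def)

lemma C12_carrier: "t \<ge> 0 \<Longrightarrow> n \<ge> 1 \<Longrightarrow> sum12 C n t \<in> carrier_mat (n + 1) n"
  using C_carrier[of t 1 n] C_carrier[of t 2 n] by (simp add: sum12_def)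

lemma banded_J: "t \<ge> 0 \<Longrightarrow> i \<in> {1, 2} \<Longrightarrow> banded 1 (J i t)"
  unfolding banded_def
proof (intro conjI allI impI)
  assume t: "t \<ge> 0" and i: "i \<in> {1, 2}"
  fix m n :: nat
  consider "n = m" | "n = m + 1" | "m = n + 1" | "n \<noteq> m" "n \<noteq> m + 1" "m \<noteq> n + 1" by blast
  then show "J i t m n \<in> carrier_mat (m + 1) (n + 1)"
    using D_carrier[OF t i, of m] C_carrier[OF t i, of m] L_carrier[of m i]
    by cases (simp_all add: Jmat_def)
qed (simp add: Jmat_def)

lemma banded_A: "t \<ge> 0 \<Longrightarrow> banded 0 (A t)"
  unfolding banded_def
proof (intro conjI allI impI)
  assume t: "t \<ge> 0"
  fix m n :: nat
  show "A t m n \<in> carrier_mat (m + 1) (n + 1)"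
    using C12_carrier[OF t, of m] by (cases "m = n + 1") (simp_all add: Amat_def)
qed (simp add: Amat_def)

lemma sum_tri_blocks:
  assumes "banded w M" "index i"
  shows "(\<Sum>j\<in>tri K. entry M i j * p t x y j) = (\<Sum>k\<le>K. (M (fst i) k *\<^sub>v Pvec G k t x y) $ snd i)"
  unfolding sum_tri
proof (intro sum.cong refl)
  fix k
  have "(M (fst i) k *\<^sub>v Pvec G k t x y) $ snd i
      = (\<Sum>c\<le>k. M (fst i) k $$ (snd i, c) * Pvec G k t x y $ c)"
    using assms(2) by (intro mult_vec_entry[OF banded_carrier[OF assms(1)]]) (simp_all add: Pvec_def)
  then show "(\<Sum>c\<le>k. entry M i (k, c) * p t x y (k, c)) = (M (fst i) k *\<^sub>v Pvec G k t x y) $ snd i"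
    by (simp add: entry_def p_def)
qed

lemma represents_J:
  assumes t: "t \<ge> 0" and i: "i \<in> {1, 2}"
  shows "represents 1 (J i t) (\<lambda>j. coord i x y * p t x y j) (p t x y)"
  unfolding represents_def
proof (intro conjI allI impI banded_J[OF t i])
  fix j :: "nat \<times> nat" assume j: "index j"
  obtain n r where [simp]: "j = (n, r)" by (cases j)
  have r: "r \<le> n" using j by simp
  have carr: "dim_row (L n i) = n + 1" "dim_row (D n i t) = n + 1" "n \<ge> 1 \<Longrightarrow> dim_row (C n i t) = n + 1"
    using D_carrier[OF t i, of n] C_carrier[OF t i, of n] L_carrier[of n i] by auto
  have lhs: "coord i x y * p t x y j = (coord i x y \<cdot>\<^sub>v Pvec G n t x y) $ r"
    using r by (simp add: p_def Pvec_def)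
  have rhs: "(\<Sum>j'\<in>tri (fst j + 1). entry (J i t) j j' * p t x y j')
      = (\<Sum>k\<le>n + 1. (J i t n k *\<^sub>v Pvec G k t x y) $ r)"
    using sum_tri_blocks[OF banded_J[OF t i] j] by simp
  show "coord i x y * p t x y j = (\<Sum>j'\<in>tri (fst j + 1). entry (J i t) j j' * p t x y j')"
  proof (cases "n = 0")
    case True
    have "coord i x y \<cdot>\<^sub>v Pvec G 0 t x y = L 0 i *\<^sub>v Pvec G 1 t x y + D 0 i t *\<^sub>v Pvec G 0 t x y"
      using ttr t i unfolding three_term_def coord_def by blast
    then show ?thesis
      unfolding lhs rhs using True r carr by (simp add: Jmat_def)
  next
    case False
    then have "coord i x y \<cdot>\<^sub>v Pvec G n t x y = L n i *\<^sub>v Pvec G (n + 1) t x y + D n i t *\<^sub>v Pvec G n t x y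
          + C n i t *\<^sub>v Pvec G (n - 1) t x y"
      using ttr t i unfolding three_term_def coord_def by (metis less_one not_le)
    then have "coord i x y * p t x y j = (L n i *\<^sub>v Pvec G (n + 1) t x y) $ r + (D n i t *\<^sub>v Pvec G n t x y) $ r
          + (C n i t *\<^sub>v Pvec G (n - 1) t x y) $ r"
      unfolding lhs using r carr False by simp
    also have "\<dots> = (\<Sum>k\<in>{n - 1, n, n + 1}. (J i t n k *\<^sub>v Pvec G k t x y) $ r)"
      using False by (cases n) (simp_all add: Jmat_def)
    also have "\<dots> = (\<Sum>k\<le>n + 1. (J i t n k *\<^sub>v Pvec G k t x y) $ r)"
    proof (rule sum.mono_neutral_left)
      show "\<forall>k\<in>{..n + 1} - {n - 1, n, n + 1}. (J i t n k *\<^sub>v Pvec G k t x y) $ r = 0"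
      proof
        fix k assume "k \<in> {..n + 1} - {n - 1, n, n + 1}"
        then have "J i t n k = 0\<^sub>m (n + 1) (k + 1)" by (auto simp: Jmat_def)
        then show "(J i t n k *\<^sub>v Pvec G k t x y) $ r = 0"
          using r by (auto simp: scalar_prod_def Pvec_def intro!: sum.neutral)
      qed
    qed auto
    finally show ?thesis unfolding rhs .
  qed
qed

end

section \<open>Evolution of the polynomials and of the recurrence matrices\<close>

lemma mat_entry_differentiable:
  assumes M: "mat_differentiable M t" and c: "\<And>s. s \<ge> 0 \<Longrightarrow> M s \<in> carrier_mat a b"
    and rc: "r < a" "c < b"
  shows "(\<lambda>s. M s $$ (r, c)) differentiable (at t within {0..})"
proof -
  obtain M' where M': "mat_has_deriv M M' t" using M by (auto simp: mat_differentiable_def)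
  then have "M 0 \<in> carrier_mat (dim_row M') (dim_col M')" by (simp add: mat_has_deriv_def)
  then have "dim_row M' = a" "dim_col M' = b" using c[of 0] by auto
  then show ?thesis using M' rc by (auto simp: mat_has_deriv_def real_differentiable_def)
qed

lemma mat_has_deriv_const_zero:
  assumes "M \<in> carrier_mat a b" shows "mat_has_deriv (\<lambda>_. M) (0\<^sub>m a b) t"
  using assms by (simp add: mat_has_deriv_def)

lemma real_differentiableD:
  fixes f :: "real \<Rightarrow> real"
  shows "f differentiable (at x within S) \<Longrightarrow> \<exists>d. (f has_real_derivative d) (at x within S)"
  by (simp add: real_differentiable_def)

context matrix_flow
begin

definition Ap :: "real \<Rightarrow> real \<Rightarrow> real \<Rightarrow> nat \<times> nat \<Rightarrow> real" where
  "Ap t x y i = (\<Sum>j\<in>tri (fst i). entry (A t) i j * p t x y j)"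

definition polynomial_equation :: bool where
  "polynomial_equation \<longleftrightarrow> (\<forall>t\<ge>0. \<forall>x y i. index i \<longrightarrow>
     ((\<lambda>s. p s x y i) has_real_derivative Ap t x y i) (at t within {0..}))"

lemma polynomial_equationD:
  "polynomial_equation \<Longrightarrow> t \<ge> 0 \<Longrightarrow> index i \<Longrightarrow>
    ((\<lambda>s. p s x y i) has_real_derivative Ap t x y i) (at t within {0..})"
  unfolding polynomial_equation_def by blast

lemma represents_A: "t \<ge> 0 \<Longrightarrow> represents 0 (A t) (Ap t x y) (p t x y)"
  by (simp add: represents_def banded_A Ap_def)

lemma entry_A:
  assumes "t \<ge> 0" "index i" "index j"
  shows "entry (A t) i j = (if fst j < fst i then entry (J 1 t) i j + entry (J 2 t) i j else 0)"
proof -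
  obtain m r n c where [simp]: "i = (m, r)" "j = (n, c)" by (cases i, cases j)
  show ?thesis
    using assms C_carrier[of t 1 m] C_carrier[of t 2 m]
    by (auto simp: entry_def Amat_def Jmat_def sum12_def)
qed

lemma Ap_eq:
  assumes t: "t \<ge> 0" and n: "n \<ge> 1" and r: "r \<le> n"
  shows "Ap t x y (n, r) = (sum12 C n t *\<^sub>v Pvec G (n - 1) t x y) $ r"
proof -
  have "Ap t x y (n, r) = (\<Sum>k\<le>n. (A t n k *\<^sub>v Pvec G k t x y) $ r)"
    unfolding Ap_def using sum_tri_blocks[OF banded_A[OF t], where i="(n, r)" and K=n and x=x and y=y and t=t] r by simp
  also have "\<dots> = (\<Sum>k\<in>{n - 1}. (A t n k *\<^sub>v Pvec G k t x y) $ r)"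
  proof (rule sum.mono_neutral_right)
    show "\<forall>k\<in>{..n} - {n - 1}. (A t n k *\<^sub>v Pvec G k t x y) $ r = 0"
    proof
      fix k assume "k \<in> {..n} - {n - 1}"
      then have "A t n k = 0\<^sub>m (n + 1) (k + 1)" by (auto simp: Amat_def)
      then show "(A t n k *\<^sub>v Pvec G k t x y) $ r = 0"
        using r by (auto simp: scalar_prod_def Pvec_def intro!: sum.neutral)
    qed
  qed (use n in auto)
  finally show ?thesis using n by (simp add: Amat_def)
qed

lemma Ap_00: "Ap t x y (0, 0) = 0"
  by (simp add: Ap_def tri_0 entry_def Amat_def)

lemma polynomial_equation_iff:
  "polynomial_equation \<longleftrightarrow> (\<forall>n\<ge>1. \<forall>t\<ge>0. \<forall>x y.
     vec_has_deriv (\<lambda>s. Pvec G n s x y) (sum12 C n t *\<^sub>v Pvec G (n - 1) t x y) t)"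
proof -
  have vec: "vec_has_deriv (\<lambda>s. Pvec G n s x y) (sum12 C n t *\<^sub>v Pvec G (n - 1) t x y) t
      \<longleftrightarrow> (\<forall>r\<le>n. ((\<lambda>s. p s x y (n, r)) has_real_derivative Ap t x y (n, r)) (at t within {0..}))"
    if "n \<ge> 1" "t \<ge> 0" for n t x y
  proof -
    have dim: "dim_vec (sum12 C n t *\<^sub>v Pvec G (n - 1) t x y) = Suc n"
      using C12_carrier[OF that(2,1)] by simp
    have "Pvec G n s x y \<in> carrier_vec (Suc n)" for s by (simp add: Pvec_def)
    then show ?thesis
      unfolding vec_has_deriv_def dim less_Suc_eq_le p_def fst_conv snd_conv
      using Ap_eq[OF that(2,1), of _ x y] by metis
  qed
  show ?thesis
  proof
    assume pe: polynomial_equation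
    show "\<forall>n\<ge>1. \<forall>t\<ge>0. \<forall>x y.
        vec_has_deriv (\<lambda>s. Pvec G n s x y) (sum12 C n t *\<^sub>v Pvec G (n - 1) t x y) t"
    proof (intro allI impI)
      fix n :: nat and t x y :: real assume nt: "n \<ge> 1" "t \<ge> 0"
      show "vec_has_deriv (\<lambda>s. Pvec G n s x y) (sum12 C n t *\<^sub>v Pvec G (n - 1) t x y) t"
        unfolding vec[OF nt] by (intro allI impI polynomial_equationD[OF pe nt(2)]) simp
    qed
  next
    assume R: "\<forall>n\<ge>1. \<forall>t\<ge>0. \<forall>x y.
        vec_has_deriv (\<lambda>s. Pvec G n s x y) (sum12 C n t *\<^sub>v Pvec G (n - 1) t x y) t"
    show polynomial_equation
      unfolding polynomial_equation_def
    proof (intro allI impI)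
      fix t x y :: real and i :: "nat \<times> nat" assume t: "t \<ge> 0" and i: "index i"
      show "((\<lambda>s. p s x y i) has_real_derivative Ap t x y i) (at t within {0..})"
      proof (cases "fst i = 0")
        case True
        then have "i = (0, 0)" using i by (simp add: prod_eq_iff)
        then show ?thesis by (simp add: p_00 Ap_00)
      next
        case False
        then have "\<forall>r\<le>fst i. ((\<lambda>s. p s x y (fst i, r)) has_real_derivative Ap t x y (fst i, r)) (at t within {0..})"
          using R t vec[of "fst i" t x y] by simp
        then show ?thesis using i by (cases i) simp
      qed
    qed
  qed
qed

lemma coef_differentiable:
  assumes t: "t \<ge> 0" and "index i" "index j"
  shows "coef i j differentiable (at t within {0..})"
proof (cases "fst j < fst i")
  case True
  then show ?thesis
    using mat_entry_differentiable[OF diff_G[OF t True] G_carrier[OF _ True], of "snd i" "snd j"] assms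
    by (simp add: coef_def[abs_def])
qed (simp add: coef_def[abs_def])

text \<open>The time derivative of a polynomial of the system has lower degree, because the leading
  coefficients are constant.\<close>

lemma p_derivative:
  assumes t: "t \<ge> 0" and i: "index i"
  obtains g where "\<And>j. j \<in> tri (fst i) \<Longrightarrow> (coef i j has_real_derivative g j) (at t within {0..})"
    and "\<And>j. \<not> fst j < fst i \<Longrightarrow> g j = 0"
    and "\<And>x y. ((\<lambda>s. p s x y i) has_real_derivative (\<Sum>j\<in>tri (fst i). g j * monomial j x y)) (at t within {0..})"
proof -
  have "\<forall>j\<in>tri (fst i). \<exists>d. (coef i j has_real_derivative d) (at t within {0..})"
    using coef_differentiable[OF t i] by (auto simp: mem_tri intro!: real_differentiableD)
  then obtain d where d: "\<And>j. j \<in> tri (fst i) \<Longrightarrow> (coef i j has_real_derivative d j) (at t within {0..})"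
    by metis
  define g where "g j = (if fst j < fst i then d j else 0)" for j
  have g: "(coef i j has_real_derivative g j) (at t within {0..})" if "j \<in> tri (fst i)" for j
    using d[OF that] by (cases "fst j < fst i") (simp_all add: g_def coef_def[abs_def])
  show ?thesis
  proof (rule that[of g, OF g])
    fix x y
    have "((\<lambda>s. \<Sum>j\<in>tri (fst i). coef i j s * monomial j x y) has_real_derivative
        (\<Sum>j\<in>tri (fst i). g j * monomial j x y)) (at t within {0..})"
      by (intro DERIV_sum DERIV_cmult_right g)
    then show "((\<lambda>s. p s x y i) has_real_derivative (\<Sum>j\<in>tri (fst i). g j * monomial j x y)) (at t within {0..})"
      by (rule has_real_derivative_cong_nonnegative) (simp_all add: t i p_expansion)
  qed (simp_all add: g_def)
qed

lemma entry_J_differentiable: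
  assumes t: "t \<ge> 0" and e: "e \<in> {1, 2}" and ij: "index i" "index j"
  shows "(\<lambda>s. entry (J e s) i j) differentiable (at t within {0..})"
proof -
  obtain m r n c where [simp]: "i = (m, r)" "j = (n, c)" by (cases i, cases j)
  have rc: "r \<le> m" "c \<le> n" using ij by auto
  consider "n = m" | "n = m + 1" | "m = n + 1" | "n \<noteq> m" "n \<noteq> m + 1" "m \<noteq> n + 1" by blast
  then show ?thesis
  proof cases
    case 1
    then show ?thesis
      using mat_entry_differentiable[OF diff_D[OF t e, of m] D_carrier[OF _ e], of r c] rc
      by (simp add: entry_def Jmat_def)
  next
    case 3
    then show ?thesis
      using mat_entry_differentiable[OF diff_C[OF t _ e, of m] C_carrier[OF _ e], of r c] rc
      by (simp add: entry_def Jmat_def)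
  qed (simp_all add: entry_def Jmat_def)
qed

text \<open>Let multiplication by a function \<open>q\<close> of \<open>x\<close> and \<open>y\<close> alone have the matrix \<open>M\<close>. Differentiating
  \<open>q P = M P\<close> and inserting \<open>P' = A P\<close> gives \<open>A M P = M' P + M A P\<close>, and the coefficients of \<open>P\<close> are
  unique.\<close>

lemma commutator_derivative_if_polynomial_equation:
  assumes pe: polynomial_equation and t: "t \<ge> 0"
    and M: "\<And>s x y. s \<ge> 0 \<Longrightarrow> represents w (M s) (\<lambda>j. q x y * p s x y j) (p s x y)"
    and dM: "\<And>i j. index i \<Longrightarrow> index j \<Longrightarrow> (\<lambda>s. entry (M s) i j) differentiable (at t within {0..})"
  shows "bmat_has_deriv M (bmat_comm (A t) (M t)) t"
proof -
  have bM: "banded w (M s)" if "s \<ge> 0" for s by (rule represents_banded[OF M[OF that]])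
  have "\<exists>d. \<forall>i j. index i \<longrightarrow> index j \<longrightarrow> ((\<lambda>s. entry (M s) i j) has_real_derivative d i j) (at t within {0..})"
    using real_differentiableD[OF dM] by metis
  then obtain d where d: "\<And>i j. index i \<Longrightarrow> index j \<Longrightarrow> ((\<lambda>s. entry (M s) i j) has_real_derivative d i j) (at t within {0..})"
    by blast
  have d_eq: "d i j = entry (bmat_comm (A t) (M t)) i j" if ij: "index i" "index j" for i j
  proof -
    define K where "K = max (fst j) (fst i + w)"
    have K: "fst i + w \<le> K" "j \<in> tri K" using ij by (auto simp: K_def mem_tri)
    have "d i j - entry (bmat_comm (A t) (M t)) i j = 0"
    proof (rule p_independent[OF t _ K(2)])
      fix x y
      have "((\<lambda>s. q x y * p s x y i) has_real_derivative q x y * Ap t x y i) (at t within {0..})"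
        by (intro DERIV_cmult polynomial_equationD[OF pe t ij(1)])
      moreover have "((\<lambda>s. q x y * p s x y i) has_real_derivative
          (\<Sum>l\<in>tri K. d i l * p t x y l + Ap t x y l * entry (M t) i l)) (at t within {0..})"
      proof (rule has_real_derivative_cong_nonnegative[OF _ t])
        show "((\<lambda>s. \<Sum>l\<in>tri K. entry (M s) i l * p s x y l) has_real_derivative
          (\<Sum>l\<in>tri K. d i l * p t x y l + Ap t x y l * entry (M t) i l)) (at t within {0..})"
          using ij by (intro DERIV_sum DERIV_mult d polynomial_equationD[OF pe t]) (auto simp: mem_tri)
        show "(\<Sum>l\<in>tri K. entry (M s) i l * p s x y l) = q x y * p s x y i" if "s \<ge> 0" for s
          by (rule representsD[OF M[OF that] ij(1) K(1), symmetric])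
      qed
      ultimately have "q x y * Ap t x y i = (\<Sum>l\<in>tri K. d i l * p t x y l + Ap t x y l * entry (M t) i l)"
        using t by (rule DERIV_unique_nonnegative)
      moreover have "q x y * Ap t x y i = (\<Sum>l\<in>tri K. entry (bmat_mult (A t) (M t)) i l * p t x y l)"
        by (rule representsD[OF represents_mult[OF represents_scale[OF represents_A[OF t]] M[OF t]] ij(1)])
          (use K in simp)
      moreover have "(\<Sum>l\<in>tri K. entry (M t) i l * Ap t x y l) = (\<Sum>l\<in>tri K. entry (bmat_mult (M t) (A t)) i l * p t x y l)"
      proof -
        have "represents w (M t) (\<lambda>i. \<Sum>l\<in>tri (fst i + w). entry (M t) i l * Ap t x y l) (Ap t x y)"
          by (simp add: represents_def bM[OF t])
        from representsD[OF this ij(1) K(1)] representsD[OF represents_mult[OF this represents_A[OF t]] ij(1), of K] K(1)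
        show ?thesis by simp
      qed
      moreover have comm: "(\<Sum>l\<in>tri K. (d i l - entry (bmat_comm (A t) (M t)) i l) * p t x y l)
          = (\<Sum>l\<in>tri K. d i l * p t x y l - (entry (bmat_mult (A t) (M t)) i l * p t x y l
              - entry (bmat_mult (M t) (A t)) i l * p t x y l))"
        by (intro sum.cong) (auto simp: mem_tri entry_comm[OF ij(1)] left_diff_distrib)
      ultimately show "(\<Sum>l\<in>tri K. (d i l - entry (bmat_comm (A t) (M t)) i l) * p t x y l) = 0"
        unfolding comm
        by (simp add: left_diff_distrib sum_subtractf sum.distrib mult.commute[of "Ap t x y _"])
    qed
    then show ?thesis by simp
  qed
  show ?thesis
  proof (subst bmat_has_deriv_iff)
    show "\<forall>i j. index i \<longrightarrow> index j \<longrightarrow>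
      ((\<lambda>s. entry (M s) i j) has_real_derivative entry (bmat_comm (A t) (M t)) i j) (at t within {0..})"
      using d by (simp add: d_eq)
  qed (rule banded_carrier[OF bM] bmat_comm_carrier | assumption)+
qed

definition JJ :: "nat \<Rightarrow> nat \<Rightarrow> real \<Rightarrow> bmat" where
  "JJ h k s = bmat_mult (bmat_pow (J 1 s) h) (bmat_pow (J 2 s) k)"

definition product_equation :: bool where
  "product_equation \<longleftrightarrow> (\<forall>t\<ge>0. \<forall>h k. bmat_has_deriv (JJ h k) (bmat_comm (A t) (JJ h k t)) t)"

definition Lax_equation :: bool where
  "Lax_equation \<longleftrightarrow> (\<forall>t\<ge>0. \<forall>e\<in>{1, 2}. bmat_has_deriv (J e) (bmat_comm (A t) (J e t)) t)"

lemma represents_JJ: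
  assumes t: "t \<ge> 0"
  shows "represents (h + k) (JJ h k t) (\<lambda>j. (x ^ h * y ^ k) * p t x y j) (p t x y)"
proof -
  have 1: "represents (h * 1) (bmat_pow (J 1 t) h) (\<lambda>j. x ^ h * p t x y j) (p t x y)"
    using represents_pow[OF represents_J[OF t, of 1 x y]] by (simp add: coord_def)
  have 2: "represents (k * 1) (bmat_pow (J 2 t) k) (\<lambda>j. y ^ k * p t x y j) (p t x y)"
    using represents_pow[OF represents_J[OF t, of 2 x y]] by (simp add: coord_def)
  show ?thesis
    using represents_mult[OF represents_scale[OF 1, of "y ^ k"] 2] by (simp add: JJ_def mult_ac)
qed

lemma entry_pow_differentiable:
  assumes t: "t \<ge> 0" and e: "e \<in> {1, 2}" and ij: "index i" "index j"
  shows "(\<lambda>s. entry (bmat_pow (J e s) h) i j) differentiable (at t within {0..})"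
  using ij
proof (induction h arbitrary: i j)
  case (Suc h)
  show ?case
    unfolding bmat_pow.simps
    by (rule entry_differentiable_mult[OF banded_J[OF _ e] banded_pow[OF banded_J[OF _ e]]
          entry_J_differentiable[OF t e] Suc.IH t Suc.prems])
qed simp

lemma entry_JJ_differentiable:
  assumes t: "t \<ge> 0" and ij: "index i" "index j"
  shows "(\<lambda>s. entry (JJ h k s) i j) differentiable (at t within {0..})"
  unfolding JJ_def
  by (rule entry_differentiable_mult[OF banded_pow[OF banded_J] banded_pow[OF banded_J]
        entry_pow_differentiable[OF t] entry_pow_differentiable[OF t] t ij]) auto

lemma polynomial_equation_imp_product_equation:
  assumes polynomial_equation shows product_equation
  unfolding product_equation_def
  using commutator_derivative_if_polynomial_equation[OF assms _ represents_JJ entry_JJ_differentiable] by blast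

lemma bmat_has_deriv_cong:
  assumes "bmat_has_deriv M M' t" "t \<ge> 0" "\<And>s. s \<ge> 0 \<Longrightarrow> M s = N s"
  shows "bmat_has_deriv N M' t"
  unfolding bmat_has_deriv_def mat_has_deriv_def
proof (intro allI conjI impI)
  fix m n and s :: real assume "s \<ge> 0"
  then show "N s m n \<in> carrier_mat (dim_row (M' m n)) (dim_col (M' m n))"
    using assms(1) by (simp add: bmat_has_deriv_def mat_has_deriv_def flip: assms(3))
next
  fix m n r c assume rc: "r < dim_row (M' m n)" "c < dim_col (M' m n)"
  then have "((\<lambda>s. M s m n $$ (r, c)) has_real_derivative M' m n $$ (r, c)) (at t within {0..})"
    using assms(1) by (simp add: bmat_has_deriv_def mat_has_deriv_def)
  then show "((\<lambda>s. N s m n $$ (r, c)) has_real_derivative M' m n $$ (r, c)) (at t within {0..})"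
    by (rule has_real_derivative_cong_nonnegative) (simp_all add: assms(2,3))
qed

lemma JJ_10: "t \<ge> 0 \<Longrightarrow> JJ 1 0 t = J 1 t"
  by (simp add: JJ_def bmat_mult_one_right[OF banded_J])

lemma JJ_01: "t \<ge> 0 \<Longrightarrow> JJ 0 1 t = J 2 t"
  by (simp add: JJ_def bmat_mult_one_right[OF banded_J] bmat_mult_one_left[OF banded_J])

lemma product_equation_imp_Lax_equation:
  assumes product_equation shows Lax_equation
  unfolding Lax_equation_def
proof (intro allI impI ballI)
  fix t :: real and e :: nat assume t: "t \<ge> 0" and "e \<in> {1, 2}"
  then consider "e = 1" | "e = 2" by auto
  then show "bmat_has_deriv (J e) (bmat_comm (A t) (J e t)) t"
  proof cases
    case 1
    then show ?thesis
      using assms t JJ_10 bmat_has_deriv_cong[of "JJ 1 0" _ t "J 1"] by (metis product_equation_def)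
  next
    case 2
    then show ?thesis
      using assms t JJ_01 bmat_has_deriv_cong[of "JJ 0 1" _ t "J 2"] by (metis product_equation_def)
  qed
qed

text \<open>The recurrence determines each block from the previous ones, because the blocks \<open>[I | 0]\<close> and \<open>[0 | I]\<close>
  together reach every entry of the next block.\<close>

lemma zero_if_recurrence:
  assumes t: "t \<ge> 0" and Q0: "Q (0, 0) = 0"
    and rec: "\<And>e i. e \<in> {1, 2} \<Longrightarrow> index i \<Longrightarrow> c e * Q i = (\<Sum>j\<in>tri (fst i + 1). entry (J e t) i j * Q j)"
    and i: "index i"
  shows "Q i = (0::real)"
proof -
  have "\<forall>i. index i \<and> fst i \<le> n \<longrightarrow> Q i = 0" for n
  proof (induction n)
    case 0
    then show ?case using Q0 by auto
  next
    case (Suc n)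
    show ?case
    proof (intro allI impI)
      fix i assume i: "index i \<and> fst i \<le> Suc n"
      show "Q i = 0"
      proof (cases "fst i \<le> n")
        case True
        then show ?thesis using Suc i by blast
      next
        case False
        define s where "s = snd i"
        have i_eq: "i = (Suc n, s)" and s: "s \<le> Suc n" using i False by (auto simp: prod_eq_iff s_def)
        obtain e r where e: "e \<in> {1::nat, 2}" and r: "r \<le> n" "s = (if e = 1 then r else r + 1)"
        proof (cases "s \<le> n")
          case True
          then show ?thesis by (intro that[of 1 s]) auto
        next
          case False
          then show ?thesis using s by (intro that[of 2 n]) auto
        qed
        have "0 = c e * Q (n, r)" using Suc r by simp
        also have "\<dots> = (\<Sum>j\<in>tri (n + 1). entry (J e t) (n, r) j * Q j)"
          using rec[OF e, of "(n, r)"] r by simp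
        also have "\<dots> = (\<Sum>j\<in>tri (n + 1). if j = i then Q i else 0)"
        proof (intro sum.cong refl)
          fix j assume j: "j \<in> tri (n + 1)"
          show "entry (J e t) (n, r) j * Q j = (if j = i then Q i else 0)"
          proof (cases "fst j \<le> n")
            case True
            then have "Q j = 0" using Suc j unfolding mem_tri by blast
            moreover have "j \<noteq> i" using True i_eq by auto
            ultimately show ?thesis by simp
          next
            case False
            then have fj: "fst j = n + 1" and sj: "snd j \<le> n + 1" using j by (auto simp: mem_tri)
            have "entry (J e t) (n, r) j = (if snd j = s then 1 else 0)"
              using r sj fj by (auto simp: entry_def Jmat_def L_def)
            moreover have "j = i \<longleftrightarrow> snd j = s" using fj unfolding i_eq by (simp add: prod_eq_iff)
            ultimately show ?thesis by auto
          qed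
        qed
        also have "\<dots> = Q i" using i by (simp add: mem_tri)
        finally show ?thesis by simp
      qed
    qed
  qed
  then show ?thesis using i by blast
qed

text \<open>Differentiating \<open>x P = J P\<close> and inserting \<open>J' = A J - J A\<close> gives \<open>x (P' - A P) = J (P' - A P)\<close>.\<close>

lemma Lax_equation_imp_polynomial_equation:
  assumes lax: Lax_equation shows polynomial_equation
  unfolding polynomial_equation_def
proof (intro allI impI)
  fix t x y :: real and i :: "nat \<times> nat" assume t: "t \<ge> 0" and i: "index i"
  have "\<exists>d. ((\<lambda>s. p s x y i) has_real_derivative d) (at t within {0..})" if "index i" for i
    by (rule p_derivative[OF t that]) blast
  then obtain P' where P': "\<And>i. index i \<Longrightarrow> ((\<lambda>s. p s x y i) has_real_derivative P' i) (at t within {0..})"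
    by metis
  have "P' i - Ap t x y i = 0"
  proof (rule zero_if_recurrence[OF t _ _ i, where Q="\<lambda>i. P' i - Ap t x y i" and c="\<lambda>e. coord e x y"])
    have "((\<lambda>s. p s x y (0, 0)) has_real_derivative 0) (at t within {0..})" by (simp add: p_00)
    then show "P' (0, 0) - Ap t x y (0, 0) = 0"
      using DERIV_unique_nonnegative[OF P'[of "(0, 0)"] _ t] by (simp add: Ap_00)
  next
    fix e i assume e: "e \<in> {1::nat, 2}" and i: "index (i :: nat \<times> nat)"
    let ?T = "tri (fst i + 1)"
    have dJ: "((\<lambda>s. entry (J e s) i j) has_real_derivative entry (bmat_comm (A t) (J e t)) i j) (at t within {0..})"
      if "index j" for j
    proof -
      have "bmat_has_deriv (J e) (bmat_comm (A t) (J e t)) t"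
        using lax t e unfolding Lax_equation_def by blast
      then show ?thesis
        using bmat_has_deriv_iff[of "J e" "bmat_comm (A t) (J e t)" t] banded_carrier[OF banded_J[OF _ e]]
          bmat_comm_carrier i that by blast
    qed
    have "((\<lambda>s. coord e x y * p s x y i) has_real_derivative coord e x y * P' i) (at t within {0..})"
      by (intro DERIV_cmult P' i)
    moreover have "((\<lambda>s. coord e x y * p s x y i) has_real_derivative
        (\<Sum>j\<in>?T. entry (bmat_comm (A t) (J e t)) i j * p t x y j + P' j * entry (J e t) i j)) (at t within {0..})"
    proof (rule has_real_derivative_cong_nonnegative[OF _ t])
      show "((\<lambda>s. \<Sum>j\<in>?T. entry (J e s) i j * p s x y j) has_real_derivative
        (\<Sum>j\<in>?T. entry (bmat_comm (A t) (J e t)) i j * p t x y j + P' j * entry (J e t) i j)) (at t within {0..})"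
        by (intro DERIV_sum DERIV_mult dJ P') (auto simp: mem_tri)
      show "(\<Sum>j\<in>?T. entry (J e s) i j * p s x y j) = coord e x y * p s x y i" if "s \<ge> 0" for s
        by (rule representsD[OF represents_J[OF that e] i, symmetric]) simp
    qed
    ultimately have 1: "coord e x y * P' i
        = (\<Sum>j\<in>?T. entry (bmat_comm (A t) (J e t)) i j * p t x y j + P' j * entry (J e t) i j)"
      using t by (rule DERIV_unique_nonnegative)
    have 2: "coord e x y * Ap t x y i = (\<Sum>j\<in>?T. entry (bmat_mult (A t) (J e t)) i j * p t x y j)"
      by (rule representsD[OF represents_mult[OF represents_scale[OF represents_A[OF t]] represents_J[OF t e]] i]) simp
    have "represents 1 (J e t) (\<lambda>i. \<Sum>j\<in>tri (fst i + 1). entry (J e t) i j * Ap t x y j) (Ap t x y)"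
      using banded_J[OF t e] by (simp add: represents_def)
    from representsD[OF represents_mult[OF this represents_A[OF t]] i, of "fst i + 1"]
    have 3: "(\<Sum>j\<in>?T. entry (J e t) i j * Ap t x y j) = (\<Sum>j\<in>?T. entry (bmat_mult (J e t) (A t)) i j * p t x y j)"
      by simp
    have "(\<Sum>j\<in>?T. entry (bmat_comm (A t) (J e t)) i j * p t x y j)
        = (\<Sum>j\<in>?T. entry (bmat_mult (A t) (J e t)) i j * p t x y j - entry (bmat_mult (J e t) (A t)) i j * p t x y j)"
      using i by (intro sum.cong) (auto simp: mem_tri entry_comm left_diff_distrib)
    then have 4: "(\<Sum>j\<in>?T. entry (bmat_comm (A t) (J e t)) i j * p t x y j)
        = coord e x y * Ap t x y i - (\<Sum>j\<in>?T. entry (J e t) i j * Ap t x y j)"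
      unfolding 2 3 by (simp only: sum_subtractf)
    show "coord e x y * (P' i - Ap t x y i) = (\<Sum>j\<in>?T. entry (J e t) i j * (P' j - Ap t x y j))"
      unfolding right_diff_distrib 1 sum_subtractf sum.distrib 4 by (simp add: mult.commute[of "P' _"])
  qed
  then show "((\<lambda>s. p s x y i) has_real_derivative Ap t x y i) (at t within {0..})"
    using P'[OF i] by simp
qed

text \<open>Integrating the expansion of \<open>x\<^sup>h y\<^sup>k\<close> singles out the coefficient of the constant polynomial.\<close>

lemma mom_JJ:
  assumes t: "t \<ge> 0" shows "mom h k t = entry (JJ h k t) (0, 0) (0, 0)"
proof -
  have "mom h k t = \<mu> t (\<lambda>x y. \<Sum>j\<in>tri (h + k). entry (JJ h k t) (0, 0) j * p t x y j)"
    unfolding moment_def using representsD[OF represents_JJ[OF t, of h k], of "(0, 0)" "h + k"]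
    by (simp add: p_00)
  also have "\<dots> = (\<Sum>j\<in>tri (h + k). entry (JJ h k t) (0, 0) j * \<mu> t (\<lambda>x y. p t x y j))"
    by (intro wintegral_combination t finite_tri continuous2_p) (auto simp: mem_tri)
  also have "\<dots> = (\<Sum>j\<in>tri (h + k). if j = (0, 0) then entry (JJ h k t) (0, 0) (0, 0) else 0)"
    using t by (intro sum.cong) (auto simp: mem_tri wintegral_p)
  finally show ?thesis by (simp add: mem_tri)
qed

lemma wintegral_coordinate_p:
  assumes t: "t \<ge> 0" and e: "e \<in> {1, 2}" and i: "index i"
  shows "\<mu> t (\<lambda>x y. coord e x y * p t x y i) = entry (J e t) i (0, 0)"
proof -
  have "\<mu> t (\<lambda>x y. coord e x y * p t x y i) = \<mu> t (\<lambda>x y. \<Sum>j\<in>tri (fst i + 1). entry (J e t) i j * p t x y j)"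
    using representsD[OF represents_J[OF t e] i, of "fst i + 1"] by simp
  also have "\<dots> = (\<Sum>j\<in>tri (fst i + 1). entry (J e t) i j * \<mu> t (\<lambda>x y. p t x y j))"
    by (intro wintegral_combination t finite_tri continuous2_p) (auto simp: mem_tri)
  also have "\<dots> = (\<Sum>j\<in>tri (fst i + 1). if j = (0, 0) then entry (J e t) i (0, 0) else 0)"
    using t by (intro sum.cong) (auto simp: mem_tri wintegral_p)
  finally show ?thesis by (simp add: mem_tri)
qed

lemma drift_eq_D0:
  assumes t: "t \<ge> 0" shows "drift t = entry (J 1 t) (0, 0) (0, 0) + entry (J 2 t) (0, 0) (0, 0)"
    and "drift t = sum12 D 0 t $$ (0, 0)"
proof -
  show *: "drift t = entry (J 1 t) (0, 0) (0, 0) + entry (J 2 t) (0, 0) (0, 0)"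
    using wintegral_coordinate_p[OF t, of 1 "(0, 0)"] wintegral_coordinate_p[OF t, of 2 "(0, 0)"]
    by (simp add: drift_def moment_def coord_def p_00)
  then show "drift t = sum12 D 0 t $$ (0, 0)"
    using D_carrier[OF t, of 1 0] D_carrier[OF t, of 2 0] by (simp add: entry_def Jmat_def sum12_def)
qed

lemma continuous2_coord: "continuous2 (coord e)"
  unfolding coord_def by (cases "e = 1") (auto intro!: continuous_intros)

text \<open>The \<open>(0, 0)\<close> entry of the commutator: \<open>A\<close> has no row \<open>0\<close>, and its column \<open>0\<close> is that of \<open>J 1 + J 2\<close>
  without the diagonal block \<open>D\<^sub>0\<close>.\<close>

lemma product_equation_imp_moment_equation:
  assumes pe: product_equation shows moment_equation
  unfolding moment_equation_def
proof (intro allI impI)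
  fix t :: real and h k assume t: "t \<ge> 0"
  let ?M = "JJ h k t" and ?o = "(0, 0) :: nat \<times> nat" and ?T = "tri (h + k)"
  have bM: "banded (h + k) (JJ h k s)" if "s \<ge> 0" for s by (rule represents_banded[OF represents_JJ[OF that]])
  have "bmat_has_deriv (JJ h k) (bmat_comm (A t) ?M) t" using pe t unfolding product_equation_def by blast
  then have "((\<lambda>s. entry (JJ h k s) ?o ?o) has_real_derivative entry (bmat_comm (A t) ?M) ?o ?o) (at t within {0..})"
    using bmat_has_deriv_iff[of "JJ h k" "bmat_comm (A t) ?M" t] banded_carrier[OF bM] bmat_comm_carrier by auto
  then have d: "(mom h k has_real_derivative entry (bmat_comm (A t) ?M) ?o ?o) (at t within {0..})"
    by (rule has_real_derivative_cong_nonnegative[OF _ t]) (simp add: mom_JJ)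
  have "entry (bmat_mult (A t) ?M) ?o ?o = 0"
    using entry_mult[OF banded_A[OF t] bM[OF t], of ?o ?o 0] by (simp add: tri_0 entry_A[OF t])
  moreover have "entry (bmat_mult ?M (A t)) ?o ?o = (\<Sum>j\<in>?T. entry ?M ?o j * entry (A t) j ?o)"
    by (rule entry_mult[OF bM[OF t] banded_A[OF t]]) auto
  moreover have "mom (h + 1) k t + mom h (k + 1) t = (\<Sum>j\<in>?T. entry ?M ?o j * entry (A t) j ?o) + mom h k t * drift t"
  proof -
    have expand: "\<mu> t (\<lambda>x y. coord e x y * (x ^ h * y ^ k)) = (\<Sum>j\<in>?T. entry ?M ?o j * entry (J e t) j ?o)"
      if e: "e \<in> {1, 2}" for e
    proof -
      have "coord e x y * (x ^ h * y ^ k) = (\<Sum>j\<in>?T. entry ?M ?o j * (coord e x y * p t x y j))" for x y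
      proof -
        have "x ^ h * y ^ k = (\<Sum>j\<in>?T. entry ?M ?o j * p t x y j)"
          using representsD[OF represents_JJ[OF t, of h k x y], of ?o "h + k"] by (simp add: p_00)
        then show ?thesis by (simp add: sum_distrib_left mult_ac)
      qed
      then have "\<mu> t (\<lambda>x y. coord e x y * (x ^ h * y ^ k)) = \<mu> t (\<lambda>x y. \<Sum>j\<in>?T. entry ?M ?o j * (coord e x y * p t x y j))"
        by simp
      also have "\<dots> = (\<Sum>j\<in>?T. entry ?M ?o j * \<mu> t (\<lambda>x y. coord e x y * p t x y j))"
        by (intro wintegral_combination t finite_tri continuous_on_mult continuous2_p continuous2_coord) (auto simp: mem_tri)
      also have "\<dots> = (\<Sum>j\<in>?T. entry ?M ?o j * entry (J e t) j ?o)"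
        by (intro sum.cong) (auto simp: mem_tri wintegral_coordinate_p[OF t e])
      finally show ?thesis .
    qed
    have "mom (h + 1) k t + mom h (k + 1) t = (\<Sum>j\<in>?T. entry ?M ?o j * (entry (J 1 t) j ?o + entry (J 2 t) j ?o))"
      using expand[of 1] expand[of 2]
      by (simp add: moment_def coord_def distrib_left sum.distrib mult_ac)
    also have "\<dots> = (\<Sum>j\<in>?T. entry ?M ?o j * entry (A t) j ?o + (if j = ?o then entry ?M ?o ?o * drift t else 0))"
    proof (intro sum.cong refl)
      fix j assume "j \<in> ?T"
      then have j: "index j" by (simp add: mem_tri)
      show "entry ?M ?o j * (entry (J 1 t) j ?o + entry (J 2 t) j ?o)
          = entry ?M ?o j * entry (A t) j ?o + (if j = ?o then entry ?M ?o ?o * drift t else 0)"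
      proof (cases "fst j = 0")
        case True
        then have "j = ?o" using j by (simp add: prod_eq_iff)
        then show ?thesis using drift_eq_D0(1)[OF t] entry_A[OF t, of ?o ?o] by simp
      next
        case False
        then show ?thesis using entry_A[OF t j, of ?o] by auto
      qed
    qed
    finally show ?thesis by (simp add: sum.distrib mem_tri mom_JJ[OF t])
  qed
  ultimately have "entry (bmat_comm (A t) ?M) ?o ?o = - mom (h + 1) k t - mom h (k + 1) t + mom h k t * drift t"
    by (simp add: entry_comm)
  with d show "(mom h k has_real_derivative - mom (h + 1) k t - mom h (k + 1) t + mom h k t * drift t) (at t within {0..})"
    by simp
qed

text \<open>Inductively, a monomial differs from the polynomial with this leading term by monomials of lower degree.\<close>

lemma p_orthogonal_monomial:
  assumes t: "t \<ge> 0" and i: "index i" and l: "index l" "fst l < fst i"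
  shows "\<mu> t (\<lambda>x y. p t x y i * monomial l x y) = 0"
  using l
proof (induction "fst l" arbitrary: l rule: less_induct)
  case less
  define T where "T = {j \<in> tri (fst l). fst j < fst l}"
  have T: "finite T" "\<And>j. j \<in> T \<Longrightarrow> index j \<and> fst j < fst l"
    by (simp_all add: T_def) (simp add: mem_tri)
  have split: "p t x y l = monomial l x y + (\<Sum>j\<in>T. coef l j t * monomial j x y)" for x y
  proof -
    have "p t x y l = (\<Sum>j\<in>insert l T. coef l j t * monomial j x y)"
      unfolding p_expansion[OF t less.prems(1)]
      using less.prems(1)
      by (intro sum.mono_neutral_right) (auto simp: T_def mem_tri coef_def)
    moreover have "l \<notin> T" by (simp add: T_def)
    ultimately show ?thesis using T(1) by (simp add: coef_def)
  qed
  have "\<mu> t (\<lambda>x y. p t x y i * monomial l x y)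
      = \<mu> t (\<lambda>x y. p t x y i * p t x y l - (\<Sum>j\<in>T. coef l j t * (p t x y i * monomial j x y)))"
    by (simp add: split distrib_left sum_distrib_left mult_ac)
  also have "\<dots> = \<mu> t (\<lambda>x y. p t x y i * p t x y l) - \<mu> t (\<lambda>x y. \<Sum>j\<in>T. coef l j t * (p t x y i * monomial j x y))"
    using i less.prems(1) t
    by (intro wintegral_diff continuous_on_sum continuous_on_mult continuous_on_const continuous2_p continuous2_monomial)
  also have "\<mu> t (\<lambda>x y. \<Sum>j\<in>T. coef l j t * (p t x y i * monomial j x y))
      = (\<Sum>j\<in>T. coef l j t * \<mu> t (\<lambda>x y. p t x y i * monomial j x y))"
    using i t T(1) by (intro wintegral_combination continuous_on_mult continuous2_p continuous2_monomial)
  also have "\<dots> = 0"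
  proof (rule sum.neutral, rule ballI)
    fix j assume "j \<in> T"
    then show "coef l j t * \<mu> t (\<lambda>x y. p t x y i * monomial j x y) = 0"
      using less.hyps[of j] T(2)[of j] less.prems(2) by simp
  qed
  finally show ?case using p_orthogonal[OF t i less.prems(1)] less.prems(2) by simp
qed

lemma wintegral_monomials:
  "\<mu> t (\<lambda>x y. monomial j x y * monomial l x y)
    = mom ((fst j - snd j) + (fst l - snd l)) (snd j + snd l) t"
  by (simp add: monomial_def moment_def power_add mult_ac)

lemma wintegral_coordinate_monomials:
  "\<mu> t (\<lambda>x y. coord 1 x y * (monomial j x y * monomial l x y))
    = mom ((fst j - snd j) + (fst l - snd l) + 1) (snd j + snd l) t"
  "\<mu> t (\<lambda>x y. coord 2 x y * (monomial j x y * monomial l x y))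
    = mom ((fst j - snd j) + (fst l - snd l)) (snd j + snd l + 1) t"
  by (simp_all add: coord_def monomial_def moment_def power_add mult_ac)

text \<open>Against a polynomial of lower degree, multiplication by \<open>x + y\<close> acts on the system only through
  the lower block, which is \<open>A\<close>.\<close>

lemma wintegral_x_plus_y_p:
  assumes t: "t \<ge> 0" and i: "index i" and l: "index l" "fst l < fst i"
  shows "\<mu> t (\<lambda>x y. coord 1 x y * (p t x y i * monomial l x y)) + \<mu> t (\<lambda>x y. coord 2 x y * (p t x y i * monomial l x y))
    = \<mu> t (\<lambda>x y. Ap t x y i * monomial l x y)"
proof -
  define T where "T = tri (fst i + 1)"
  let ?I = "\<lambda>j. \<mu> t (\<lambda>x y. p t x y j * monomial l x y)"
  have T: "finite T" "\<And>j. j \<in> T \<Longrightarrow> index j" by (auto simp: T_def mem_tri)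
  have expand: "\<mu> t (\<lambda>x y. coord e x y * (p t x y i * monomial l x y)) = (\<Sum>j\<in>T. entry (J e t) i j * ?I j)"
    if e: "e \<in> {1, 2}" for e
  proof -
    have "coord e x y * (p t x y i * monomial l x y) = (\<Sum>j\<in>T. entry (J e t) i j * (p t x y j * monomial l x y))" for x y
    proof -
      have "coord e x y * p t x y i = (\<Sum>j\<in>T. entry (J e t) i j * p t x y j)"
        unfolding T_def by (rule representsD[OF represents_J[OF t e] i]) simp
      then show ?thesis by (simp add: mult.assoc[symmetric] sum_distrib_right)
    qed
    then show ?thesis
      using t T by (simp add: wintegral_combination continuous_on_mult continuous2_p continuous2_monomial)
  qed
  have "\<mu> t (\<lambda>x y. Ap t x y i * monomial l x y) = (\<Sum>j\<in>tri (fst i). entry (A t) i j * ?I j)"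
  proof -
    have "Ap t x y i * monomial l x y = (\<Sum>j\<in>tri (fst i). entry (A t) i j * (p t x y j * monomial l x y))" for x y
      by (simp add: Ap_def sum_distrib_right mult.assoc)
    then have "\<mu> t (\<lambda>x y. Ap t x y i * monomial l x y)
        = \<mu> t (\<lambda>x y. \<Sum>j\<in>tri (fst i). entry (A t) i j * (p t x y j * monomial l x y))" by simp
    also have "\<dots> = (\<Sum>j\<in>tri (fst i). entry (A t) i j * ?I j)"
      by (intro wintegral_combination t finite_tri continuous_on_mult continuous2_p continuous2_monomial)
        (simp add: mem_tri)
    finally show ?thesis .
  qed
  also have "\<dots> = (\<Sum>j\<in>T. entry (A t) i j * ?I j)"
    unfolding T_def using t i entry_A by (intro sum.mono_neutral_left) (auto simp: mem_tri)
  also have "\<dots> = (\<Sum>j\<in>T. entry (J 1 t) i j * ?I j + entry (J 2 t) i j * ?I j)"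
  proof (intro sum.cong refl)
    fix j assume "j \<in> T"
    then have j: "index j" by (rule T(2))
    show "entry (A t) i j * ?I j = entry (J 1 t) i j * ?I j + entry (J 2 t) i j * ?I j"
    proof (cases "fst j < fst i")
      case True
      then show ?thesis by (simp add: entry_A[OF t i j] distrib_right)
    next
      case False
      then show ?thesis using p_orthogonal_monomial[OF t j l(1)] l(2) by simp
    qed
  qed
  finally show ?thesis using expand[of 1] expand[of 2] by (simp add: sum.distrib)
qed

text \<open>Differentiating the orthogonality relations shows that the defect of the polynomial equation is
  orthogonal to all polynomials of lower degree; it is itself such a polynomial.\<close>

lemma moment_equation_imp_polynomial_equation:
  assumes me: moment_equation shows polynomial_equation
  unfolding polynomial_equation_def
proof (intro allI impI)
  fix t x0 y0 :: real and i :: "nat \<times> nat" assume t: "t \<ge> 0" and i: "index i"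
  define S where "S = tri (fst i)"
  define T where "T = {j \<in> S. fst j < fst i}"
  have S: "finite S" "\<And>j. j \<in> S \<Longrightarrow> index j" by (auto simp: S_def mem_tri)
  have T: "finite T" "\<And>j. j \<in> T \<Longrightarrow> index j \<and> fst j < fst i"
    by (simp_all add: T_def S_def) (simp add: mem_tri)
  obtain g where g: "\<And>j. j \<in> S \<Longrightarrow> (coef i j has_real_derivative g j) (at t within {0..})"
    and g0: "\<And>j. \<not> fst j < fst i \<Longrightarrow> g j = 0"
    and dp: "\<And>x y. ((\<lambda>s. p s x y i) has_real_derivative (\<Sum>j\<in>S. g j * monomial j x y)) (at t within {0..})"
    unfolding S_def by (rule p_derivative[OF t i]) blast
  define dP where "dP x y = (\<Sum>j\<in>S. g j * monomial j x y)" for x y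
  have cdP: "continuous2 dP" unfolding dP_def by (intro continuous_on_sum continuous_on_mult continuous_on_const continuous2_monomial)
  have cAp: "continuous2 (\<lambda>x y. Ap t x y i)"
    unfolding Ap_def using t
    by (intro continuous_on_sum continuous_on_mult continuous_on_const continuous2_p) (auto simp: mem_tri)
  have orth: "\<mu> t (\<lambda>x y. (dP x y - Ap t x y i) * monomial l x y) = 0" if l: "l \<in> T" for l
  proof -
    have l': "index l" "fst l < fst i" using T(2)[OF l] by auto
    let ?a = "\<lambda>j. (fst j - snd j) + (fst l - snd l)" and ?b = "\<lambda>j. snd j + snd l"
    have lin: "\<mu> s (\<lambda>x y. c x y * (p s x y i * monomial l x y)) = (\<Sum>j\<in>S. coef i j s * \<mu> s (\<lambda>x y. c x y * (monomial j x y * monomial l x y)))"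
      if "s \<ge> 0" "continuous2 c" for s c
    proof -
      have "c x y * (p s x y i * monomial l x y) = (\<Sum>j\<in>S. coef i j s * (c x y * (monomial j x y * monomial l x y)))" for x y
        unfolding p_expansion[OF that(1) i] S_def by (simp add: sum_distrib_left sum_distrib_right mult_ac)
      then show ?thesis
        using that S by (simp add: wintegral_combination continuous_on_mult continuous2_monomial)
    qed
    have zero: "(\<Sum>j\<in>S. coef i j s * mom (?a j) (?b j) s) = 0" if "s \<ge> 0" for s
      using lin[OF that, of "\<lambda>_ _. 1"] p_orthogonal_monomial[OF that i l'] by (simp add: wintegral_monomials)
    have "((\<lambda>s. \<Sum>j\<in>S. coef i j s * mom (?a j) (?b j) s) has_real_derivative
       (\<Sum>j\<in>S. g j * mom (?a j) (?b j) t + (- mom (?a j + 1) (?b j) t - mom (?a j) (?b j + 1) t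
          + mom (?a j) (?b j) t * drift t) * coef i j t)) (at t within {0..})"
      using me t unfolding moment_equation_def by (intro DERIV_sum DERIV_mult g) auto
    moreover have "((\<lambda>s. \<Sum>j\<in>S. coef i j s * mom (?a j) (?b j) s) has_real_derivative 0) (at t within {0..})"
      by (rule has_real_derivative_cong_nonnegative[OF DERIV_const t]) (simp add: zero)
    ultimately have "(\<Sum>j\<in>S. g j * mom (?a j) (?b j) t + (- mom (?a j + 1) (?b j) t - mom (?a j) (?b j + 1) t
          + mom (?a j) (?b j) t * drift t) * coef i j t) = 0"
      using t by (rule DERIV_unique_nonnegative)
    also have "(\<Sum>j\<in>S. g j * mom (?a j) (?b j) t + (- mom (?a j + 1) (?b j) t - mom (?a j) (?b j + 1) t
          + mom (?a j) (?b j) t * drift t) * coef i j t)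
      = (\<Sum>j\<in>S. g j * mom (?a j) (?b j) t) - (\<Sum>j\<in>S. coef i j t * mom (?a j + 1) (?b j) t)
        - (\<Sum>j\<in>S. coef i j t * mom (?a j) (?b j + 1) t) + drift t * (\<Sum>j\<in>S. coef i j t * mom (?a j) (?b j) t)"
      by (simp add: sum_distrib_left sum.distrib[symmetric] sum_subtractf[symmetric] algebra_simps)
    also have "(\<Sum>j\<in>S. g j * mom (?a j) (?b j) t) = \<mu> t (\<lambda>x y. dP x y * monomial l x y)"
    proof -
      have "dP x y * monomial l x y = (\<Sum>j\<in>S. g j * (monomial j x y * monomial l x y))" for x y
        by (simp add: dP_def sum_distrib_right mult.assoc)
      then show ?thesis
        using t S by (simp add: wintegral_combination continuous_on_mult continuous2_monomial wintegral_monomials)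
    qed
    also have "(\<Sum>j\<in>S. coef i j t * mom (?a j + 1) (?b j) t) = \<mu> t (\<lambda>x y. coord 1 x y * (p t x y i * monomial l x y))"
      unfolding lin[OF t continuous2_coord] wintegral_coordinate_monomials by (rule refl)
    also have "(\<Sum>j\<in>S. coef i j t * mom (?a j) (?b j + 1) t) = \<mu> t (\<lambda>x y. coord 2 x y * (p t x y i * monomial l x y))"
      unfolding lin[OF t continuous2_coord] wintegral_coordinate_monomials by (rule refl)
    finally have "\<mu> t (\<lambda>x y. dP x y * monomial l x y) = \<mu> t (\<lambda>x y. Ap t x y i * monomial l x y)"
      using wintegral_x_plus_y_p[OF t i l'] zero[OF t] by simp
    then show ?thesis
      using wintegral_diff[OF t continuous_on_mult[OF cdP continuous2_monomial] continuous_on_mult[OF cAp continuous2_monomial]]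
      by (simp add: left_diff_distrib)
  qed
  \<comment> \<open>the coefficients of the defect, all of degree less than that of the polynomial \<open>i\<close>\<close>
  define b where "b l = g l - (\<Sum>j\<in>T. entry (A t) i j * coef j l t)" for l
  have Q: "dP x y - Ap t x y i = (\<Sum>l\<in>T. b l * monomial l x y)" for x y
  proof -
    have "dP x y = (\<Sum>l\<in>T. g l * monomial l x y)"
      unfolding dP_def using S g0 by (intro sum.mono_neutral_right) (auto simp: T_def)
    moreover have "Ap t x y i = (\<Sum>j\<in>T. entry (A t) i j * (\<Sum>l\<in>T. coef j l t * monomial l x y))"
    proof -
      have "Ap t x y i = (\<Sum>j\<in>T. entry (A t) i j * p t x y j)"
        unfolding Ap_def S_def[symmetric] using S entry_A[OF t i]
        by (intro sum.mono_neutral_right) (auto simp: T_def)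
      also have "\<dots> = (\<Sum>j\<in>T. entry (A t) i j * (\<Sum>l\<in>T. coef j l t * monomial l x y))"
      proof (intro sum.cong refl arg_cong2[where f="(*)"])
        fix j assume "j \<in> T"
        then have j: "index j" "fst j < fst i" using T(2) by auto
        have "p t x y j = (\<Sum>l\<in>tri (fst j). coef j l t * monomial l x y)" by (rule p_expansion[OF t j(1)])
        also have "\<dots> = (\<Sum>l\<in>T. coef j l t * monomial l x y)"
        proof (rule sum.mono_neutral_left[OF T(1)])
          show "tri (fst j) \<subseteq> T" using j by (auto simp: T_def S_def mem_tri)
          show "\<forall>l\<in>T - tri (fst j). coef j l t * monomial l x y = 0"
            using j T(2) by (auto simp: mem_tri coef_def)
        qed
        finally show "p t x y j = (\<Sum>l\<in>T. coef j l t * monomial l x y)" .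
      qed
      finally show ?thesis .
    qed
    moreover have "(\<Sum>j\<in>T. entry (A t) i j * (\<Sum>l\<in>T. coef j l t * monomial l x y))
        = (\<Sum>l\<in>T. (\<Sum>j\<in>T. entry (A t) i j * coef j l t) * monomial l x y)"
      by (simp add: sum_distrib_left sum_distrib_right mult.assoc) (rule sum.swap)
    ultimately show ?thesis by (simp add: b_def left_diff_distrib sum_subtractf)
  qed
  have "\<mu> t (\<lambda>x y. (dP x y - Ap t x y i) * (dP x y - Ap t x y i)) = 0"
  proof -
    have "(dP x y - Ap t x y i) * (dP x y - Ap t x y i)
        = (\<Sum>l\<in>T. b l * ((dP x y - Ap t x y i) * monomial l x y))" for x y
      using arg_cong[OF Q[of x y], of "\<lambda>q. (dP x y - Ap t x y i) * q"]
      by (simp add: sum_distrib_left mult.left_commute)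
    then have "\<mu> t (\<lambda>x y. (dP x y - Ap t x y i) * (dP x y - Ap t x y i))
        = (\<Sum>l\<in>T. b l * \<mu> t (\<lambda>x y. (dP x y - Ap t x y i) * monomial l x y))"
      using t T(1) cdP cAp
      by (simp add: wintegral_combination continuous_on_mult continuous_on_diff continuous2_monomial)
    then show ?thesis by (simp add: orth)
  qed
  then have "dP x0 y0 - Ap t x0 y0 i = 0"
    by (intro zero_if_square_integral_zero[OF t, where q="\<lambda>x y. dP x y - Ap t x y i" and I=T and c=b
          and a="\<lambda>l. fst l - snd l" and b=snd]) (simp_all add: Q monomial_def mult.assoc)
  then show "((\<lambda>s. p s x0 y0 i) has_real_derivative Ap t x0 y0 i) (at t within {0..})"
    using dp[of x0 y0] by (simp add: dP_def)
qed

lemma A_mult_block: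
  assumes t: "t \<ge> 0" and N: "banded v N"
  shows "bmat_mult (A t) N m n = (if m = 0 then 0\<^sub>m (m + 1) (n + 1) else sum12 C m t * N (m - 1) n)"
proof (cases "m = 0")
  case True
  have "bmat_mult (A t) N m n $$ (r, c) = 0" if "r \<le> m" "c \<le> n" for r c
    using bmat_mult_block[OF banded_A[OF t] N, of "{}" m n r c] that True by (simp add: Amat_def)
  then show ?thesis using True by (intro eq_matI) (auto simp: bmat_mult_def)
next
  case False
  then have car: "sum12 C m t \<in> carrier_mat (m + 1) m" "N (m - 1) n \<in> carrier_mat m (n + 1)"
    using C12_carrier[OF t, of m] banded_carrier[OF N, of "m - 1" n] by auto
  have "bmat_mult (A t) N m n $$ (r, c) = (sum12 C m t * N (m - 1) n) $$ (r, c)" if "r \<le> m" "c \<le> n" for r c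
    using bmat_mult_block[OF banded_A[OF t] N, of "{m - 1}" m n r c] that False
    by (cases m) (auto simp: Amat_def)
  then show ?thesis using False car by (intro eq_matI) (auto simp: bmat_mult_def)
qed

lemma mult_A_block:
  assumes t: "t \<ge> 0" and M: "banded w M"
  shows "bmat_mult M (A t) m n = M m (n + 1) * sum12 C (n + 1) t"
proof (rule eq_matI)
  have car: "M m (n + 1) \<in> carrier_mat (m + 1) (n + 2)" "sum12 C (n + 1) t \<in> carrier_mat (n + 2) (n + 1)"
    using C12_carrier[OF t, of "n + 1"] banded_carrier[OF M, of m "n + 1"] by auto
  fix r c assume "r < dim_row (M m (n + 1) * sum12 C (n + 1) t)" "c < dim_col (M m (n + 1) * sum12 C (n + 1) t)"
  then have "r \<le> m" "c \<le> n" using car by auto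
  then show "bmat_mult M (A t) m n $$ (r, c) = (M m (n + 1) * sum12 C (n + 1) t) $$ (r, c)"
    using bmat_mult_block[OF M banded_A[OF t], of "{n + 1}" m n r c] by (auto simp: Amat_def)
qed (use C12_carrier[OF t, of "n + 1"] banded_carrier[OF M, of m "n + 1"] in \<open>auto simp: bmat_mult_def\<close>)

lemma commutator_block:
  assumes "t \<ge> 0" "e \<in> {1, 2}"
  shows "bmat_comm (A t) (J e t) m n
    = (if m = 0 then 0\<^sub>m (m + 1) (n + 1) else sum12 C m t * J e t (m - 1) n) - J e t m (n + 1) * sum12 C (n + 1) t"
  unfolding bmat_comm_def A_mult_block[OF assms(1) banded_J[OF assms]] mult_A_block[OF assms(1) banded_J[OF assms]]
  by (rule refl)

lemma commutator_diagonal_block: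
  assumes "t \<ge> 0" "e \<in> {1, 2}" "n \<ge> 1"
  shows "bmat_comm (A t) (J e t) n n = sum12 C n t * L (n - 1) e - L n e * sum12 C (n + 1) t"
  using assms by (cases n) (simp_all add: commutator_block Jmat_def)

lemma commutator_lower_block:
  assumes "t \<ge> 0" "e \<in> {1, 2}"
  shows "bmat_comm (A t) (J e t) (n + 1) n = sum12 C (n + 1) t * D n e t - D (n + 1) e t * sum12 C (n + 1) t"
  using assms by (simp add: commutator_block Jmat_def)

text \<open>Both products of \<open>J 1\<close> and \<open>J 2\<close> expand \<open>x * y\<close> times the polynomials of the system.\<close>

lemma J_commute:
  assumes t: "t \<ge> 0" shows "bmat_mult (J 1 t) (J 2 t) = bmat_mult (J 2 t) (J 1 t)"
proof -
  have 1: "represents 2 (bmat_mult (J 1 t) (J 2 t)) (\<lambda>j. coord 1 x y * coord 2 x y * p t x y j) (p t x y)" for x y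
    using represents_mult[OF represents_scale[OF represents_J[OF t, of 1 x y], of "coord 2 x y"] represents_J[OF t, of 2 x y]]
    by (simp add: mult_ac numeral_2_eq_2)
  have 2: "represents 2 (bmat_mult (J 2 t) (J 1 t)) (\<lambda>j. coord 1 x y * coord 2 x y * p t x y j) (p t x y)" for x y
    using represents_mult[OF represents_scale[OF represents_J[OF t, of 2 x y], of "coord 1 x y"] represents_J[OF t, of 1 x y]]
    by (simp add: mult_ac numeral_2_eq_2)
  show ?thesis
    by (rule banded_eqI[OF represents_banded[OF 1] represents_banded[OF 2] represents_unique[OF t 1 2]])
qed

text \<open>These products are the blocks of \<open>J\<^sub>1 J\<^sub>2\<close> and \<open>J\<^sub>2 J\<^sub>1\<close> two below the diagonal.\<close>

lemma C_C_commute: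
  assumes t: "t \<ge> 0"
  shows "C (n + 2) 1 t * C (n + 1) 2 t = C (n + 2) 2 t * C (n + 1) 1 t"
proof -
  have block: "bmat_mult (J e t) (J e' t) (n + 2) n = C (n + 2) e t * C (n + 1) e' t"
    if e: "e \<in> {1, 2}" "e' \<in> {1, 2}" for e e'
  proof (rule eq_matI)
    fix r c assume "r < dim_row (C (n + 2) e t * C (n + 1) e' t)" "c < dim_col (C (n + 2) e t * C (n + 1) e' t)"
    then have "r \<le> n + 2" "c \<le> n" using C_carrier[OF t e(1), of "n + 2"] C_carrier[OF t e(2), of "n + 1"] by auto
    then show "bmat_mult (J e t) (J e' t) (n + 2) n $$ (r, c) = (C (n + 2) e t * C (n + 1) e' t) $$ (r, c)"
      using bmat_mult_block[OF banded_J[OF t e(1)] banded_J[OF t e(2)], of "{n + 1}" "n + 2" n r c]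
      by (auto simp: Jmat_def)
  qed (use C_carrier[OF t e(1), of "n + 2"] C_carrier[OF t e(2), of "n + 1"] in \<open>auto simp: bmat_mult_def\<close>)
  show ?thesis using block[of 1 2] block[of 2 1] J_commute[OF t] by simp
qed

text \<open>With \<open>A\<close> as the sum of the lower parts of \<open>J\<^sub>1\<close> and \<open>J\<^sub>2\<close>, all terms cancel by the previous relation.\<close>

lemma commutator_second_lower_block:
  assumes t: "t \<ge> 0" and e: "e \<in> {1, 2}"
  shows "bmat_comm (A t) (J e t) (n + 2) n = 0\<^sub>m (n + 3) (n + 1)"
proof -
  let ?X = "\<lambda>e. C (n + 2) e t" and ?Y = "\<lambda>e. C (n + 1) e t"
  have X: "?X 1 \<in> carrier_mat (n + 3) (n + 2)" "?X 2 \<in> carrier_mat (n + 3) (n + 2)"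
    and Y: "?Y 1 \<in> carrier_mat (n + 2) (n + 1)" "?Y 2 \<in> carrier_mat (n + 2) (n + 1)"
    using C_carrier[OF t, of _ "n + 2"] C_carrier[OF t, of _ "n + 1"] by (auto simp: numeral_3_eq_3)
  have "bmat_comm (A t) (J e t) (n + 2) n = (?X 1 + ?X 2) * ?Y e - ?X e * (?Y 1 + ?Y 2)"
    using t e by (simp add: commutator_block Jmat_def sum12_def)
  also have "\<dots> = (?X 1 * ?Y e + ?X 2 * ?Y e) - (?X e * ?Y 1 + ?X e * ?Y 2)"
  proof -
    have e': "?X e \<in> carrier_mat (n + 3) (n + 2)" "?Y e \<in> carrier_mat (n + 2) (n + 1)" using e X Y by auto
    show ?thesis
      unfolding add_mult_distrib_mat[OF X e'(2)] mult_add_distrib_mat[OF e'(1) Y] by (rule refl)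
  qed
  also have "\<dots> = 0\<^sub>m (n + 3) (n + 1)"
    using e X Y C_C_commute[OF t, of n] by (intro eq_matI) auto
  finally show ?thesis .
qed

lemma commutator_zero_block:
  assumes t: "t \<ge> 0" and e: "e \<in> {1, 2}" and mn: "m \<noteq> n" "m \<noteq> n + 1"
  shows "bmat_comm (A t) (J e t) m n = 0\<^sub>m (m + 1) (n + 1)"
proof (cases "m = n + 2")
  case True
  then show ?thesis using commutator_second_lower_block[OF t e, of n] by (simp add: numeral_3_eq_3)
next
  case False
  have "J e t m (n + 1) = 0\<^sub>m (m + 1) (n + 2)" using mn False by (auto simp: Jmat_def)
  moreover have "m \<noteq> 0 \<Longrightarrow> J e t (m - 1) n = 0\<^sub>m m (n + 1)" using mn False by (auto simp: Jmat_def)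
  moreover have "m \<noteq> 0 \<Longrightarrow> sum12 C m t \<in> carrier_mat (m + 1) m" "sum12 C (n + 1) t \<in> carrier_mat (n + 2) (n + 1)"
    using C12_carrier[OF t, of m] C12_carrier[OF t, of "n + 1"] by auto
  ultimately show ?thesis
    unfolding commutator_block[OF t e] by (intro eq_matI) auto
qed

text \<open>The block \<open>(0, 1)\<close> of \<open>J\<^sub>1 J\<^sub>2 = J\<^sub>2 J\<^sub>1\<close>, where \<open>L\<^sub>0\<^sub>,\<^sub>1\<close> and \<open>L\<^sub>0\<^sub>,\<^sub>2\<close> are unit row vectors.\<close>

lemma D_0_eq:
  assumes t: "t \<ge> 0"
  shows "D 0 1 t $$ (0, 0) = D 1 1 t $$ (1, 1) - D 1 2 t $$ (0, 1)"
    and "D 0 2 t $$ (0, 0) = D 1 2 t $$ (0, 0) - D 1 1 t $$ (1, 0)"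
proof -
  have tri_1: "tri (Suc 0) = {(0, 0), (1, 0), (1, 1)}" by (auto simp: mem_tri le_Suc_eq)
  have eq: "(\<Sum>l\<in>tri 1. entry (J 1 t) (0, 0) l * entry (J 2 t) l (1, c)) = (\<Sum>l\<in>tri 1. entry (J 2 t) (0, 0) l * entry (J 1 t) l (1, c))"
    if "c \<le> 1" for c
    using entry_mult[OF banded_J[OF t, of 1] banded_J[OF t, of 2], of "(0, 0)" "(1, c)" 1]
      entry_mult[OF banded_J[OF t, of 2] banded_J[OF t, of 1], of "(0, 0)" "(1, c)" 1] J_commute[OF t] that by simp
  show "D 0 1 t $$ (0, 0) = D 1 1 t $$ (1, 1) - D 1 2 t $$ (0, 1)"
    using eq[of 1] by (simp add: tri_1 entry_def Jmat_def L_def)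
  show "D 0 2 t $$ (0, 0) = D 1 2 t $$ (0, 0) - D 1 1 t $$ (1, 0)"
    using eq[of 0] by (simp add: tri_1 entry_def Jmat_def L_def)
qed

definition component_equations :: bool where
  "component_equations \<longleftrightarrow> (\<forall>t\<ge>0. \<forall>n\<ge>1. \<forall>i\<in>{1, 2}.
        mat_has_deriv (D n i) (sum12 C n t * L (n - 1) i - L n i * sum12 C (n + 1) t) t \<and>
        mat_has_deriv (C n i) (sum12 C n t * D (n - 1) i t - D n i t * sum12 C n t) t)"

text \<open>The component equations do not prescribe the derivative of \<open>D\<^sub>0\<close>. Commutation of \<open>J 1\<close> and \<open>J 2\<close> expresses \<open>D\<^sub>0\<close> by
  entries of \<open>D\<^sub>1\<close>, and the terms with \<open>C\<^sub>2\<close> cancel in its derivative.\<close>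

lemma D_0_derivative:
  assumes ce: component_equations and t: "t \<ge> 0" and e: "e \<in> {1, 2}"
  shows "mat_has_deriv (D 0 e) (bmat_comm (A t) (J e t) 0 0) t"
proof -
  let ?C1 = "sum12 C 1 t" and ?C2 = "sum12 C 2 t"
  have C1: "?C1 \<in> carrier_mat 2 (0 + 1)" and C2: "?C2 \<in> carrier_mat (2 + 1) 2"
    using C12_carrier[OF t, of 1] C12_carrier[OF t, of 2] by (auto simp: numeral_2_eq_2 numeral_3_eq_3)
  have Ls: "L 0 e \<in> carrier_mat (0 + 1) 2" "L 1 e \<in> carrier_mat 2 (2 + 1)" for e by (auto simp: L_def numeral_2_eq_2 numeral_3_eq_3)
  have D1: "((\<lambda>s. D 1 e s $$ (r, c)) has_real_derivative
      (if c = (if e = 1 then 0 else 1) then ?C1 $$ (r, 0) else 0) - ?C2 $$ (if e = 1 then r else r + 1, c)) (at t within {0..})"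
    if e: "e \<in> {1, 2}" and rc: "r < 2" "c < 2" for e r c
  proof -
    let ?X = "?C1 * L 0 e - L 1 e * ?C2"
    have "mat_has_deriv (D 1 e) (sum12 C 1 t * L (1 - 1) e - L 1 e * sum12 C (1 + 1) t) t"
      using ce t e unfolding component_equations_def by (meson le_refl)
    then have md: "mat_has_deriv (D 1 e) ?X t" by (simp only: diff_self_eq_0 one_add_one)
    have dim: "dim_row ?X = 2" "dim_col ?X = 2" using Ls C1 C2 by auto
    have "\<forall>r<2. \<forall>c<2. ((\<lambda>s. D 1 e s $$ (r, c)) has_real_derivative ?X $$ (r, c)) (at t within {0..})"
      using md unfolding mat_has_deriv_def dim by blast
    then have deriv: "((\<lambda>s. D 1 e s $$ (r, c)) has_real_derivative ?X $$ (r, c)) (at t within {0..})"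
      using rc by blast
    have X: "?X $$ (r, c) = (?C1 * L 0 e) $$ (r, c) - (L 1 e * ?C2) $$ (r, c)"
      using rc Ls[of e] C2 by (intro index_minus_mat) auto
    have X1: "(?C1 * L 0 e) $$ (r, c) = (if c = (if e = 1 then 0 else 1) then ?C1 $$ (r, 0) else 0)"
      using rc by (subst mult_entry[OF C1 Ls(1)]) (auto simp: L_def)
    have X2: "(L 1 e * ?C2) $$ (r, c) = ?C2 $$ (if e = 1 then r else r + 1, c)"
    proof -
      have "(L 1 e * ?C2) $$ (r, c) = (\<Sum>l\<le>2. L 1 e $$ (r, l) * ?C2 $$ (l, c))"
        using rc by (intro mult_entry[OF Ls(2) C2])
      also have "\<dots> = (\<Sum>l\<le>2. if l = (if e = 1 then r else r + 1) then ?C2 $$ (l, c) else 0)"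
        using rc by (intro sum.cong) (auto simp: L_def)
      finally show ?thesis using rc by (simp add: sum.delta)
    qed
    show ?thesis using deriv unfolding X X1 X2 .
  qed
  have X: "bmat_comm (A t) (J e t) 0 0 $$ (0, 0) = - ?C1 $$ (if e = 1 then 0 else 1, 0)"
  proof -
    have "(L 0 e * ?C1) $$ (0, 0) = (\<Sum>l\<le>1. L 0 e $$ (0, l) * ?C1 $$ (l, 0))"
      by (rule mult_entry) (use Ls[of e] C1 in \<open>auto simp: numeral_2_eq_2\<close>)
    also have "\<dots> = ?C1 $$ (if e = 1 then 0 else 1, 0)" by (simp add: L_def)
    finally show ?thesis
      using Ls[of e] C1 by (simp add: commutator_block[OF t e] Jmat_def)
  qed
  have "((\<lambda>s. D 0 e s $$ (0, 0)) has_real_derivative bmat_comm (A t) (J e t) 0 0 $$ (0, 0)) (at t within {0..})"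
  proof (cases "e = 1")
    case True
    have "((\<lambda>s. D 1 1 s $$ (1, 1) - D 1 2 s $$ (0, 1)) has_real_derivative - ?C1 $$ (0, 0)) (at t within {0..})"
      using DERIV_diff[OF D1[of 1 1 1] D1[of 2 0 1]] by simp
    then have "((\<lambda>s. D 0 1 s $$ (0, 0)) has_real_derivative - ?C1 $$ (0, 0)) (at t within {0..})"
      by (rule has_real_derivative_cong_nonnegative[OF _ t]) (rule D_0_eq(1)[symmetric])
    then show ?thesis unfolding X using True by simp
  next
    case False
    then have e2: "e = 2" using e by simp
    have "((\<lambda>s. D 1 2 s $$ (0, 0) - D 1 1 s $$ (1, 0)) has_real_derivative - ?C1 $$ (1, 0)) (at t within {0..})"
      using DERIV_diff[OF D1[of 2 0 0] D1[of 1 1 0]] by simp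
    then have "((\<lambda>s. D 0 2 s $$ (0, 0)) has_real_derivative - ?C1 $$ (1, 0)) (at t within {0..})"
      by (rule has_real_derivative_cong_nonnegative[OF _ t]) (rule D_0_eq(2)[symmetric])
    then show ?thesis unfolding X using e2 by simp
  qed
  moreover have "bmat_comm (A t) (J e t) 0 0 \<in> carrier_mat 1 1"
    using bmat_comm_carrier[of "A t" "J e t" 0 0] by simp
  ultimately show ?thesis
    using D_carrier[OF _ e, of _ 0] by (auto simp: mat_has_deriv_def)
qed

lemma component_equations_iff: "component_equations \<longleftrightarrow> Lax_equation"
proof
  assume ce: component_equations
  show Lax_equation
    unfolding Lax_equation_def bmat_has_deriv_def
  proof (intro allI impI ballI)
    fix t :: real and e m n :: nat assume t: "t \<ge> 0" and e: "e \<in> {1, 2}"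
    consider "m = n" "n = 0" | "m = n" "n \<ge> 1" | "m = n + 1" | "m \<noteq> n" "m \<noteq> n + 1" by linarith
    then show "mat_has_deriv (\<lambda>s. J e s m n) (bmat_comm (A t) (J e t) m n) t"
    proof cases
      case 1
      then show ?thesis using D_0_derivative[OF ce t e] by (simp add: Jmat_def)
    next
      case 2
      have "mat_has_deriv (D n e) (sum12 C n t * L (n - 1) e - L n e * sum12 C (n + 1) t) t"
        using ce t e 2(2) unfolding component_equations_def by blast
      then show ?thesis
        using 2 commutator_diagonal_block[OF t e 2(2)] by (simp add: Jmat_def)
    next
      case 3
      have "mat_has_deriv (C (n + 1) e) (sum12 C (n + 1) t * D (n + 1 - 1) e t - D (n + 1) e t * sum12 C (n + 1) t) t"
        using ce t e unfolding component_equations_def by (metis le_add2)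
      then show ?thesis
        using 3 commutator_lower_block[OF t e, of n] by (simp add: Jmat_def)
    next
      case 4
      then have const: "(\<lambda>s. J e s m n) = (\<lambda>_. J e t m n)" by (intro ext) (simp add: Jmat_def)
      show ?thesis
        unfolding commutator_zero_block[OF t e 4] const
        by (rule mat_has_deriv_const_zero[OF banded_carrier[OF banded_J[OF t e]]])
    qed
  qed
next
  assume lax: Lax_equation
  show component_equations
    unfolding component_equations_def
  proof (intro allI impI ballI)
    fix t :: real and n e :: nat assume t: "t \<ge> 0" and n: "n \<ge> 1" and e: "e \<in> {1, 2}"
    have d: "mat_has_deriv (\<lambda>s. J e s m n) (bmat_comm (A t) (J e t) m n) t" for m n
      using lax t e unfolding Lax_equation_def bmat_has_deriv_def by blast
    obtain k where k: "n = k + 1" using n by (metis add.commute le_Suc_ex)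
    have "mat_has_deriv (D n e) (sum12 C n t * L (n - 1) e - L n e * sum12 C (n + 1) t) t"
      using d[of n n] commutator_diagonal_block[OF t e n] by (simp add: Jmat_def)
    moreover have "mat_has_deriv (C n e) (sum12 C n t * D (n - 1) e t - D n e t * sum12 C n t) t"
      using d[of "k + 1" k] commutator_lower_block[OF t e, of k] k by (simp add: Jmat_def)
    ultimately show "mat_has_deriv (D n e) (sum12 C n t * L (n - 1) e - L n e * sum12 C (n + 1) t) t \<and>
        mat_has_deriv (C n e) (sum12 C n t * D (n - 1) e t - D n e t * sum12 C n t) t" ..
  qed
qed

lemma equivalences:
  "component_equations \<longleftrightarrow> moment_equation" "Lax_equation \<longleftrightarrow> moment_equation"
  "product_equation \<longleftrightarrow> moment_equation" "polynomial_equation \<longleftrightarrow> moment_equation"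
  "weight_equation \<longleftrightarrow> moment_equation" "weight_formula \<longleftrightarrow> moment_equation"
  using component_equations_iff Lax_equation_imp_polynomial_equation
    polynomial_equation_imp_product_equation product_equation_imp_Lax_equation
    product_equation_imp_moment_equation moment_equation_imp_polynomial_equation
    moment_equation_imp_weight_formula weight_formula_imp_weight_equation
    weight_equation_imp_weight_formula weight_formula_imp_moment_equation
  by blast+

end

lemma all_equivalentI:
  "(\<And>p. p \<in> set ps \<Longrightarrow> p \<longleftrightarrow> q) \<Longrightarrow> all_equivalent ps"
  by (auto simp: all_equivalent_def)

section \<open>Equivalence\<close>

theorem theorem3p1:
  fixes \<Omega> :: "(real \<times> real) set"
    and \<omega> :: "real \<Rightarrow> real \<Rightarrow> real \<Rightarrow> real"
    and G D C :: "nat \<Rightarrow> nat \<Rightarrow> real \<Rightarrow> real mat"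
    and D0 :: "real \<Rightarrow> real"
  assumes weight: "normalized_weight \<Omega> \<omega>"
    and mops: "monic_ops \<Omega> \<omega> G"
    and ttr: "three_term G D C"
    and D0: "\<And>t. D0 t = sum12 D 0 t $$ (0, 0)"
    and diff_weight: "\<And>t x y. t \<ge> 0 \<Longrightarrow> (x, y) \<in> \<Omega> \<Longrightarrow> (\<lambda>s. \<omega> x y s) differentiable (at t within {0..})"
    and diff_moment: "\<And>t h k. t \<ge> 0 \<Longrightarrow> (\<lambda>s. moment \<Omega> \<omega> h k s) differentiable (at t within {0..})"
    and diff_G: "\<And>t n m. t \<ge> 0 \<Longrightarrow> m < n \<Longrightarrow> mat_differentiable (G n m) t"
    and diff_D: "\<And>t n i. t \<ge> 0 \<Longrightarrow> i \<in> {1, 2} \<Longrightarrow> mat_differentiable (D n i) t"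
    and diff_C: "\<And>t n i. t \<ge> 0 \<Longrightarrow> n \<ge> 1 \<Longrightarrow> i \<in> {1, 2} \<Longrightarrow> mat_differentiable (C n i) t"
  shows "all_equivalent
    [ \<comment> \<open>(i)\<close>
      \<forall>t\<ge>0. \<forall>n\<ge>1. \<forall>i\<in>{1, 2}.
        mat_has_deriv (D n i) (sum12 C n t * L (n - 1) i - L n i * sum12 C (n + 1) t) t \<and>
        mat_has_deriv (C n i) (sum12 C n t * D (n - 1) i t - D n i t * sum12 C n t) t,
      \<comment> \<open>(ii)\<close>
      \<forall>t\<ge>0. \<forall>i\<in>{1, 2}. bmat_has_deriv (Jmat D C i) (bmat_comm (Amat C t) (Jmat D C i t)) t,
      \<comment> \<open>(iii)\<close>
      \<forall>t\<ge>0. \<forall>h k.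
        bmat_has_deriv
          (\<lambda>s. bmat_mult (bmat_pow (Jmat D C 1 s) h) (bmat_pow (Jmat D C 2 s) k))
          (bmat_comm (Amat C t)
            (bmat_mult (bmat_pow (Jmat D C 1 t) h) (bmat_pow (Jmat D C 2 t) k))) t,
      \<comment> \<open>(iv)\<close>
      \<forall>t\<ge>0. \<forall>h k.
        ((\<lambda>s. moment \<Omega> \<omega> h k s) has_real_derivative
           - moment \<Omega> \<omega> (h + 1) k t - moment \<Omega> \<omega> h (k + 1) t
           + moment \<Omega> \<omega> h k t * (moment \<Omega> \<omega> 1 0 t + moment \<Omega> \<omega> 0 1 t)) (at t within {0..}),
      \<comment> \<open>(v)\<close>
      \<forall>t\<ge>0.
        dseries_has_deriv (stieltjes \<Omega> \<omega>)
          ((fls_const (fls_const (D0 t)) - z1 - z2) * stieltjes \<Omega> \<omega> t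
            + stieltjes10 \<Omega> \<omega> t + stieltjes20 \<Omega> \<omega> t) t,
      \<comment> \<open>(vi)\<close>
      \<forall>t\<ge>0. AE (x, y) in lebesgue. (x, y) \<in> \<Omega> \<longrightarrow>
        ((\<lambda>s. \<omega> x y s) has_real_derivative - (x + y - D0 t) * \<omega> x y t) (at t within {0..}),
      \<comment> \<open>(vii)\<close>
      \<forall>t\<ge>0. AE (x, y) in lebesgue. (x, y) \<in> \<Omega> \<longrightarrow>
        \<omega> x y t = exp (- (x + y) * t) * \<omega> x y 0
          / (LINT (x, y):\<Omega>|lebesgue. exp (- (x + y) * t) * \<omega> x y 0),
      \<comment> \<open>(viii)\<close>
      \<forall>n\<ge>1. \<forall>t\<ge>0. \<forall>x y.
        vec_has_deriv (\<lambda>s. Pvec G n s x y) (sum12 C n t *\<^sub>v Pvec G (n - 1) t x y) t ]"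
proof -
  interpret matrix_flow \<Omega> \<omega> G D C
    by unfold_locales (fact weight diff_weight diff_moment mops ttr diff_G diff_D diff_C)+
  have D0_eq: "D0 t = drift t" if "t \<ge> 0" for t
    using drift_eq_D0(2)[OF that] by (simp add: D0)
  show ?thesis
  proof (rule all_equivalentI[where q=moment_equation], unfold list.set insert_iff empty_iff, elim disjE, goal_cases)
    case (1 q)
    then show ?case
      by (simp only: component_equations_def[symmetric] equivalences)
  next
    case (2 q)
    then show ?case
      by (simp only: Lax_equation_def[symmetric] equivalences)
  next
    case (3 q)
    then show ?case
      by (simp only: product_equation_def[unfolded JJ_def[abs_def], symmetric] equivalences)
  next
    case (4 q)
    then show ?case
      by (simp only: moment_equation_def drift_def)
  next
    case (5 q)
    then show ?case
      by (simp only: stieltjes_equation_iff moment_equation_def) (simp add: D0_eq)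
  next
    case (6 q)
    have "q = weight_equation" unfolding 6 weight_equation_def by (simp add: D0_eq)
    then show ?case by (simp only: equivalences)
  next
    case (7 q)
    then show ?case
      by (simp only: weight_formula_def[symmetric] equivalences)
  next
    case (8 q)
    then show ?case
      by (simp only: polynomial_equation_iff[symmetric] equivalences)
  qed simp
qed

end
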